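(* Let $\alpha,\beta>-1$, let $g\in H(\mathbb{D})$, and let $0<p<q<\infty$. Define the measure $\mu_{g,q,\beta}$ on $\mathbb{D}$ by $d\mu_{g,q,\beta}(z)=(1-|z|^2)^\beta|g'(z)|^q\,dA(z)$. Then the following statements hold. (1) If $p<\alpha+2$, then $T_g:D_\alpha^p\to D_\beta^q$ is compact if and only if $\mu_{g,q,\beta}$ is a vanishing $\frac{q(\alpha+2-p)}{p}$-Carleson measure. (2) If $p=\alpha+2$, then $T_g:D_\alpha^p\to D_\beta^q$ is compact if and only if $\mu_{g,q,\beta}(S(I))=o\left(\left(\log\frac{1}{|I|}\right)^{(1/p-1)q}\right)$ as $|I|\to0$. (3) If $p>\alpha+2$, then $T_g:D_\alpha^p\to D_\beta^q$ is compact if and only if $\mu_{g,q,\beta}$ is a finite measure, or equivalently, if and only if $g\in D_\beta^q$.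
   Context: $\mathbb{D}$ is the open unit disk in $\mathbb{C}$, $H(\mathbb{D})$ is the space of analytic functions on $\mathbb{D}$, and $dA(z)=\frac1\pi\,dx\,dy$ is normalized area measure. For $0<p<\infty$ and $\alpha>-1$, the weighted Dirichlet space $D_\alpha^p$ is the set of $f\in H(\mathbb{D})$ with $\|f\|_{D_\alpha^p}=\left(|f(0)|^p+\int_{\mathbb{D}}|f'(z)|^p(1-|z|^2)^\alpha\,dA(z)\right)^{1/p}<\infty$. (For $p<1$ this is only a quasi-norm.) For $g\in H(\mathbb{D})$, the Volterra type operator is $(T_gf)(z)=\int_0^z f(\omega)g'(\omega)\,d\omega$, $f\in H(\mathbb{D})$. An operator $T:D_\alpha^p\to D_\beta^q$ is compact if it maps $D_\alpha^p$ into $D_\beta^q$ and sends bounded sets to relatively compact sets. For an interval (arc) $I\subset\partial\mathbb{D}$, $|I|$ is its normalized length (so $|\partial\mathbb{D}|=1$), and the Carleson square is $S(I)=\{re^{i\theta}: e^{i\theta}\in I,\ 1-|I|\le r<1\}$. For $s>0$, a positive Borel measure $\mu$ on $\mathbb{D}$ is a vanishing $s$-Carleson measure if $\mu(S(I))=o(|I|^s)$ as $|I|\to0$ (uniformly over intervals $I\subset\partial\mathbb{D}$ of length tending to $0$). The $o$-condition in (2) is likewise uniform over intervals. *)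

theory Defs
  imports "HOL-Complex_Analysis.Complex_Analysis"
begin

abbreviation unit_disk :: "complex set" where
  "unit_disk \<equiv> ball 0 1"

text \<open>Functions on the disk are total functions on the plane.  Requiring the value \<open>0\<close>
  off the disk gives each analytic function on the disk exactly one representative.\<close>

definition disk_analytic :: "(complex \<Rightarrow> complex) set" where
  "disk_analytic = {f. f holomorphic_on unit_disk \<and> (\<forall>z. z \<notin> unit_disk \<longrightarrow> f z = 0)}"

definition disk_area :: "complex measure" where
  "disk_area = scale_measure (ennreal (1 / pi)) (restrict_space lborel unit_disk)"

definition dirichlet_density :: "real \<Rightarrow> real \<Rightarrow> (complex \<Rightarrow> complex) \<Rightarrow> complex \<Rightarrow> real" where
  "dirichlet_density \<alpha> p f z = cmod (deriv f z) powr p * (1 - (cmod z)\<^sup>2) powr \<alpha>"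

text \<open>The density is nonnegative, and measurable for \<open>f\<close> analytic, so integrability below is
  finiteness of the integral; the value of \<open>dirichlet_norm\<close> is meaningful only on the space.\<close>

definition dirichlet_norm :: "real \<Rightarrow> real \<Rightarrow> (complex \<Rightarrow> complex) \<Rightarrow> real" where
  "dirichlet_norm \<alpha> p f =
     (cmod (f 0) powr p + (\<integral>z. dirichlet_density \<alpha> p f z \<partial>disk_area)) powr (1 / p)"

definition dirichlet_space :: "real \<Rightarrow> real \<Rightarrow> (complex \<Rightarrow> complex) set" where
  "dirichlet_space \<alpha> p =
     {f \<in> disk_analytic. integrable disk_area (dirichlet_density \<alpha> p f)}"

text \<open>Since \<open>dirichlet_norm\<close> is only a quasi-norm for \<open>p < 1\<close>, its topology is
  described directly through its balls.\<close>

definition dirichlet_topology :: "real \<Rightarrow> real \<Rightarrow> (complex \<Rightarrow> complex) topology" where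
  "dirichlet_topology \<alpha> p = topology (\<lambda>U. U \<subseteq> dirichlet_space \<alpha> p \<and>
     (\<forall>f\<in>U. \<exists>r>0. \<forall>h\<in>dirichlet_space \<alpha> p.
        dirichlet_norm \<alpha> p (\<lambda>z. h z - f z) < r \<longrightarrow> h \<in> U))"

lemma openin_dirichlet_topology:
  "openin (dirichlet_topology \<alpha> p) U \<longleftrightarrow> U \<subseteq> dirichlet_space \<alpha> p \<and>
     (\<forall>f\<in>U. \<exists>r>0. \<forall>h\<in>dirichlet_space \<alpha> p.
        dirichlet_norm \<alpha> p (\<lambda>z. h z - f z) < r \<longrightarrow> h \<in> U)"
proof -
  let ?B = "\<lambda>f r U. \<forall>h\<in>dirichlet_space \<alpha> p. dirichlet_norm \<alpha> p (\<lambda>z. h z - f z) < r \<longrightarrow> h \<in> U"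
  have "istopology (\<lambda>U. U \<subseteq> dirichlet_space \<alpha> p \<and> (\<forall>f\<in>U. \<exists>r>0. ?B f r U))"
    unfolding istopology_def
  proof (intro conjI allI impI ballI, goal_cases)
    case (2 S T f)
    then obtain r s where "r > 0" "?B f r S" "s > 0" "?B f s T" by blast
    then show ?case by (intro exI[of _ "min r s"]) auto
  next
    case (4 K f)
    then obtain S r where "S \<in> K" "r > 0" "?B f r S" by blast
    then show ?case by blast
  qed blast+
  then show ?thesis
    by (simp add: dirichlet_topology_def topology_inverse')
qed

lemma topspace_dirichlet_topology: "topspace (dirichlet_topology \<alpha> p) = dirichlet_space \<alpha> p"
proof
  show "topspace (dirichlet_topology \<alpha> p) \<subseteq> dirichlet_space \<alpha> p"
    using openin_dirichlet_topology openin_topspace by blast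
  show "dirichlet_space \<alpha> p \<subseteq> topspace (dirichlet_topology \<alpha> p)"
    by (rule openin_subset) (auto simp: openin_dirichlet_topology intro: exI[of _ 1])
qed

definition dirichlet_bounded :: "real \<Rightarrow> real \<Rightarrow> (complex \<Rightarrow> complex) set \<Rightarrow> bool" where
  "dirichlet_bounded \<alpha> p S \<longleftrightarrow>
     S \<subseteq> dirichlet_space \<alpha> p \<and> (\<exists>C. \<forall>f\<in>S. dirichlet_norm \<alpha> p f \<le> C)"

definition relatively_compactin :: "'a topology \<Rightarrow> 'a set \<Rightarrow> bool" where
  "relatively_compactin X S \<longleftrightarrow> S \<subseteq> topspace X \<and> compactin X (X closure_of S)"

definition compact_dirichlet_operator ::
    "real \<Rightarrow> real \<Rightarrow> real \<Rightarrow> real \<Rightarrow> ((complex \<Rightarrow> complex) \<Rightarrow> complex \<Rightarrow> complex) \<Rightarrow> bool" where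
  "compact_dirichlet_operator \<alpha> p \<beta> q T \<longleftrightarrow>
     T ` dirichlet_space \<alpha> p \<subseteq> dirichlet_space \<beta> q \<and>
     (\<forall>S. dirichlet_bounded \<alpha> p S \<longrightarrow> relatively_compactin (dirichlet_topology \<beta> q) (T ` S))"

definition volterra :: "(complex \<Rightarrow> complex) \<Rightarrow> (complex \<Rightarrow> complex) \<Rightarrow> complex \<Rightarrow> complex" where
  "volterra g f z =
     (if z \<in> unit_disk then contour_integral (linepath 0 z) (\<lambda>w. f w * deriv g w) else 0)"


definition circle_arc :: "complex set \<Rightarrow> bool" where
  "circle_arc I \<longleftrightarrow> (\<exists>J::real set. is_interval J \<and> I = cis ` J)"

definition arc_length :: "complex set \<Rightarrow> real" where
  "arc_length I = measure lborel {t \<in> {0..<2 * pi}. cis t \<in> I} / (2 * pi)"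

definition carleson_square :: "complex set \<Rightarrow> complex set" where
  "carleson_square I = {of_real r * w | r w. w \<in> I \<and> 1 - arc_length I \<le> r \<and> r < 1}"

text \<open>\<open>squares_little_o \<mu> \<phi>\<close> is \<open>\<mu>(S(I)) = o(\<phi>(|I|))\<close> as \<open>|I| \<rightarrow> 0\<close>, uniformly in \<open>I\<close>.  It uses
  \<open>emeasure\<close> because \<open>measure\<close> would be \<open>0\<close> on sets of infinite measure.\<close>

definition squares_little_o :: "complex measure \<Rightarrow> (real \<Rightarrow> real) \<Rightarrow> bool" where
  "squares_little_o \<mu> \<phi> \<longleftrightarrow>
     (\<forall>\<epsilon>>0. \<exists>\<delta>>0. \<forall>I. circle_arc I \<and> 0 < arc_length I \<and> arc_length I < \<delta> \<longrightarrow>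
        emeasure \<mu> (carleson_square I) \<le> ennreal (\<epsilon> * \<phi> (arc_length I)))"

definition vanishing_carleson :: "real \<Rightarrow> complex measure \<Rightarrow> bool" where
  "vanishing_carleson s \<mu> \<longleftrightarrow> squares_little_o \<mu> (\<lambda>t. t powr s)"

definition dirichlet_measure :: "(complex \<Rightarrow> complex) \<Rightarrow> real \<Rightarrow> real \<Rightarrow> complex measure" where
  "dirichlet_measure g q \<beta> =
     density disk_area (\<lambda>z. ennreal ((1 - (cmod z)\<^sup>2) powr \<beta> * cmod (deriv g z) powr q))"

end

theory Submission
  imports Defs
begin

text \<open>The derivative of \<open>T\<^sub>g f\<close> is \<open>f g'\<close>, so \<open>T\<^sub>g\<close> is compact precisely when the inclusion of the Dirichlet
  space into \<open>L\<^sup>q(\<mu>)\<close>, \<open>\<mu> = \<mu>\<^bsub>g,q,\<beta>\<^esub>\<close>, is.  Integrating \<open>f'\<close> along radii and playing the global growth bound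
  on \<open>f'\<close> off against local averages of \<open>\<bar>f'\<bar>\<^sup>p\<close> gives, for \<open>f\<close> in the unit ball, the pointwise estimate
  \<open>\<bar>f(z) - f(0)\<bar>\<^sup>q \<le> C \<integral> \<bar>f'(u)\<bar>\<^sup>p (1 - \<bar>u\<bar>\<^sup>2)\<^sup>\<alpha> / \<psi>(1 - \<bar>u\<bar>) dA(u)\<close> over the points \<open>u\<close> with
  \<open>\<bar>z - u\<bar> < 3 (1 - \<bar>u\<bar>)\<close>; it is here that \<open>p < q\<close> enters.  Here \<open>\<psi>(t)\<close> is \<open>t\<^bsup>q(\<alpha>+2-p)/p\<^esup>\<close> or
  \<open>(2 - log t)\<^bsup>(1/p-1)q\<^esup>\<close>.  Integrating in \<open>\<mu>\<close> and exchanging the order of integration turns the smallness of \<open>\<mu>\<close> on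
  Carleson squares into uniform smallness of the tails \<open>\<integral>\<^bsub>\<bar>z\<bar> \<ge> R\<^esub> \<bar>f - f(0)\<bar>\<^sup>q d\<mu>\<close>, and Montel's theorem yields
  compactness.  If \<open>p > \<alpha> + 2\<close> the oscillation of \<open>f\<close> is bounded outright.  Conversely, powers and logarithms
  of Cauchy kernels concentrated at a boundary arc are bounded in norm and tend to \<open>0\<close> pointwise, which
  compactness turns into the little-o conditions.\<close>

section \<open>Quasi-metric topologies\<close>

text \<open>For p < 1 neither convexity nor duality is at hand, so the triangle and mean value
  inequalities are replaced by cruder ones with explicit factors, and the topology is treated
  through an abstract quasi-metric. The pointwise estimate has to be linear in the cone integral B,
  since only then can Tonelli be applied to its integral in \<mu>. Linearity is the effect of
  interpolation: the global bound on f' has order -\<tau> - 1, the local one has order \<eta> - 1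
  with factor (C B) powr (1 / p), and \<tau> / (\<tau> + \<eta>) = p / q. At p = \<alpha> + 2 the
  exponent \<tau> vanishes, and the growth bound would integrate to a full logarithm instead of its
  power 1 - 1 / p. That case needs an averaged argument along the radius, which may use p > 1
  because \<alpha> > -1. The little-o condition concerns short arcs only, while the Tonelli step
  asks for a mass bound at every u in the disk. Restricting \<mu> to a thin outer annulus reconciles
  the two: deep inside the disk, the small total mass of the annulus is bound enough.\<close>

locale quasi_metric_topology =
  fixes X :: "'a topology" and M :: "'a set" and d :: "'a \<Rightarrow> 'a \<Rightarrow> real" and K :: real
  assumes openin_iff: "openin X U \<longleftrightarrow> U \<subseteq> M \<and> (\<forall>f\<in>U. \<exists>r>0. \<forall>h\<in>M. d h f < r \<longrightarrow> h \<in> U)"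
    and dist_self: "\<And>f. f \<in> M \<Longrightarrow> d f f = 0"
    and dist_sym: "\<And>f h. f \<in> M \<Longrightarrow> h \<in> M \<Longrightarrow> d f h = d h f"
    and K_pos: "K > 0"
    and quasi_triangle: "\<And>f h k. f \<in> M \<Longrightarrow> h \<in> M \<Longrightarrow> k \<in> M \<Longrightarrow> d f k \<le> K * (d f h + d h k)"
begin

lemma topspace_eq: "topspace X = M"
proof
  show "topspace X \<subseteq> M" using openin_iff openin_topspace by blast
  show "M \<subseteq> topspace X" by (rule openin_subset) (auto simp: openin_iff intro: exI[of _ 1])
qed

text \<open>A quasi-metric ball need not be open, so it is replaced by the set of points having some
  ball around them inside it. That set is open because shrinking \<open>\<delta>\<close> to
  \<open>\<delta> / (2 * K)\<close> leaves room for one quasi-triangle inequality.\<close>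

lemma ball_contains_open:
  assumes "x \<in> M" "r > 0"
  obtains W where "openin X W" "x \<in> W" "\<And>h. h \<in> W \<Longrightarrow> d h x < r"
proof
  define W where "W = {f \<in> M. \<exists>\<delta>>0. \<forall>h\<in>M. d h f < \<delta> \<longrightarrow> d h x < r}"
  show "openin X W"
    unfolding openin_iff
  proof (intro conjI ballI)
    fix f assume "f \<in> W"
    then obtain \<delta> where f: "f \<in> M" "\<delta> > 0" "\<And>h. h \<in> M \<Longrightarrow> d h f < \<delta> \<Longrightarrow> d h x < r"
      unfolding W_def by blast
    define \<eta> where "\<eta> = \<delta> / (2 * K)"
    have \<eta>: "\<eta> > 0" "K * (\<eta> + \<eta>) = \<delta>" using f(2) K_pos by (auto simp: \<eta>_def)
    have "h \<in> W" if h: "h \<in> M" "d h f < \<eta>" for h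
    proof -
      have "d k x < r" if k: "k \<in> M" "d k h < \<eta>" for k
      proof (rule f(3)[OF k(1)])
        have "d k f \<le> K * (d k h + d h f)" using quasi_triangle k h f by blast
        also have "\<dots> < K * (\<eta> + \<eta>)" using k h K_pos by (intro mult_strict_left_mono) auto
        finally show "d k f < \<delta>" using \<eta> by simp
      qed
      thus ?thesis unfolding W_def using h(1) \<eta>(1) by blast
    qed
    thus "\<exists>r>0. \<forall>h\<in>M. d h f < r \<longrightarrow> h \<in> W" using \<eta>(1) by blast
  qed (auto simp: W_def)
  show "x \<in> W" unfolding W_def using assms by blast
  show "d h x < r" if "h \<in> W" for h
    using that dist_self[of h] unfolding W_def by force
qed

lemma in_closure_of_iff:
  assumes "S \<subseteq> M"
  shows "x \<in> X closure_of S \<longleftrightarrow> x \<in> M \<and> (\<forall>r>0. \<exists>s\<in>S. d s x < r)"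
proof
  assume x: "x \<in> X closure_of S"
  hence xM: "x \<in> M" using closure_of_subset_topspace topspace_eq by (metis subsetD)
  have "\<exists>s\<in>S. d s x < r" if "r > 0" for r
    using ball_contains_open[OF xM that] x unfolding in_closure_of by metis
  thus "x \<in> M \<and> (\<forall>r>0. \<exists>s\<in>S. d s x < r)" using xM by blast
next
  assume x: "x \<in> M \<and> (\<forall>r>0. \<exists>s\<in>S. d s x < r)"
  show "x \<in> X closure_of S"
    unfolding in_closure_of topspace_eq
  proof (intro conjI allI impI)
    fix T assume "x \<in> T \<and> openin X T"
    then obtain r where "r > 0" "\<And>h. h \<in> M \<Longrightarrow> d h x < r \<Longrightarrow> h \<in> T" unfolding openin_iff by blast
    thus "\<exists>y. y \<in> S \<and> y \<in> T" using x assms by blast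
  qed (use x in blast)
qed

text \<open>If no point of \<open>C\<close> were a cluster point, each would have an open
  neighbourhood that the sequence leaves for good; finitely many of these cover \<open>C\<close>,
  and a late term lies in none of them.\<close>

lemma compactin_cluster_point:
  assumes "compactin X C" "\<And>n::nat. k n \<in> C"
  shows "\<exists>l\<in>C. \<forall>r>0. \<forall>N. \<exists>n\<ge>N. d (k n) l < r"
proof -
  have CM: "C \<subseteq> M" using assms(1) topspace_eq compactin_subset_topspace by blast
  show ?thesis
  proof (rule ccontr)
    assume "\<not> ?thesis"
    hence "\<forall>l\<in>C. \<exists>r>0. \<exists>N. \<forall>n\<ge>N. \<not> d (k n) l < r" by blast
    hence "\<forall>l\<in>C. \<exists>W N. openin X W \<and> l \<in> W \<and> (\<forall>n\<ge>N. k n \<notin> W)"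
      using ball_contains_open CM by (metis subsetD)
    then obtain W N where W: "\<And>l. l \<in> C \<Longrightarrow> openin X (W l)" "\<And>l. l \<in> C \<Longrightarrow> l \<in> W l"
        "\<And>l n. l \<in> C \<Longrightarrow> n \<ge> N l \<Longrightarrow> k n \<notin> W l" by metis
    have "\<exists>F. finite F \<and> F \<subseteq> W ` C \<and> C \<subseteq> \<Union>F"
      by (rule compactinD[OF assms(1)]) (use W in blast)+
    then obtain L where L: "finite L" "L \<subseteq> C" "C \<subseteq> \<Union>(W ` L)" by (metis finite_subset_image)
    \<comment> \<open>The sum of the thresholds is at least each of them, so at this index the
      sequence has left every set of the finite cover.\<close>
    define n where "n = (\<Sum>l\<in>L. N l)"
    obtain l where "l \<in> L" "k n \<in> W l" using L assms(2) by blast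
    moreover have "N l \<le> n" unfolding n_def using L(1) \<open>l \<in> L\<close> by (simp add: member_le_sum)
    ultimately show False using W(3) L(2) by blast
  qed
qed

text \<open>The metric argument survives the factor \<open>K\<close>: sequential compactness yields
  a Lebesgue number \<open>e\<close> of the cover and a finite \<open>e\<close>-net, and the cover
  sets attached to the points of the net cover \<open>C\<close>.\<close>

lemma compactin_if_sequentially_compact:
  assumes CM: "C \<subseteq> M"
    and seq: "\<And>k :: nat \<Rightarrow> 'a. range k \<subseteq> C \<Longrightarrow> \<exists>l\<in>C. \<exists>r. strict_mono r \<and> (\<lambda>n. d (k (r n)) l) \<longlonglongrightarrow> 0"
  shows "compactin X C"
  unfolding compactin_def
proof (intro conjI allI impI)
  show "C \<subseteq> topspace X" using CM topspace_eq by simp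
  fix \<U> assume \<U>: "(\<forall>U\<in>\<U>. openin X U) \<and> C \<subseteq> \<Union>\<U>"
  \<comment> \<open>Lebesgue number. Otherwise there are points whose balls of radius
    \<open>1 / Suc n\<close> lie in no single cover set, which fails near the limit of a
    subsequence.\<close>
  have "\<exists>e>0. \<forall>x\<in>C. \<exists>U\<in>\<U>. \<forall>h\<in>C. d h x < e \<longrightarrow> h \<in> U"
  proof (rule ccontr)
    assume no_radius: "\<not> ?thesis"
    have *: "\<forall>e>0. \<exists>x\<in>C. \<forall>U\<in>\<U>. \<exists>h\<in>C. d h x < e \<and> h \<notin> U"
      using no_radius by (simp only: not_ex not_all de_Morgan_conj not_imp bex_simps ball_simps Bex_def Ball_def simp_thms) blast
    have "\<exists>x\<in>C. \<forall>U\<in>\<U>. \<exists>h\<in>C. d h x < 1 / Suc n \<and> h \<notin> U" for n :: nat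
    proof -
      have "(0::real) < 1 / Suc n" by simp
      thus ?thesis using spec[OF *, of "1 / Suc n"] by (rule rev_mp)
    qed
    then obtain k where k: "\<And>n::nat. k n \<in> C" "\<And>n U. U \<in> \<U> \<Longrightarrow> \<exists>h\<in>C. d h (k n) < 1 / Suc n \<and> h \<notin> U"
      by metis
    obtain l r where l: "l \<in> C" "strict_mono r" "(\<lambda>n. d (k (r n)) l) \<longlonglongrightarrow> 0"
      using seq[of k] k(1) by blast
    obtain U where U: "U \<in> \<U>" "l \<in> U" using \<U> l(1) by blast
    then obtain \<delta> where \<delta>: "\<delta> > 0" "\<And>h. h \<in> M \<Longrightarrow> d h l < \<delta> \<Longrightarrow> h \<in> U"
      using \<U> openin_iff by meson
    have "(\<lambda>n. K * (1 / Suc n + d (k (r n)) l)) \<longlonglongrightarrow> K * (0 + 0)"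
      by (intro tendsto_intros l(3) LIMSEQ_Suc[OF lim_1_over_n])
    hence "\<forall>\<^sub>F n in sequentially. K * (1 / Suc n + d (k (r n)) l) < \<delta>"
      using \<delta>(1) by (intro order_tendstoD) auto
    then obtain n where n: "K * (1 / Suc n + d (k (r n)) l) < \<delta>"
      by (meson eventually_happens' sequentially_bot)
    obtain h where h: "h \<in> C" "d h (k (r n)) < 1 / Suc (r n)" "h \<notin> U" using k(2)[OF U(1)] by blast
    have "d h l \<le> K * (d h (k (r n)) + d (k (r n)) l)" using quasi_triangle h(1) k(1) l(1) CM by blast
    also have "\<dots> \<le> K * (1 / Suc n + d (k (r n)) l)"
    proof (intro mult_left_mono add_right_mono)
      have "1 / real (Suc (r n)) \<le> 1 / Suc n"
        using seq_suble[OF l(2), of n] by (intro divide_left_mono) auto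
      thus "d h (k (r n)) \<le> 1 / Suc n" using h(2) by linarith
    qed (use K_pos in auto)
    also have "\<dots> < \<delta>" by (rule n)
    finally show False using \<delta>(2) h CM by blast
  qed
  then obtain e where e: "e > 0" "\<forall>x\<in>C. \<exists>U\<in>\<U>. \<forall>h\<in>C. d h x < e \<longrightarrow> h \<in> U" by blast
  \<comment> \<open>Finite net. Otherwise greedy choice produces a sequence no term of which is
    within \<open>e\<close> of an earlier one.\<close>
  have "\<exists>F. finite F \<and> F \<subseteq> C \<and> (\<forall>h\<in>C. \<exists>x\<in>F. d h x < e)"
  proof (rule ccontr)
    assume no_net: "\<not> ?thesis"
    define step where "step = (\<lambda>F. SOME h. h \<in> C \<and> (\<forall>x\<in>F. \<not> d h x < e))"
    have step: "step F \<in> C \<and> (\<forall>x\<in>F. \<not> d (step F) x < e)" if "finite F" "F \<subseteq> C" for F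
    proof -
      have "\<not> (\<forall>h\<in>C. \<exists>x\<in>F. d h x < e)" using spec[OF no_net[unfolded not_ex], of F] that by simp
      hence "\<exists>h. h \<in> C \<and> (\<forall>x\<in>F. \<not> d h x < e)" by blast
      thus ?thesis unfolding step_def by (rule someI_ex)
    qed
    define F where "F = rec_nat {} (\<lambda>_ F. insert (step F) F)"
    have F0: "F 0 = {}" and FS: "F (Suc n) = insert (step (F n)) (F n)" for n by (simp_all add: F_def)
    have F: "finite (F n) \<and> F n \<subseteq> C" for n by (induction n) (auto simp: F0 FS step)
    have mono: "F m \<subseteq> F n" if "m \<le> n" for m n using that by (induction n) (auto simp: FS le_Suc_eq)
    define k where "k = (\<lambda>n. step (F n))"
    have far: "\<not> d (k n) (k m) < e" if "m < n" for m n
    proof -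
      have "k m \<in> F n" using mono[of "Suc m" n] that by (auto simp: FS k_def)
      thus ?thesis using step F unfolding k_def by blast
    qed
    have kC: "k n \<in> C" for n using step F unfolding k_def by blast
    \<comment> \<open>Two consecutive terms of the subsequence within \<open>e / (2 * K)\<close> of
      the limit are within \<open>e\<close> of each other, against the greedy choice.\<close>
    obtain l r where l: "l \<in> C" "strict_mono r" "(\<lambda>n. d (k (r n)) l) \<longlonglongrightarrow> 0"
      using seq[of k] kC by blast
    have "\<forall>\<^sub>F n in sequentially. d (k (r n)) l < e / (2 * K)"
      by (rule order_tendstoD(2)[OF l(3)]) (use e K_pos in auto)
    then obtain n where n: "\<And>m. m \<ge> n \<Longrightarrow> d (k (r m)) l < e / (2 * K)"
      by (meson eventually_sequentially)
    have "d (k (r (Suc n))) (k (r n)) \<le> K * (d (k (r (Suc n))) l + d l (k (r n)))"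
      using quasi_triangle kC l(1) CM by blast
    also have "d l (k (r n)) = d (k (r n)) l" using dist_sym kC l(1) CM by blast
    also have "K * (d (k (r (Suc n))) l + d (k (r n)) l) < K * (e / (2 * K) + e / (2 * K))"
      using n[of n] n[of "Suc n"] K_pos by (intro mult_strict_left_mono add_strict_mono) auto
    also have "\<dots> = e" using K_pos by simp
    finally show False using far[of "r n" "r (Suc n)"] l(2) by (auto simp: strict_mono_def)
  qed
  then obtain F where F: "finite F" "F \<subseteq> C" "\<forall>h\<in>C. \<exists>x\<in>F. d h x < e" by blast
  obtain U where U: "\<forall>x\<in>C. U x \<in> \<U> \<and> (\<forall>h\<in>C. d h x < e \<longrightarrow> h \<in> U x)" using e(2) by metis
  show "\<exists>\<F>. finite \<F> \<and> \<F> \<subseteq> \<U> \<and> C \<subseteq> \<Union>\<F>"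
    by (rule exI[of _ "U ` F"]) (use F U in blast)
qed

text \<open>Points of the closure are replaced by points of \<open>S\<close> at distance below
  \<open>1 / Suc n\<close>. A limit of the latter along a subsequence is also one of the former, and
  it belongs to the closure because it is approached from \<open>S\<close>.\<close>

lemma relatively_compactin_if_sequential:
  assumes SM: "S \<subseteq> M"
    and seq: "\<And>k :: nat \<Rightarrow> 'a. range k \<subseteq> S \<Longrightarrow> \<exists>l\<in>M. \<exists>r. strict_mono r \<and> (\<lambda>n. d (k (r n)) l) \<longlonglongrightarrow> 0"
    and nonneg: "\<And>f h. d f h \<ge> 0"
  shows "relatively_compactin X S"
  unfolding relatively_compactin_def
proof
  show "S \<subseteq> topspace X" using SM topspace_eq by simp
  note cl = in_closure_of_iff[OF SM]
  show "compactin X (X closure_of S)"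
  proof (rule compactin_if_sequentially_compact)
    show "X closure_of S \<subseteq> M" using closure_of_subset_topspace[of X S] topspace_eq by simp
    fix k :: "nat \<Rightarrow> 'a" assume k: "range k \<subseteq> X closure_of S"
    have "\<exists>s\<in>S. d s (k n) < 1 / Suc n" for n using k cl[of "k n"] by (auto simp: image_subset_iff)
    then obtain s where s: "\<And>n. s n \<in> S" "\<And>n. d (s n) (k n) < 1 / Suc n" by metis
    obtain l r where l: "l \<in> M" "strict_mono r" "(\<lambda>n. d (s (r n)) l) \<longlonglongrightarrow> 0"
      using seq[of s] s(1) by blast
    have kM: "k n \<in> M" for n using k cl by blast
    have "(\<lambda>n. d (s (r n)) (k (r n))) \<longlonglongrightarrow> 0"
    proof (rule tendsto_sandwich[OF _ _ tendsto_const])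
      show "\<forall>\<^sub>F n in sequentially. d (s (r n)) (k (r n)) \<le> 1 / Suc (r n)"
        using s(2) by (intro always_eventually) (auto intro: less_imp_le)
      show "(\<lambda>n. 1 / real (Suc (r n))) \<longlonglongrightarrow> 0"
        using LIMSEQ_subseq_LIMSEQ[OF LIMSEQ_Suc[OF lim_1_over_n] l(2)] by (simp add: o_def)
    qed (use nonneg in auto)
    hence lim: "(\<lambda>n. K * (d (s (r n)) (k (r n)) + d (s (r n)) l)) \<longlonglongrightarrow> K * (0 + 0)"
      by (intro tendsto_intros l(3))
    have "(\<lambda>n. d (k (r n)) l) \<longlonglongrightarrow> 0"
    proof (rule tendsto_sandwich[OF _ _ tendsto_const])
      have "d (k (r n)) l \<le> K * (d (s (r n)) (k (r n)) + d (s (r n)) l)" for n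
      proof -
        have "s (r n) \<in> M" using s(1) SM by blast
        thus ?thesis using quasi_triangle[OF kM _ l(1)] dist_sym[OF kM] by metis
      qed
      thus "\<forall>\<^sub>F n in sequentially. d (k (r n)) l \<le> K * (d (s (r n)) (k (r n)) + d (s (r n)) l)"
        by (intro always_eventually) blast
      show "(\<lambda>n. K * (d (s (r n)) (k (r n)) + d (s (r n)) l)) \<longlonglongrightarrow> 0" using lim by simp
    qed (use nonneg in auto)
    moreover have "l \<in> X closure_of S"
      unfolding cl
    proof (intro conjI allI impI l(1))
      fix e :: real assume "e > 0"
      then obtain n where "d (s (r n)) l < e"
        using order_tendstoD(2)[OF l(3)] by (meson eventually_happens' sequentially_bot)
      thus "\<exists>s\<in>S. d s l < e" using s(1) by blast
    qed
    ultimately show "\<exists>l\<in>X closure_of S. \<exists>r. strict_mono r \<and> (\<lambda>n. d (k (r n)) l) \<longlonglongrightarrow> 0"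
      using l(2) by blast
  qed
qed

end

section \<open>Dirichlet spaces and the Volterra operator\<close>

text \<open>Through x + y \<le> 2 max x y, which treats exponents below and above 1 alike.\<close>

lemma powr_add_le:
  fixes x y p :: real
  assumes "x \<ge> 0" "y \<ge> 0" "p > 0"
  shows "(x + y) powr p \<le> 2 powr p * (x powr p + y powr p)"
proof -
  have "(x + y) powr p \<le> (2 * max x y) powr p" using assms by (intro powr_mono2) auto
  also have "\<dots> = 2 powr p * max x y powr p" using assms by (simp add: powr_mult)
  also have "max x y powr p \<le> x powr p + y powr p" by (auto simp: max_def)
  finally show ?thesis by (simp add: mult_left_mono)
qed

lemma norm_diff_powr_le:
  fixes x y :: complex
  assumes "p > 0"
  shows "cmod (x - y) powr p \<le> 2 powr p * (cmod x powr p + cmod y powr p)"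
proof -
  have "cmod (x - y) powr p \<le> (cmod x + cmod y) powr p"
    using assms norm_triangle_ineq4[of x y] by (intro powr_mono2) auto
  also have "\<dots> \<le> 2 powr p * (cmod x powr p + cmod y powr p)" by (rule powr_add_le) (use assms in auto)
  finally show ?thesis .
qed

section \<open>Normalised area measure on the disk\<close>

lemma space_disk_area [simp]: "space disk_area = unit_disk"
  by (simp add: disk_area_def space_restrict_space space_scale_measure)

lemma sets_disk_area [measurable_cong]: "sets disk_area = sets (restrict_space borel unit_disk)"
  unfolding disk_area_def by (simp add: sets_restrict_space)

lemma in_sets_disk_area: "A \<in> sets borel \<Longrightarrow> A \<subseteq> unit_disk \<Longrightarrow> A \<in> sets disk_area"
  by (simp add: sets_disk_area sets_restrict_space_iff)

lemma disk_tail_in_sets_disk_area: "{z \<in> unit_disk. R \<le> cmod z} \<in> sets disk_area"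
proof (rule in_sets_disk_area)
  have "{z \<in> unit_disk. R \<le> cmod z} = unit_disk \<inter> {z. R \<le> cmod z}" by auto
  also have "\<dots> \<in> sets borel"
    by (intro sets.Int borel_open[OF open_ball] borel_closed closed_Collect_le continuous_intros)
  finally show "{z \<in> unit_disk. R \<le> cmod z} \<in> sets borel" .
qed auto

lemma borel_measurable_disk_area:
  "f \<in> borel_measurable borel \<Longrightarrow> f \<in> borel_measurable disk_area"
  by (subst measurable_cong_sets[OF sets_disk_area refl]) (rule measurable_restrict_space1)

lemma borel_measurable_ident_disk_area [measurable]: "(\<lambda>u. u) \<in> borel_measurable disk_area"
  by (rule borel_measurable_disk_area) simp

lemma continuous_borel_measurable_disk_area:
  fixes f :: "complex \<Rightarrow> 'b::topological_space"
  assumes "continuous_on unit_disk f"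
  shows "f \<in> borel_measurable disk_area"
  by (subst measurable_cong_sets[OF sets_disk_area refl]) (rule borel_measurable_continuous_on_restrict[OF assms])

lemma emeasure_disk_area:
  assumes "A \<in> sets borel" "A \<subseteq> unit_disk"
  shows "emeasure disk_area A = ennreal (1 / pi) * emeasure lborel A"
  using assms unfolding disk_area_def by (simp add: emeasure_restrict_space)

lemma emeasure_lborel_complex_ball: "r \<ge> 0 \<Longrightarrow> emeasure lborel (ball (c :: complex) r) = ennreal (pi * r\<^sup>2)"
  by (simp add: emeasure_ball DIM_complex eval_unit_ball_vol)

lemma emeasure_disk_area_ball:
  assumes "ball c r \<subseteq> unit_disk" "r \<ge> 0"
  shows "emeasure disk_area (ball c r) = ennreal (r\<^sup>2)"
  using assms by (simp add: emeasure_disk_area emeasure_lborel_complex_ball flip: ennreal_mult)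

lemma emeasure_disk_area_le_ball:
  assumes "A \<subseteq> ball c r" "r \<ge> 0"
  shows "emeasure disk_area A \<le> ennreal (r\<^sup>2)"
proof (cases "A \<in> sets disk_area")
  case True
  hence A: "A \<in> sets borel" "A \<subseteq> unit_disk"
    by (auto simp: sets_disk_area sets_restrict_space_iff dest: sets.sets_into_space)
  have "emeasure disk_area A = ennreal (1 / pi) * emeasure lborel A" by (rule emeasure_disk_area[OF A])
  also have "\<dots> \<le> ennreal (1 / pi) * emeasure lborel (ball c r)"
    by (intro mult_left_mono emeasure_mono assms) auto
  also have "\<dots> = ennreal (r\<^sup>2)" using assms by (simp add: emeasure_lborel_complex_ball flip: ennreal_mult)
  finally show ?thesis .
qed (simp add: emeasure_notin_sets)

lemma finite_measure_disk_area: "finite_measure disk_area"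
proof
  have "emeasure disk_area (space disk_area) \<le> ennreal (1\<^sup>2)"
    by (rule emeasure_disk_area_le_ball[of _ 0]) auto
  thus "emeasure disk_area (space disk_area) \<noteq> \<infinity>" by (auto simp: top_unique)
qed

interpretation disk_area: finite_measure disk_area by (rule finite_measure_disk_area)

text \<open>An extended integral: it is infinite exactly where the Bochner integral in
  \<open>dirichlet_norm\<close> would default to 0, so membership in the space becomes finiteness,
  and Fatou and Tonelli apply without integrability conditions.\<close>

definition dirichlet_energy :: "real \<Rightarrow> real \<Rightarrow> (complex \<Rightarrow> complex) \<Rightarrow> ennreal" where
  "dirichlet_energy \<alpha> p f = (\<integral>\<^sup>+z. ennreal (dirichlet_density \<alpha> p f z) \<partial>disk_area)"

lemma disk_analytic_deriv:
  assumes "f \<in> disk_analytic" "z \<in> unit_disk"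
  shows "(f has_field_derivative deriv f z) (at z)"
  using assms holomorphic_derivI[of f unit_disk z UNIV] by (auto simp: disk_analytic_def)

lemma disk_analytic_holomorphic: "f \<in> disk_analytic \<Longrightarrow> f holomorphic_on unit_disk"
  by (simp add: disk_analytic_def)

lemma disk_analytic_diff: "f \<in> disk_analytic \<Longrightarrow> h \<in> disk_analytic \<Longrightarrow> (\<lambda>z. f z - h z) \<in> disk_analytic"
  by (auto simp: disk_analytic_def intro: holomorphic_intros)

lemma deriv_diff_disk_analytic:
  assumes "f \<in> disk_analytic" "h \<in> disk_analytic" "z \<in> unit_disk"
  shows "deriv (\<lambda>z. f z - h z) z = deriv f z - deriv h z"
  by (intro DERIV_imp_deriv DERIV_diff disk_analytic_deriv assms)

lemma borel_measurable_disk_analytic: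
  assumes "f \<in> disk_analytic"
  shows "f \<in> borel_measurable disk_area" "deriv f \<in> borel_measurable disk_area"
  using assms by (auto intro!: continuous_borel_measurable_disk_area holomorphic_on_imp_continuous_on
      holomorphic_deriv simp: disk_analytic_def)

lemma borel_measurable_cmod_disk_area: "cmod \<in> borel_measurable disk_area"
  by (intro borel_measurable_disk_area) auto

lemma borel_measurable_dirichlet_density:
  assumes "f \<in> disk_analytic"
  shows "dirichlet_density \<alpha> p f \<in> borel_measurable disk_area"
proof -
  note [measurable] = borel_measurable_disk_analytic[OF assms] borel_measurable_cmod_disk_area
  show ?thesis unfolding dirichlet_density_def by measurable
qed

lemma dirichlet_density_nonneg: "dirichlet_density \<alpha> p f z \<ge> 0"
  by (simp add: dirichlet_density_def)

lemma dirichlet_space_iff: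
  "f \<in> dirichlet_space \<alpha> p \<longleftrightarrow> f \<in> disk_analytic \<and> dirichlet_energy \<alpha> p f < \<infinity>"
  unfolding dirichlet_space_def dirichlet_energy_def
  using borel_measurable_dirichlet_density[of f \<alpha> p]
  by (auto simp: integrable_iff_bounded dirichlet_density_nonneg)

text \<open>This holds off the space too: \<open>enn2real\<close> sends infinity to 0, as does the
  Bochner integral of a nonintegrable density.\<close>

lemma dirichlet_norm_eq:
  "dirichlet_norm \<alpha> p f = (cmod (f 0) powr p + enn2real (dirichlet_energy \<alpha> p f)) powr (1 / p)"
  if "f \<in> disk_analytic"
  unfolding dirichlet_norm_def dirichlet_energy_def
  using borel_measurable_dirichlet_density[OF that]
  by (subst integral_eq_nn_integral) (auto simp: dirichlet_density_nonneg)

lemma dirichlet_norm_nonneg: "dirichlet_norm \<alpha> p f \<ge> 0"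
  by (simp add: dirichlet_norm_def)

lemma dirichlet_norm_leD:
  assumes "f \<in> dirichlet_space \<alpha> p" "p > 0" "dirichlet_norm \<alpha> p f \<le> C"
  shows "cmod (f 0) \<le> C" "dirichlet_energy \<alpha> p f \<le> ennreal (C powr p)"
proof -
  define E where "E = enn2real (dirichlet_energy \<alpha> p f)"
  have f: "f \<in> disk_analytic" "dirichlet_energy \<alpha> p f = ennreal E"
    using assms(1) unfolding dirichlet_space_iff E_def by auto
  have E: "E \<ge> 0" by (simp add: E_def)
  have C: "C \<ge> 0" using assms(3) dirichlet_norm_nonneg order_trans by blast
  have "(cmod (f 0) powr p + E) = (dirichlet_norm \<alpha> p f) powr p"
    using assms(2) E by (simp add: dirichlet_norm_eq[OF f(1)] f(2) powr_powr)
  also have "\<dots> \<le> C powr p" using assms by (intro powr_mono2 dirichlet_norm_nonneg) auto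
  finally have le: "cmod (f 0) powr p + E \<le> C powr p" .
  show "cmod (f 0) \<le> C"
    using le E assms(2) C powr_le_cancel_iff by (metis add_increasing2 le_add_same_cancel1 norm_ge_zero order.trans powr_less_mono2 linorder_not_le)
  show "dirichlet_energy \<alpha> p f \<le> ennreal (C powr p)"
    unfolding f(2) using le by (intro ennreal_leI) (smt (verit) powr_ge_zero)
qed

lemma dirichlet_norm_leI:
  assumes "f \<in> disk_analytic" "p > 0" "a \<ge> 0" "b \<ge> 0" "cmod (f 0) \<le> a" "dirichlet_energy \<alpha> p f \<le> ennreal b"
  shows "dirichlet_norm \<alpha> p f \<le> (a powr p + b) powr (1 / p)"
proof -
  have "enn2real (dirichlet_energy \<alpha> p f) \<le> b" using assms(4,6) by (simp add: enn2real_leI)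
  thus ?thesis unfolding dirichlet_norm_eq[OF assms(1)]
    using assms by (intro powr_mono2 add_mono) auto
qed

lemma dirichlet_energy_diff_le:
  assumes "f \<in> disk_analytic" "h \<in> disk_analytic" "p > 0"
  shows "dirichlet_energy \<alpha> p (\<lambda>z. f z - h z) \<le>
    ennreal (2 powr p) * (dirichlet_energy \<alpha> p f + dirichlet_energy \<alpha> p h)"
proof -
  note [measurable] = borel_measurable_dirichlet_density[OF assms(1)] borel_measurable_dirichlet_density[OF assms(2)]
  have "dirichlet_energy \<alpha> p (\<lambda>z. f z - h z) \<le>
    (\<integral>\<^sup>+z. ennreal (2 powr p) * (ennreal (dirichlet_density \<alpha> p f z) + ennreal (dirichlet_density \<alpha> p h z)) \<partial>disk_area)"
    unfolding dirichlet_energy_def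
  proof (rule nn_integral_mono)
    fix z assume "z \<in> space disk_area"
    hence "deriv (\<lambda>z. f z - h z) z = deriv f z - deriv h z" using assms by (intro deriv_diff_disk_analytic) auto
    hence "dirichlet_density \<alpha> p (\<lambda>z. f z - h z) z \<le> 2 powr p * (cmod (deriv f z) powr p + cmod (deriv h z) powr p) * (1 - (cmod z)\<^sup>2) powr \<alpha>"
      unfolding dirichlet_density_def using norm_diff_powr_le[OF assms(3)] by (intro mult_right_mono) auto
    thus "ennreal (dirichlet_density \<alpha> p (\<lambda>z. f z - h z) z) \<le>
        ennreal (2 powr p) * (ennreal (dirichlet_density \<alpha> p f z) + ennreal (dirichlet_density \<alpha> p h z))"
      by (simp add: dirichlet_density_nonneg dirichlet_density_def algebra_simps ennreal_leI flip: ennreal_mult' ennreal_plus)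
  qed
  also have "\<dots> = ennreal (2 powr p) * (dirichlet_energy \<alpha> p f + dirichlet_energy \<alpha> p h)"
    unfolding dirichlet_energy_def by (simp add: nn_integral_cmult nn_integral_add)
  finally show ?thesis .
qed

lemma dirichlet_space_diff:
  assumes "f \<in> dirichlet_space \<alpha> p" "h \<in> dirichlet_space \<alpha> p" "p > 0"
  shows "(\<lambda>z. f z - h z) \<in> dirichlet_space \<alpha> p"
  using dirichlet_energy_diff_le[of f h p \<alpha>] assms
  by (auto simp: dirichlet_space_iff disk_analytic_diff ennreal_mult_less_top intro: order.strict_trans1)

lemma dirichlet_norm_diff_commute:
  assumes "f \<in> disk_analytic" "h \<in> disk_analytic"
  shows "dirichlet_norm \<alpha> p (\<lambda>z. f z - h z) = dirichlet_norm \<alpha> p (\<lambda>z. h z - f z)"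
proof -
  have "(\<integral>z. dirichlet_density \<alpha> p (\<lambda>z. f z - h z) z \<partial>disk_area) = (\<integral>z. dirichlet_density \<alpha> p (\<lambda>z. h z - f z) z \<partial>disk_area)"
    using assms by (intro Bochner_Integration.integral_cong refl)
      (auto simp: dirichlet_density_def deriv_diff_disk_analytic norm_minus_commute)
  thus ?thesis by (simp add: dirichlet_norm_def norm_minus_commute)
qed

text \<open>\<open>powr_add_le\<close> enters twice: with exponent p on values and derivatives,
  where its factor becomes 2 after the p-th root, and with exponent 1 / p to split that root, which
  costs 2 powr (1 / p).\<close>

lemma dirichlet_norm_quasi_triangle:
  assumes "f \<in> dirichlet_space \<alpha> p" "h \<in> dirichlet_space \<alpha> p" "k \<in> dirichlet_space \<alpha> p" "p > 0"
  shows "dirichlet_norm \<alpha> p (\<lambda>z. f z - k z) \<le> (2 * 2 powr (1 / p)) *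
    (dirichlet_norm \<alpha> p (\<lambda>z. f z - h z) + dirichlet_norm \<alpha> p (\<lambda>z. h z - k z))"
proof -
  define a where "a = enn2real (dirichlet_energy \<alpha> p (\<lambda>z. f z - h z))"
  define b where "b = enn2real (dirichlet_energy \<alpha> p (\<lambda>z. h z - k z))"
  define c where "c = enn2real (dirichlet_energy \<alpha> p (\<lambda>z. f z - k z))"
  define a0 where "a0 = cmod (f 0 - h 0) powr p"
  define b0 where "b0 = cmod (h 0 - k 0) powr p"
  have fh: "(\<lambda>z. f z - h z) \<in> dirichlet_space \<alpha> p" and hk: "(\<lambda>z. h z - k z) \<in> dirichlet_space \<alpha> p"
    and fk: "(\<lambda>z. f z - k z) \<in> dirichlet_space \<alpha> p"
    using dirichlet_space_diff assms by auto
  have kh: "(\<lambda>z. k z - h z) \<in> dirichlet_space \<alpha> p" using dirichlet_space_diff assms by auto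
  have eq: "dirichlet_energy \<alpha> p (\<lambda>z. k z - h z) = dirichlet_energy \<alpha> p (\<lambda>z. h z - k z)"
    unfolding dirichlet_energy_def using assms
    by (intro nn_integral_cong)
      (auto simp: dirichlet_density_def deriv_diff_disk_analytic norm_minus_commute dirichlet_space_iff)
  \<comment> \<open>The energy inequality is available for differences, so f - k is written as (f -
    h) - (k - h); \<open>eq\<close> undoes the change of sign.\<close>
  have "dirichlet_energy \<alpha> p (\<lambda>z. (f z - h z) - (k z - h z)) \<le>
    ennreal (2 powr p) * (dirichlet_energy \<alpha> p (\<lambda>z. f z - h z) + dirichlet_energy \<alpha> p (\<lambda>z. k z - h z))"
    using fh kh assms(4) by (intro dirichlet_energy_diff_le) (auto simp: dirichlet_space_iff)
  hence "dirichlet_energy \<alpha> p (\<lambda>z. f z - k z) \<le> ennreal (2 powr p) * (ennreal a + ennreal b)"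
    unfolding eq using fh hk by (simp add: a_def b_def dirichlet_space_iff)
  also have "\<dots> = ennreal (2 powr p * (a + b))" by (simp add: a_def b_def ennreal_mult' flip: ennreal_plus)
  finally have c: "c \<le> 2 powr p * (a + b)" unfolding c_def by (intro enn2real_leI) (auto simp: a_def b_def)
  have nonneg: "a \<ge> 0" "b \<ge> 0" "c \<ge> 0" "a0 \<ge> 0" "b0 \<ge> 0" by (auto simp: a_def b_def c_def a0_def b0_def)
  have "cmod (f 0 - k 0) powr p \<le> 2 powr p * (a0 + b0)"
    using norm_diff_powr_le[OF assms(4), of "f 0 - h 0" "k 0 - h 0"]
    by (simp add: a0_def b0_def norm_minus_commute[of "k 0"])
  hence "(cmod (f 0 - k 0) powr p + c) powr (1 / p) \<le> (2 powr p * ((a0 + a) + (b0 + b))) powr (1 / p)"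
    using c nonneg assms(4) by (intro powr_mono2) (auto simp: algebra_simps)
  also have "\<dots> = 2 * ((a0 + a) + (b0 + b)) powr (1 / p)"
    using nonneg assms(4) by (simp add: powr_mult powr_powr)
  also have "\<dots> \<le> 2 * (2 powr (1 / p) * ((a0 + a) powr (1 / p) + (b0 + b) powr (1 / p)))"
    using nonneg assms(4) by (intro mult_left_mono powr_add_le) auto
  finally show ?thesis
    using fh hk fk by (simp add: dirichlet_norm_eq dirichlet_space_iff a_def b_def c_def a0_def b0_def)
qed

text \<open>On the convex disk the integrand has a primitive, and the integral along the segment
  from 0 is a difference of two of its values.\<close>

lemma volterra_deriv:
  assumes "f \<in> disk_analytic" "g \<in> disk_analytic" "z \<in> unit_disk"
  shows "(volterra g f has_field_derivative f z * deriv g z) (at z)"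
proof -
  have hol: "(\<lambda>w. f w * deriv g w) holomorphic_on unit_disk"
    using assms by (intro holomorphic_intros) (auto simp: disk_analytic_def)
  then obtain P where P: "\<And>w. w \<in> unit_disk \<Longrightarrow> (P has_field_derivative f w * deriv g w) (at w within unit_disk)"
    using holomorphic_convex_primitive'[of unit_disk "\<lambda>w. f w * deriv g w"] by auto
  have eq: "volterra g f w = P w - P 0" if "w \<in> unit_disk" for w
  proof -
    have seg: "path_image (linepath 0 w) \<subseteq> unit_disk"
      using that closed_segment_subset[of 0 unit_disk w] by auto
    have "((\<lambda>w. f w * deriv g w) has_contour_integral (P (pathfinish (linepath 0 w)) - P (pathstart (linepath 0 w)))) (linepath 0 w)"
      by (rule contour_integral_primitive[OF P _ seg]) auto
    thus ?thesis using that by (simp add: volterra_def contour_integral_unique)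
  qed
  have "((\<lambda>w. P w - P 0) has_field_derivative f z * deriv g z - 0) (at z)"
    using P[OF assms(3)] assms(3) by (intro DERIV_diff DERIV_const) (simp add: at_within_open[OF _ open_ball])
  hence "((\<lambda>w. P w - P 0) has_field_derivative f z * deriv g z) (at z)" by simp
  thus ?thesis
    by (rule has_field_derivative_transform_within_open[OF _ open_ball assms(3)]) (simp add: eq)
qed

lemma volterra_0 [simp]: "volterra g f 0 = 0"
  by (simp add: volterra_def)

lemma volterra_disk_analytic:
  assumes "f \<in> disk_analytic" "g \<in> disk_analytic"
  shows "volterra g f \<in> disk_analytic"
proof -
  have "volterra g f holomorphic_on unit_disk"
    unfolding holomorphic_on_open[OF open_ball] using volterra_deriv[OF assms] by blast
  thus ?thesis by (auto simp: disk_analytic_def volterra_def)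
qed

section \<open>The Volterra operator as an inclusion into a Lebesgue space\<close>

lemma sets_dirichlet_measure [simp, measurable_cong]: "sets (dirichlet_measure g q \<beta>) = sets disk_area"
  by (simp add: dirichlet_measure_def)

lemma space_dirichlet_measure [simp]: "space (dirichlet_measure g q \<beta>) = unit_disk"
  by (simp add: dirichlet_measure_def)

lemma nn_integral_dirichlet_measure:
  assumes "g \<in> disk_analytic" "u \<in> borel_measurable disk_area"
  shows "(\<integral>\<^sup>+z. u z \<partial>dirichlet_measure g q \<beta>) =
    (\<integral>\<^sup>+z. ennreal ((1 - (cmod z)\<^sup>2) powr \<beta> * cmod (deriv g z) powr q) * u z \<partial>disk_area)"
proof -
  note [measurable] = borel_measurable_disk_analytic[OF assms(1)] borel_measurable_cmod_disk_area
  show ?thesis unfolding dirichlet_measure_def by (rule nn_integral_density) (use assms in auto)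
qed

text \<open>The factor \<open>deriv g z\<close> is absorbed into the measure. The function
  \<open>u\<close> is kept general so that images and differences of images are both
  covered.\<close>

lemma dirichlet_energy_of_deriv_eq:
  assumes "g \<in> disk_analytic" "f \<in> disk_analytic" "\<And>z. z \<in> unit_disk \<Longrightarrow> deriv u z = f z * deriv g z"
  shows "dirichlet_energy \<beta> q u = (\<integral>\<^sup>+z. ennreal (cmod (f z) powr q) \<partial>dirichlet_measure g q \<beta>)"
proof -
  note [measurable] = borel_measurable_disk_analytic[OF assms(1)] borel_measurable_disk_analytic[OF assms(2)]
  show ?thesis
    unfolding dirichlet_energy_def
    by (subst nn_integral_dirichlet_measure[OF assms(1)])
      (auto intro!: nn_integral_cong simp: assms(3) dirichlet_density_def norm_mult powr_mult mult_ac simp flip: ennreal_mult)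
qed

lemma dirichlet_energy_volterra:
  assumes "g \<in> disk_analytic" "f \<in> disk_analytic"
  shows "dirichlet_energy \<beta> q (volterra g f) = (\<integral>\<^sup>+z. ennreal (cmod (f z) powr q) \<partial>dirichlet_measure g q \<beta>)"
  using assms by (intro dirichlet_energy_of_deriv_eq) (auto intro!: DERIV_imp_deriv volterra_deriv)

lemma dirichlet_energy_volterra_diff:
  assumes "g \<in> disk_analytic" "f \<in> disk_analytic" "h \<in> disk_analytic"
  shows "dirichlet_energy \<beta> q (\<lambda>z. volterra g f z - volterra g h z) =
    (\<integral>\<^sup>+z. ennreal (cmod (f z - h z) powr q) \<partial>dirichlet_measure g q \<beta>)"
proof (rule dirichlet_energy_of_deriv_eq[OF assms(1) disk_analytic_diff[OF assms(2,3)]])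
  fix z assume z: "z \<in> unit_disk"
  have "((\<lambda>z. volterra g f z - volterra g h z) has_field_derivative f z * deriv g z - h z * deriv g z) (at z)"
    by (intro DERIV_diff volterra_deriv assms z)
  thus "deriv (\<lambda>z. volterra g f z - volterra g h z) z = (f z - h z) * deriv g z"
    by (simp add: DERIV_imp_deriv left_diff_distrib)
qed

section \<open>Local estimates for holomorphic functions\<close>

text \<open>At a point \<open>z\<^sub>0\<close> maximising \<open>\<bar>h\<bar>\<^sup>p (r - \<bar>z - w\<bar>)\<^sup>2\<close>, Cauchy's estimate shows that
  \<open>\<bar>h\<bar> \<ge> \<bar>h z\<^sub>0\<bar> / 2\<close> on a disk of comparable radius; this avoids subharmonicity for \<open>p < 1\<close>.\<close>

lemma holomorphic_powr_le_area_integral: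
  fixes p :: real
  assumes "p > 0"
  shows "\<exists>C>0. \<forall>h w r. h holomorphic_on ball w r \<and> ball w r \<subseteq> unit_disk \<and> r > 0 \<longrightarrow>
    ennreal (cmod (h w) powr p * r\<^sup>2) \<le> ennreal C * (\<integral>\<^sup>+z. ennreal (cmod (h z) powr p) * indicator (ball w r) z \<partial>disk_area)"
proof -
  \<comment> \<open>Halving the distance \<open>\<rho>\<close> to the rim divides the squared weight
    by 4, so \<open>cmod (h z) powr p\<close> can exceed its value at the maximum point by at most
    4; this gives \<open>A\<close>. Over a distance \<open>c * \<rho>\<close> the derivative bound
    \<open>4 * A * m / \<rho>\<close> then changes \<open>h\<close> by at most \<open>m / 2\<close>.
    In \<open>C\<close>, the 4 undoes the passage from r to r / 2.\<close>
  define A where "A = 4 powr (1 / p)"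
  define c where "c = 1 / (8 * A)"
  define C where "C = 4 * (2 powr p / c\<^sup>2)"
  have A: "A \<ge> 1" unfolding A_def using assms by (intro ge_one_powr_ge_zero) auto
  have c: "0 < c" "c \<le> 1 / 8" using A by (auto simp: c_def divide_simps)
  have "C > 0" using c by (simp add: C_def)
  moreover have "ennreal (cmod (h w) powr p * r\<^sup>2) \<le> ennreal C * (\<integral>\<^sup>+z. ennreal (cmod (h z) powr p) * indicator (ball w r) z \<partial>disk_area)"
    if hol: "h holomorphic_on ball w r" and sub: "ball w r \<subseteq> unit_disk" and r: "r > 0" for h w r
  proof (cases "h w = 0")
    case False
    \<comment> \<open>Half the radius keeps the closed ball inside the domain of holomorphy, so that
      the maximum is attained.\<close>
    define R where "R = r / 2"
    define \<Phi> where "\<Phi> = (\<lambda>z. cmod (h z) powr p * (R - cmod (z - w))\<^sup>2)"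
    have R: "R > 0" "R < r" using r by (auto simp: R_def)
    have cb: "cball w R \<subseteq> ball w r" using R by auto
    have "continuous_on (cball w R) h" using holomorphic_on_imp_continuous_on[OF hol] cb continuous_on_subset by blast
    hence "continuous_on (cball w R) \<Phi>"
      unfolding \<Phi>_def using assms by (intro continuous_intros continuous_on_powr') auto
    then obtain z0 where z0: "z0 \<in> cball w R" "\<And>z. z \<in> cball w R \<Longrightarrow> \<Phi> z \<le> \<Phi> z0"
      using continuous_attains_sup[of "cball w R" \<Phi>] R by auto
    have "\<Phi> w > 0" using False R assms by (simp add: \<Phi>_def)
    hence pos: "\<Phi> z0 > 0" using z0(2)[of w] R by force
    define \<rho> where "\<rho> = R - cmod (z0 - w)"
    have "\<rho> \<noteq> 0" using pos by (auto simp: \<Phi>_def \<rho>_def)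
    hence \<rho>: "\<rho> > 0" "\<rho> \<le> R" using z0(1) by (auto simp: \<rho>_def dist_norm norm_minus_commute)
    define m where "m = cmod (h z0)"
    have m: "m > 0" using pos unfolding \<Phi>_def m_def by (cases "h z0 = 0") (use assms in auto)
    have Phi0: "\<Phi> z0 = m powr p * \<rho>\<^sup>2" by (simp add: \<Phi>_def m_def \<rho>_def)
    have near: "R - cmod (z - w) \<ge> \<rho> / 2" if "cmod (z - z0) \<le> \<rho> / 2" for z
      using norm_triangle_ineq[of "z - z0" "z0 - w"] that by (simp add: \<rho>_def)
    have bound: "cmod (h z) \<le> A * m" if "cmod (z - z0) \<le> \<rho> / 2" for z
    proof -
      have zin: "z \<in> cball w R" using near[OF that] \<rho> by (simp add: dist_norm norm_minus_commute)
      have "cmod (h z) powr p * (\<rho> / 2)\<^sup>2 \<le> \<Phi> z"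
        unfolding \<Phi>_def using near[OF that] \<rho> by (intro mult_left_mono power_mono) auto
      also have "\<dots> \<le> m powr p * \<rho>\<^sup>2" using z0(2)[OF zin] Phi0 by simp
      finally have "cmod (h z) powr p \<le> 4 * m powr p"
        using \<rho> by (simp add: power2_eq_square field_simps)
      also have "\<dots> = (A * m) powr p" using assms m by (simp add: A_def powr_mult powr_powr)
      finally show ?thesis
        using powr_less_mono2[of p "A * m" "cmod (h z)"] assms A m by (smt (verit) mult_nonneg_nonneg)
    qed
    have deriv_bound: "cmod (deriv h z) \<le> 4 * A * m / \<rho>" if z: "z \<in> ball z0 (\<rho> / 4)" for z
    proof -
      have sub': "cball z (\<rho> / 4) \<subseteq> ball w r"
      proof
        fix y assume "y \<in> cball z (\<rho> / 4)"
        hence "cmod (y - z0) \<le> \<rho> / 2"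
          using z norm_triangle_ineq[of "y - z" "z - z0"] by (simp add: dist_norm norm_minus_commute)
        thus "y \<in> ball w r" using near[of y] \<rho> R by (simp add: dist_norm norm_minus_commute)
      qed
      \<comment> \<open>Circles of radius \<open>\<rho> / 4\<close> about points within
        \<open>\<rho> / 4\<close> of \<open>z0\<close> stay within \<open>\<rho> / 2\<close>, where
        \<open>bound\<close> applies.\<close>
      have "cmod ((deriv ^^ 1) h z) \<le> fact 1 * (A * m) / (\<rho> / 4) ^ 1"
      proof (rule Cauchy_inequality)
        show "h holomorphic_on ball z (\<rho> / 4)" using hol sub' ball_subset_cball holomorphic_on_subset by blast
        show "continuous_on (cball z (\<rho> / 4)) h"
          using holomorphic_on_imp_continuous_on[OF hol] sub' continuous_on_subset by blast
        fix x assume "cmod (z - x) = \<rho> / 4"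
        hence "cmod (x - z0) \<le> \<rho> / 2"
          using z norm_triangle_ineq[of "x - z" "z - z0"] by (simp add: dist_norm norm_minus_commute)
        thus "cmod (h x) \<le> A * m" by (rule bound)
      qed (use \<rho> in auto)
      thus ?thesis by (simp add: mult_ac)
    qed
    have sub0: "ball z0 (\<rho> / 4) \<subseteq> ball w r"
    proof
      fix y assume "y \<in> ball z0 (\<rho> / 4)"
      hence "cmod (y - z0) \<le> \<rho> / 2" using \<rho> by (simp add: dist_norm norm_minus_commute)
      thus "y \<in> ball w r" using near[of y] \<rho> R by (simp add: dist_norm norm_minus_commute)
    qed
    have lower: "m / 2 \<le> cmod (h z)" if z: "z \<in> ball z0 (c * \<rho>)" for z
    proof -
      have "c * \<rho> \<le> 1 / 8 * \<rho>" using c \<rho> by (intro mult_right_mono) auto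
      hence zin: "z \<in> ball z0 (\<rho> / 4)" using z \<rho> unfolding mem_ball by linarith
      have "cmod (h z - h z0) \<le> (4 * A * m / \<rho>) * cmod (z - z0)"
      proof (rule field_differentiable_bound[of "ball z0 (\<rho> / 4)" h "deriv h"])
        fix x assume "x \<in> ball z0 (\<rho> / 4)"
        thus "(h has_field_derivative deriv h x) (at x within ball z0 (\<rho> / 4))"
          using holomorphic_derivI[OF hol open_ball, of x] sub0 has_field_derivative_at_within by blast
      qed (use zin \<rho> deriv_bound in auto)
      also have "\<dots> \<le> (4 * A * m / \<rho>) * (c * \<rho>)"
        using z A m \<rho> by (intro mult_left_mono) (auto simp: dist_norm norm_minus_commute)
      also have "\<dots> = m / 2" using \<rho> A by (simp add: c_def)
      finally show ?thesis using norm_triangle_ineq2[of "h z0" "h z"] unfolding m_def by (simp add: norm_minus_commute)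
    qed
    have sub1: "ball z0 (c * \<rho>) \<subseteq> ball w r"
      using sub0 c \<rho> subset_ball[of "c * \<rho>" "\<rho> / 4" z0] mult_right_mono[of c "1 / 8" \<rho>] by force
    have "cmod (h w) powr p * r\<^sup>2 = 4 * \<Phi> w" by (simp add: \<Phi>_def R_def power2_eq_square)
    also have "\<dots> \<le> 4 * (m powr p * \<rho>\<^sup>2)" using z0(2)[of w] R Phi0 by simp
    also have "\<dots> = C * ((m / 2) powr p * (c * \<rho>)\<^sup>2)"
      using c m by (simp add: C_def powr_divide power_mult_distrib)
    finally have "ennreal (cmod (h w) powr p * r\<^sup>2) \<le> ennreal (C * ((m / 2) powr p * (c * \<rho>)\<^sup>2))"
      by (rule ennreal_leI)
    also have "\<dots> = ennreal C * (ennreal ((m / 2) powr p) * emeasure disk_area (ball z0 (c * \<rho>)))"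
      using emeasure_disk_area_ball[of z0 "c * \<rho>"] sub1 sub c \<rho> \<open>C > 0\<close> by (simp add: ennreal_mult)
    also have "ennreal ((m / 2) powr p) * emeasure disk_area (ball z0 (c * \<rho>)) =
        (\<integral>\<^sup>+z. ennreal ((m / 2) powr p) * indicator (ball z0 (c * \<rho>)) z \<partial>disk_area)"
      using sub1 sub by (subst nn_integral_cmult_indicator) (auto intro!: in_sets_disk_area)
    also have "\<dots> \<le> (\<integral>\<^sup>+z. ennreal (cmod (h z) powr p) * indicator (ball w r) z \<partial>disk_area)"
    proof (rule nn_integral_mono)
      fix z
      show "ennreal ((m / 2) powr p) * indicator (ball z0 (c * \<rho>)) z \<le> ennreal (cmod (h z) powr p) * indicator (ball w r) z"
      proof (cases "z \<in> ball z0 (c * \<rho>)")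
        case True
        hence "(m / 2) powr p \<le> cmod (h z) powr p" using lower m assms by (intro powr_mono2) auto
        thus ?thesis using True sub1 by (auto simp: ennreal_leI)
      qed simp
    qed
    finally show ?thesis by (simp add: mult_left_mono)
  qed (use assms in simp)
  ultimately show ?thesis by blast
qed

section \<open>Circular arcs and Carleson squares\<close>

lemma cis_2pi_mult [simp]: "cis (t + 2 * pi * of_int k) = cis t"
  by (metis cis_mult cis_multiple_2pi mult.right_neutral Ints_of_int)

lemma cis_eq_imp:
  assumes "cis s = cis t" obtains k :: int where "s = t + 2 * pi * of_int k"
proof -
  have "cos s = cos t" "sin s = sin t" using assms by (auto simp: complex_eq_iff)
  thus ?thesis using that sin_cos_eq_iff by (metis mult.commute)
qed

lemma dist_cis_le: "cmod (cis s - cis t) \<le> \<bar>s - t\<bar>"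
proof -
  have "cmod (cis s - cis t) = cmod (cis (s - t) - 1)"
  proof -
    have "cis s - cis t = cis t * (cis (s - t) - 1)" by (simp add: algebra_simps cis_mult)
    thus ?thesis by (simp add: norm_mult)
  qed
  also have "\<dots> \<le> \<bar>s - t\<bar>"
    using dist_exp_i_1[of "s - t"] abs_sin_x_le_abs_x[of "(s - t) / 2"] by (simp add: cis_conv_exp dist_norm)
  finally show ?thesis .
qed

lemma arc_parameters_borel:
  assumes "is_interval J"
  shows "{u \<in> {0..<2 * pi}. cis u \<in> cis ` J} \<in> sets borel"
proof -
  have "{u \<in> {0..<2 * pi}. cis u \<in> cis ` J} = {0..<2 * pi} \<inter> (\<Union>k::int. (\<lambda>u. u + 2 * pi * of_int k) -` J)"
  proof (intro equalityI subsetI)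
    fix u assume u: "u \<in> {u \<in> {0..<2 * pi}. cis u \<in> cis ` J}"
    then obtain s where "s \<in> J" "cis s = cis u" by auto
    then obtain k :: int where "s = u + 2 * pi * of_int k" using cis_eq_imp by blast
    thus "u \<in> {0..<2 * pi} \<inter> (\<Union>k::int. (\<lambda>u. u + 2 * pi * of_int k) -` J)" using u \<open>s \<in> J\<close> by auto
  next
    fix u assume "u \<in> {0..<2 * pi} \<inter> (\<Union>k::int. (\<lambda>u. u + 2 * pi * of_int k) -` J)"
    then obtain k :: int where "u \<in> {0..<2 * pi}" "u + 2 * pi * of_int k \<in> J" by auto
    thus "u \<in> {u \<in> {0..<2 * pi}. cis u \<in> cis ` J}" using cis_2pi_mult[of u k] by (metis (mono_tags) image_eqI mem_Collect_eq)
  qed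
  moreover have "(\<lambda>u. u + 2 * pi * of_int k) -` J \<in> sets borel" for k :: int
    using real_interval_borel_measurable[OF assms]
      measurable_sets[of "\<lambda>u. u + 2 * pi * of_int k" borel borel J] by simp
  ultimately show ?thesis by auto
qed

lemma arc_parameters_lmeasurable:
  assumes "is_interval J"
  shows "{u \<in> {0..<2 * pi}. cis u \<in> cis ` J} \<in> fmeasurable lborel"
proof (rule fmeasurableI2[of "{0..2 * pi}"])
  show "{0..2 * pi} \<in> fmeasurable lborel" by (rule fmeasurableI) auto
qed (use arc_parameters_borel[OF assms] in auto)

lemma reduce_mod_2pi:
  fixes s :: real
  obtains k :: int where "0 \<le> s - 2 * pi * of_int k" "s - 2 * pi * of_int k < 2 * pi"
proof
  have "of_int \<lfloor>s / (2 * pi)\<rfloor> \<le> s / (2 * pi)" "s / (2 * pi) < of_int \<lfloor>s / (2 * pi)\<rfloor> + 1" by linarith+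
  from this(1)[unfolded pos_le_divide_eq[OF pi_gt_zero[THEN mult_pos_pos[OF zero_less_numeral]]]]
    this(2)[unfolded pos_divide_less_eq[OF pi_gt_zero[THEN mult_pos_pos[OF zero_less_numeral]]]]
  show "0 \<le> s - 2 * pi * of_int \<lfloor>s / (2 * pi)\<rfloor>" "s - 2 * pi * of_int \<lfloor>s / (2 * pi)\<rfloor> < 2 * pi"
    by (simp_all add: algebra_simps)
qed

text \<open>After reduction of s modulo 2 pi the parameter interval either stays in the window from
  0 to 2 pi or, being no longer than a full turn, wraps around once and leaves two disjoint pieces
  there.\<close>

lemma arc_length_ge:
  assumes "is_interval J" "s \<in> J" "t \<in> J" "s \<le> t" "t - s \<le> 2 * pi"
  shows "t - s \<le> 2 * pi * arc_length (cis ` J)"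
proof -
  obtain k :: int where k: "0 \<le> s - 2 * pi * of_int k" "s - 2 * pi * of_int k < 2 * pi"
    by (rule reduce_mod_2pi)
  define s' where "s' = s - 2 * pi * of_int k"
  define t' where "t' = t - 2 * pi * of_int k"
  have s': "0 \<le> s'" "s' < 2 * pi" using k by (auto simp: s'_def)
  have t': "t' - s' = t - s" by (simp add: s'_def t'_def)
  define B where "B = {u \<in> {0..<2 * pi}. cis u \<in> cis ` J}"
  have inB: "u \<in> B" if "s' \<le> u + 2 * pi * of_int j" "u + 2 * pi * of_int j \<le> t'" "0 \<le> u" "u < 2 * pi" for u and j :: int
  proof -
    have "u + 2 * pi * of_int j + 2 * pi * of_int k \<in> J"
      using mem_is_interval_1_I[OF assms(1,2,3), of "u + 2 * pi * of_int j + 2 * pi * of_int k"] that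
      by (simp add: s'_def t'_def)
    moreover have "cis u = cis (u + 2 * pi * of_int j + 2 * pi * of_int k)" by simp
    ultimately show ?thesis unfolding B_def using that by fastforce
  qed
  have fm: "B \<in> fmeasurable lborel" unfolding B_def by (rule arc_parameters_lmeasurable[OF assms(1)])
  have "t - s \<le> measure lborel B"
  proof (cases "t' \<le> 2 * pi")
    case True
    have "{s'..<t'} \<subseteq> B" using inB[where j = 0] s' True by auto
    hence "measure lborel {s'..<t'} \<le> measure lborel B" by (intro measure_mono_fmeasurable fm) auto
    thus ?thesis using t' assms(4) by simp
  next
    case False
    have "{s'..<2 * pi} \<union> {0..<t' - 2 * pi} \<subseteq> B"
      using inB[where j = 0] inB[where j = 1] s' False t' assms(5) by (auto simp: algebra_simps)
    hence "measure lborel ({s'..<2 * pi} \<union> {0..<t' - 2 * pi}) \<le> measure lborel B"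
      by (intro measure_mono_fmeasurable fm) auto
    also have "measure lborel ({s'..<2 * pi} \<union> {0..<t' - 2 * pi}) = measure lborel {s'..<2 * pi} + measure lborel {0..<t' - 2 * pi}"
      using False t' assms(5) emeasure_lborel_Ico[of s' "2 * pi"] emeasure_lborel_Ico[of 0 "t' - 2 * pi"] s'
      by (intro measure_Union) (auto simp del: emeasure_lborel_Ico)
    finally show ?thesis using False s' t' by simp
  qed
  thus ?thesis by (simp add: arc_length_def B_def)
qed

text \<open>The lower bound is \<open>arc_length_ge\<close>. For the upper bound, a parameter in the
  window can meet the reduced interval only through its translates by 0 and by one full turn, so it
  lies in one of two explicit intervals.\<close>

lemma arc_length_Icc:
  assumes "0 \<le> x" "x \<le> pi"
  shows "arc_length (cis ` {\<theta> - x..\<theta> + x}) = x / pi"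
proof (rule antisym)
  have "\<theta> + x - (\<theta> - x) \<le> 2 * pi * arc_length (cis ` {\<theta> - x..\<theta> + x})"
    by (rule arc_length_ge) (use assms in \<open>auto simp: is_interval_cc\<close>)
  thus "x / pi \<le> arc_length (cis ` {\<theta> - x..\<theta> + x})" by (simp add: field_simps)
  obtain k :: int where k: "0 \<le> (\<theta> - x) - 2 * pi * of_int k" "(\<theta> - x) - 2 * pi * of_int k < 2 * pi"
    by (rule reduce_mod_2pi)
  define s' where "s' = (\<theta> - x) - 2 * pi * of_int k"
  define t' where "t' = (\<theta> + x) - 2 * pi * of_int k"
  have s': "0 \<le> s'" "s' < 2 * pi" "t' = s' + 2 * x" using k by (auto simp: s'_def t'_def)
  define B where "B = {u \<in> {0..<2 * pi}. cis u \<in> cis ` {\<theta> - x..\<theta> + x}}"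
  have "B \<subseteq> {s'..min t' (2 * pi)} \<union> {0..max 0 (t' - 2 * pi)}"
  proof
    fix u assume "u \<in> B"
    then obtain v where u: "0 \<le> u" "u < 2 * pi" "\<theta> - x \<le> v" "v \<le> \<theta> + x" "cis v = cis u" by (auto simp: B_def)
    then obtain l :: int where l: "v = u + 2 * pi * of_int l" using cis_eq_imp by blast
    define j where "j = l - k"
    have v: "v - 2 * pi * of_int k = u + 2 * pi * of_int j" by (simp add: l j_def algebra_simps)
    have j: "s' \<le> u + 2 * pi * of_int j" "u + 2 * pi * of_int j \<le> t'" using v u by (auto simp: s'_def t'_def)
    have "2 * pi * (of_int j + 1) > 0" using j(1) s' u by (simp add: algebra_simps)
    hence "of_int j > (-1 :: real)" using pi_gt_zero by (simp add: zero_less_mult_iff)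
    hence j0: "j \<ge> 0" by linarith
    have "2 * pi * of_int j < 2 * pi * 2" using j(2) s' u assms by linarith
    hence "of_int j < (2 :: real)" using pi_gt_zero by (subst (asm) mult_less_cancel_left_pos) auto
    hence "j = 0 \<or> j = 1" using j0 by linarith
    thus "u \<in> {s'..min t' (2 * pi)} \<union> {0..max 0 (t' - 2 * pi)}" using j u by auto
  qed
  hence "measure lborel B \<le> measure lborel ({s'..min t' (2 * pi)} \<union> {0..max 0 (t' - 2 * pi)})"
    using arc_parameters_borel[of "{\<theta> - x..\<theta> + x}"]
    by (intro measure_mono_fmeasurable fmeasurable.Un fmeasurableI) (auto simp: B_def is_interval_cc emeasure_lborel_Icc_eq)
  also have "\<dots> \<le> measure lborel {s'..min t' (2 * pi)} + measure lborel {0..max 0 (t' - 2 * pi)}"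
    by (intro measure_Un_le) auto
  also have "\<dots> = 2 * x" using s' assms by (auto simp: min_def max_def)
  finally show "arc_length (cis ` {\<theta> - x..\<theta> + x}) \<le> x / pi"
    by (simp add: arc_length_def B_def field_simps)
qed

text \<open>A chord is at most the parameter distance, and this is controlled by the arc length.
  Parameters more than 2 pi apart would put a full turn into the arc, which
  \<open>arc_length I < 1\<close> excludes.\<close>

lemma circle_arc_dist_le:
  assumes "circle_arc I" "z \<in> I" "w \<in> I" "arc_length I < 1"
  shows "cmod (z - w) \<le> 2 * pi * arc_length I"
proof -
  obtain J where J: "is_interval J" "I = cis ` J" using assms(1) by (auto simp: circle_arc_def)
  have "cmod (cis s - cis t) \<le> 2 * pi * arc_length I" if st: "s \<in> J" "t \<in> J" "s \<le> t" for s t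
  proof (cases "t - s \<le> 2 * pi")
    case True
    have "cmod (cis s - cis t) \<le> t - s" using dist_cis_le[of s t] st by simp
    also have "\<dots> \<le> 2 * pi * arc_length I" unfolding J(2) by (rule arc_length_ge) (use J st True in auto)
    finally show ?thesis .
  next
    case False
    have "s + 2 * pi \<in> J" using mem_is_interval_1_I[OF J(1) st(1,2), of "s + 2 * pi"] False by simp
    hence "s + 2 * pi - s \<le> 2 * pi * arc_length I"
      unfolding J(2) by (intro arc_length_ge J(1) st(1)) auto
    thus ?thesis using assms(4) by simp
  qed
  from this this[THEN order_trans[OF eq_refl[OF norm_minus_commute]]] show ?thesis
    using assms(2,3) unfolding J(2) by (metis imageE linear)
qed

text \<open>For \<open>arc_length I < 1\<close> the radii in the square are positive, so a point
  determines its radius and direction as \<open>cmod\<close> and \<open>sgn\<close>; this form makes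
  measurability visible.\<close>

lemma carleson_square_eq:
  assumes "circle_arc I" "arc_length I < 1"
  shows "carleson_square I = {z. 1 - arc_length I \<le> cmod z \<and> cmod z < 1 \<and> sgn z \<in> I}"
proof -
  have norm1: "cmod w = 1" if "w \<in> I" for w using that assms(1) by (auto simp: circle_arc_def)
  have "z \<in> carleson_square I" if "1 - arc_length I \<le> cmod z" "cmod z < 1" "sgn z \<in> I" for z
  proof -
    have "z = of_real (cmod z) * sgn z" using that assms(2) by (auto simp: sgn_eq)
    thus ?thesis unfolding carleson_square_def using that by blast
  qed
  moreover have "1 - arc_length I \<le> cmod z \<and> cmod z < 1 \<and> sgn z \<in> I" if "z \<in> carleson_square I" for z
  proof -
    obtain r w where z: "z = of_real r * w" "w \<in> I" "1 - arc_length I \<le> r" "r < 1"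
      using \<open>z \<in> carleson_square I\<close> by (auto simp: carleson_square_def)
    have "r > 0" using z assms(2) by simp
    thus ?thesis using z norm1[OF z(2)] by (simp add: norm_mult sgn_mult sgn_eq)
  qed
  ultimately show ?thesis by blast
qed

lemma carleson_square_borel:
  assumes "circle_arc I" "arc_length I < 1" "closed I"
  shows "carleson_square I \<in> sets borel"
proof -
  have "{z. 1 - arc_length I \<le> cmod z} \<inter> {z. cmod z < 1} \<inter> sgn -` I \<in> sets borel"
    using measurable_sets[of sgn borel borel I] assms(3)
    by (intro sets.Int) (auto intro!: borel_closed borel_open closed_Collect_le open_Collect_less continuous_intros)
  also have "{z. 1 - arc_length I \<le> cmod z} \<inter> {z. cmod z < 1} \<inter> sgn -` I = carleson_square I"
    unfolding carleson_square_eq[OF assms(1,2)] by auto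
  finally show ?thesis .
qed

lemma closed_cis_Icc: "closed (cis ` {a..b})"
  by (intro compact_imp_closed compact_continuous_image continuous_intros) auto

lemma circle_arc_Icc: "circle_arc (cis ` {a..b})"
  unfolding circle_arc_def using is_interval_cc by blast

section \<open>Pointwise estimates by weighted averages\<close>

text \<open>Comparability is required in both directions because the exponent may have either
  sign.\<close>

lemma powr_le_comparable:
  fixes x y a K :: real
  assumes "x > 0" "y > 0" "K \<ge> 1" "x \<le> K * y" "y \<le> K * x"
  shows "x powr a \<le> K powr \<bar>a\<bar> * y powr a"
proof (cases "a \<ge> 0")
  case True
  have "x powr a \<le> (K * y) powr a" using assms True by (intro powr_mono2) auto
  thus ?thesis using assms True by (simp add: powr_mult)
next
  case False
  have "x powr a \<le> (y / K) powr a" using assms False by (intro powr_mono2') (auto simp: field_simps)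
  also have "\<dots> = y powr a * K powr (-a)" using assms by (simp add: powr_divide powr_minus_divide)
  finally show ?thesis using False by (simp add: mult.commute)
qed

lemma one_minus_cmod_sq: "1 - (cmod u)\<^sup>2 = (1 - cmod u) * (1 + cmod u)"
  by (simp add: power2_eq_square algebra_simps)

text \<open>A Whitney-type disk: on it the distance to the circle varies only by a bounded factor,
  so weights depending on that distance are almost constant.\<close>

abbreviation half_ball :: "complex \<Rightarrow> complex set" where
  "half_ball w \<equiv> ball w ((1 - cmod w) / 2)"

lemma in_half_ball:
  assumes "u \<in> half_ball w"
  shows "(1 - cmod w) / 2 < 1 - cmod u" "1 - cmod u < 3 / 2 * (1 - cmod w)"
  using assms norm_triangle_ineq2[of u w] norm_triangle_ineq2[of w u]
  by (auto simp: dist_norm norm_minus_commute)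

lemma half_ball_subset:
  assumes "w \<in> unit_disk"
  shows "half_ball w \<subseteq> unit_disk"
proof
  fix u assume u: "u \<in> half_ball w"
  have "cmod w < 1" using assms by simp
  thus "u \<in> unit_disk" using in_half_ball(1)[OF u] by simp
qed

text \<open>\<open>\<psi> t\<close> stands for the mass allowed to a Carleson square of size about
  t. Doubling makes it nearly constant on half balls. The instances are the constant 1, powers, and
  powers of \<open>2 - ln t\<close>.\<close>

locale admissible_weight =
  fixes \<psi> :: "real \<Rightarrow> real" and K :: real
  assumes weight_pos: "\<And>t. 0 < t \<Longrightarrow> t \<le> 1 \<Longrightarrow> \<psi> t > 0"
    and weight_doubling: "\<And>x y. 0 < x \<Longrightarrow> x \<le> 1 \<Longrightarrow> 0 < y \<Longrightarrow> y \<le> 1 \<Longrightarrow> x \<le> 2 * y \<Longrightarrow> y \<le> 2 * x \<Longrightarrow> \<psi> x \<le> K * \<psi> y"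
    and K_pos: "K > 0"
    and weight_measurable [measurable]: "\<psi> \<in> borel_measurable borel"
begin

text \<open>Division by \<open>\<psi>\<close> prepares for Tonelli: there the mass bound carries the
  factor \<open>\<psi> (1 - cmod u)\<close> and cancels it.\<close>

definition weighted_density :: "real \<Rightarrow> real \<Rightarrow> (complex \<Rightarrow> complex) \<Rightarrow> complex \<Rightarrow> real" where
  "weighted_density \<alpha> p f u = dirichlet_density \<alpha> p f u / \<psi> (1 - cmod u)"

abbreviation local_energy :: "real \<Rightarrow> real \<Rightarrow> (complex \<Rightarrow> complex) \<Rightarrow> complex set \<Rightarrow> ennreal" where
  "local_energy \<alpha> p f S \<equiv> \<integral>\<^sup>+u. ennreal (weighted_density \<alpha> p f u) * indicator S u \<partial>disk_area"

abbreviation weighted_deriv :: "real \<Rightarrow> real \<Rightarrow> (complex \<Rightarrow> complex) \<Rightarrow> complex \<Rightarrow> real" where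
  "weighted_deriv \<alpha> p f w \<equiv> cmod (deriv f w) powr p * (1 - cmod w) powr (\<alpha> + 2) / \<psi> (1 - cmod w)"

abbreviation local_bound :: "real \<Rightarrow> real \<Rightarrow> real \<Rightarrow> bool" where
  "local_bound \<alpha> p C \<equiv> \<forall>f w. f \<in> disk_analytic \<and> w \<in> unit_disk \<longrightarrow>
    ennreal (weighted_deriv \<alpha> p f w) \<le> ennreal C * local_energy \<alpha> p f (half_ball w)"

lemma weighted_density_measurable:
  assumes "f \<in> disk_analytic"
  shows "weighted_density \<alpha> p f \<in> borel_measurable disk_area"
proof -
  note [measurable] = borel_measurable_dirichlet_density[OF assms] borel_measurable_cmod_disk_area
  show ?thesis unfolding weighted_density_def by measurable
qed

text \<open>The unweighted mean value estimate is applied to \<open>deriv f\<close> on a half ball,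
  and the weights are then moved under the integral, where they vary by a bounded factor.\<close>

lemma deriv_powr_le_weighted:
  fixes \<alpha> p :: real
  assumes "p > 0"
  shows "\<exists>C>0. local_bound \<alpha> p C"
proof -
  obtain C0 where C0: "C0 > 0" "\<forall>h w r. h holomorphic_on ball w r \<and> ball w r \<subseteq> unit_disk \<and> r > 0 \<longrightarrow>
    ennreal (cmod (h w) powr p * r\<^sup>2) \<le> ennreal C0 * (\<integral>\<^sup>+z. ennreal (cmod (h z) powr p) * indicator (ball w r) z \<partial>disk_area)"
    using holomorphic_powr_le_area_integral[OF assms] by (elim exE conjE)
  \<comment> \<open>On the half ball 1 - (cmod u)^2 and 1 - cmod w are within a factor 3 of each
    other, and the arguments of \<open>\<psi>\<close> are within a factor 2.\<close>
  define L where "L = 3 powr \<bar>\<alpha>\<bar> * K"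
  have L: "L > 0" using K_pos by (simp add: L_def)
  show ?thesis
  proof (intro exI[of _ "4 * C0 * L"] conjI allI impI)
    show "4 * C0 * L > 0" using C0(1) L by simp
    fix f w assume fw: "f \<in> disk_analytic \<and> w \<in> unit_disk"
    hence f: "f \<in> disk_analytic" and w: "w \<in> unit_disk" by auto
    define d where "d = 1 - cmod w"
    have d: "d > 0" "d \<le> 1" using w by (auto simp: d_def)
    let ?B = "half_ball w"
    \<comment> \<open>The 4 compensates the radius d / 2 in the mean value estimate.\<close>
    define c where "c = 4 * d powr \<alpha> / \<psi> d"
    have c: "c \<ge> 0" using weight_pos[OF d] by (simp add: c_def)
    note [measurable] = borel_measurable_disk_analytic[OF f] weighted_density_measurable[OF f]
    have Bm [measurable]: "?B \<in> sets disk_area" by (intro in_sets_disk_area half_ball_subset w) auto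
    have "weighted_deriv \<alpha> p f w =
        c * (cmod (deriv f w) powr p * ((1 - cmod w) / 2)\<^sup>2)"
      using d by (simp add: c_def powr_add d_def[symmetric] power_divide)
    hence "ennreal (weighted_deriv \<alpha> p f w) =
        ennreal c * ennreal (cmod (deriv f w) powr p * ((1 - cmod w) / 2)\<^sup>2)"
      using c by (simp add: ennreal_mult)
    also have "\<dots> \<le> ennreal c * (ennreal C0 * (\<integral>\<^sup>+z. ennreal (cmod (deriv f z) powr p) * indicator ?B z \<partial>disk_area))"
      using f half_ball_subset[OF w] d
      by (intro mult_left_mono C0(2)[rule_format] conjI) (auto simp: d_def disk_analytic_def intro!: holomorphic_deriv elim: holomorphic_on_subset)
    also have "\<dots> = ennreal C0 * (\<integral>\<^sup>+z. ennreal c * (ennreal (cmod (deriv f z) powr p) * indicator ?B z) \<partial>disk_area)"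
      by (subst nn_integral_cmult) (auto simp: mult_ac)
    also have "(\<integral>\<^sup>+z. ennreal c * (ennreal (cmod (deriv f z) powr p) * indicator ?B z) \<partial>disk_area) \<le>
        (\<integral>\<^sup>+u. ennreal (4 * L) * (ennreal (weighted_density \<alpha> p f u) * indicator ?B u) \<partial>disk_area)"
    proof (rule nn_integral_mono)
      fix u
      show "ennreal c * (ennreal (cmod (deriv f u) powr p) * indicator ?B u) \<le>
          ennreal (4 * L) * (ennreal (weighted_density \<alpha> p f u) * indicator ?B u)"
      proof (cases "u \<in> ?B")
        case True
        define e where "e = 1 - cmod u"
        have e: "d / 2 < e" "e < 3 / 2 * d" using in_half_ball[OF True] by (auto simp: d_def e_def)
        have e1: "e \<le> 1" "e > 0" using e d by (auto simp: e_def)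
        have sq: "1 - (cmod u)\<^sup>2 = e * (1 + cmod u)" by (simp add: one_minus_cmod_sq e_def)
        have sq1: "e \<le> 1 - (cmod u)\<^sup>2" using mult_left_mono[of 1 "1 + cmod u" e] e1 by (simp add: sq)
        have sq2: "1 - (cmod u)\<^sup>2 \<le> e * 2" unfolding sq using e1 by (intro mult_left_mono) (auto simp: e_def)
        have "d powr \<alpha> \<le> 3 powr \<bar>\<alpha>\<bar> * (1 - (cmod u)\<^sup>2) powr \<alpha>"
          using e d sq1 sq2 by (intro powr_le_comparable) auto
        moreover have "1 / \<psi> d \<le> K / \<psi> e"
          using weight_doubling[of e d] e e1 d weight_pos[of e] weight_pos[of d] by (simp add: field_simps)
        ultimately have "d powr \<alpha> * (1 / \<psi> d) \<le> (3 powr \<bar>\<alpha>\<bar> * (1 - (cmod u)\<^sup>2) powr \<alpha>) * (K / \<psi> e)"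
          using weight_pos[OF d] by (intro mult_mono) auto
        hence "4 * (d powr \<alpha> * (1 / \<psi> d)) \<le> 4 * ((3 powr \<bar>\<alpha>\<bar> * (1 - (cmod u)\<^sup>2) powr \<alpha>) * (K / \<psi> e))"
          by (intro mult_left_mono) auto
        hence "c \<le> 4 * L * ((1 - (cmod u)\<^sup>2) powr \<alpha> / \<psi> e)" by (simp add: c_def L_def mult_ac)
        hence "c * cmod (deriv f u) powr p \<le> 4 * L * ((1 - (cmod u)\<^sup>2) powr \<alpha> / \<psi> e) * cmod (deriv f u) powr p"
          by (intro mult_right_mono) auto
        also have "\<dots> = 4 * L * weighted_density \<alpha> p f u"
          by (simp add: weighted_density_def dirichlet_density_def e_def)
        finally have "ennreal (c * cmod (deriv f u) powr p) \<le> ennreal (4 * L * weighted_density \<alpha> p f u)"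
          by (rule ennreal_leI)
        thus ?thesis using True c L by (simp add: ennreal_mult')
      qed simp
    qed
    also have "ennreal C0 * \<dots> = ennreal (4 * C0 * L) * local_energy \<alpha> p f ?B"
      using C0(1) L by (subst nn_integral_cmult) (auto simp: ennreal_mult' mult_ac)
    finally show "ennreal (weighted_deriv \<alpha> p f w) \<le>
        ennreal (4 * C0 * L) * local_energy \<alpha> p f ?B"
      by (simp add: mult_left_mono)
  qed
qed

end

section \<open>Concrete weights and the growth of derivatives\<close>

lemma admissible_weight_1: "admissible_weight (\<lambda>_. 1) 1"
  by unfold_locales auto

lemma admissible_weight_powr: "admissible_weight (\<lambda>t. t powr s) (2 powr \<bar>s\<bar>)"
  by unfold_locales (auto intro!: powr_le_comparable)

text \<open>Doubling t shifts \<open>ln t\<close> by \<open>ln 2 < 1\<close>, and the offset 2 keeps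
  the base at least 2 on the unit interval, so this shift changes it by a factor of at most
  2.\<close>

lemma admissible_weight_log: "admissible_weight (\<lambda>t. (2 - ln t) powr s) (2 powr \<bar>s\<bar>)"
proof unfold_locales
  fix x y :: real assume xy: "0 < x" "x \<le> 1" "0 < y" "y \<le> 1" "x \<le> 2 * y" "y \<le> 2 * x"
  have ln2: "ln (2 :: real) \<le> 1" using ln_2_less_1 by simp
  have "ln x \<le> ln (2 * y)" "ln y \<le> ln (2 * x)" using xy by auto
  hence "ln x \<le> ln 2 + ln y" "ln y \<le> ln 2 + ln x" using xy by (auto simp: ln_mult)
  moreover have "ln x \<le> 0" "ln y \<le> 0" using xy by auto
  moreover have "2 - a \<le> 2 * (2 - b)" if "b \<le> c + a" "b \<le> 0" "c \<le> 1" for a b c :: real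
    using that by (simp add: algebra_simps)
  ultimately show "(2 - ln x) powr s \<le> 2 powr \<bar>s\<bar> * (2 - ln y) powr s"
    using ln2 by (intro powr_le_comparable) (blast | linarith)+
next
  fix t :: real assume "0 < t" "t \<le> 1"
  hence "ln t \<le> 0" by simp
  hence "2 - ln t > 0" by linarith
  thus "(2 - ln t) powr s > 0" by simp
qed auto

abbreviation growth_bound :: "real \<Rightarrow> real \<Rightarrow> real \<Rightarrow> bool" where
  "growth_bound \<alpha> p A \<equiv> \<forall>f w. f \<in> disk_analytic \<and> dirichlet_energy \<alpha> p f \<le> 1 \<and> w \<in> unit_disk \<longrightarrow>
    cmod (deriv f w) \<le> A * (1 - cmod w) powr (- (\<alpha> + 2) / p)"

text \<open>The constant weight turns the local bound into the usual growth estimate, once the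
  energy of the half ball is enlarged to the whole energy.\<close>

lemma deriv_growth:
  fixes \<alpha> p :: real
  assumes "p > 0"
  shows "\<exists>C>0. growth_bound \<alpha> p C"
proof -
  interpret admissible_weight "\<lambda>_. 1" 1 by (rule admissible_weight_1)
  obtain C where C: "C > 0" "\<forall>f w. f \<in> disk_analytic \<and> w \<in> unit_disk \<longrightarrow>
    ennreal (cmod (deriv f w) powr p * (1 - cmod w) powr (\<alpha> + 2) / 1) \<le>
    ennreal C * local_energy \<alpha> p f (half_ball w)"
    using deriv_powr_le_weighted[OF assms, of \<alpha>] by (elim exE conjE)
  show ?thesis
  proof (intro exI[of _ "C powr (1 / p)"] conjI allI impI)
    show "C powr (1 / p) > 0" using C by simp
    fix f w assume fw: "f \<in> disk_analytic \<and> dirichlet_energy \<alpha> p f \<le> 1 \<and> w \<in> unit_disk"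
    hence f: "f \<in> disk_analytic" "dirichlet_energy \<alpha> p f \<le> 1" "w \<in> unit_disk" by auto
    define d where "d = 1 - cmod w"
    have d: "d > 0" using f(3) by (simp add: d_def)
    have "ennreal (cmod (deriv f w) powr p * d powr (\<alpha> + 2)) \<le>
        ennreal C * local_energy \<alpha> p f (half_ball w)"
      using C(2)[rule_format, OF conjI[OF f(1,3)]] by (simp add: d_def)
    also have "\<dots> \<le> ennreal C * dirichlet_energy \<alpha> p f"
      unfolding dirichlet_energy_def
      by (intro mult_left_mono nn_integral_mono) (auto simp: weighted_density_def indicator_def)
    also have "\<dots> \<le> ennreal C * 1" by (intro mult_left_mono f(2)) auto
    finally have "cmod (deriv f w) powr p * d powr (\<alpha> + 2) \<le> C" using C(1) by (simp add: ennreal_le_iff)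
    hence "cmod (deriv f w) powr p \<le> C / d powr (\<alpha> + 2)"
      using d by (subst pos_le_divide_eq) auto
    hence "cmod (deriv f w) powr p \<le> C * d powr (- (\<alpha> + 2))"
      unfolding powr_minus_divide by simp
    hence "(cmod (deriv f w) powr p) powr (1 / p) \<le> (C * d powr (- (\<alpha> + 2))) powr (1 / p)"
      using assms by (intro powr_mono2) auto
    thus "cmod (deriv f w) \<le> C powr (1 / p) * (1 - cmod w) powr (- (\<alpha> + 2) / p)"
      using assms C(1) d by (simp add: powr_powr powr_mult d_def)
  qed
qed

text \<open>For z = r \<zeta> it contains the half balls about all points \<rho> \<zeta> with \<rho>
  \<le> r: such a u has distance below (3 / 2) (1 - \<rho>) from z, while 1 - cmod u > (1 - \<rho>)
  / 2, whence the 3. For fixed u the admissible z form a disk of radius 3 (1 - cmod u), which is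
  what Carleson squares can capture.\<close>

definition radial_cone :: "complex \<Rightarrow> complex set" where
  "radial_cone z = {u \<in> unit_disk. cmod (z - u) < 3 * (1 - cmod u)}"

lemma radial_cone_measurable: "radial_cone z \<in> sets disk_area"
proof (rule in_sets_disk_area)
  have "radial_cone z = unit_disk \<inter> {u. cmod (z - u) < 3 * (1 - cmod u)}" by (auto simp: radial_cone_def)
  also have "\<dots> \<in> sets borel"
    by (intro sets.Int borel_open open_Collect_less continuous_intros) auto
  finally show "radial_cone z \<in> sets borel" .
qed (auto simp: radial_cone_def)

lemma half_ball_subset_radial_cone:
  assumes "cmod \<zeta> = 1" "0 \<le> \<rho>" "\<rho> \<le> r" "r < 1"
  shows "ball (of_real \<rho> * \<zeta>) ((1 - \<rho>) / 2) \<subseteq> radial_cone (of_real r * \<zeta>)"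
proof
  have w: "cmod (of_real \<rho> * \<zeta>) = \<rho>" using assms by (simp add: norm_mult)
  fix u assume u: "u \<in> ball (of_real \<rho> * \<zeta>) ((1 - \<rho>) / 2)"
  have u1: "(1 - \<rho>) / 2 < 1 - cmod u" using in_half_ball(1)[of u "of_real \<rho> * \<zeta>"] u w by simp
  have "cmod (of_real r * \<zeta> - of_real \<rho> * \<zeta>) = r - \<rho>"
    using assms by (simp add: norm_mult flip: of_real_diff left_diff_distrib)
  hence "cmod (of_real r * \<zeta> - u) < 3 * (1 - cmod u)"
    using norm_triangle_ineq[of "of_real r * \<zeta> - of_real \<rho> * \<zeta>" "of_real \<rho> * \<zeta> - u"] u u1 assms
    by (simp add: dist_norm)
  thus "u \<in> radial_cone (of_real r * \<zeta>)" using u1 assms by (simp add: radial_cone_def)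
qed

lemma radial_has_vector_derivative:
  assumes "f \<in> disk_analytic" "cmod \<zeta> = 1" "0 \<le> x" "x < 1"
  shows "((\<lambda>x. f (of_real x * \<zeta>)) has_vector_derivative \<zeta> * deriv f (of_real x * \<zeta>)) (at x within S)"
proof -
  have "(f has_field_derivative deriv f (of_real x * \<zeta>)) (at (of_real x * \<zeta>))"
    using assms by (intro disk_analytic_deriv) (auto simp: norm_mult)
  moreover have "((\<lambda>x. of_real x * \<zeta>) has_vector_derivative \<zeta>) (at x within S)"
    unfolding has_vector_derivative_def
    by (auto intro!: derivative_eq_intros simp: scaleR_conv_of_real)
  ultimately show ?thesis using field_vector_diff_chain_within[of "\<lambda>x. of_real x * \<zeta>" \<zeta> x S f]
    by (auto simp: o_def has_field_derivative_at_within)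
qed

lemma radial_deriv_continuous:
  assumes "f \<in> disk_analytic" "cmod \<zeta> = 1" "r < 1"
  shows "continuous_on {0..r} (\<lambda>x. deriv f (of_real x * \<zeta>))"
proof (rule continuous_on_compose2[of unit_disk "deriv f"])
  show "continuous_on unit_disk (deriv f)"
    using assms by (intro holomorphic_on_imp_continuous_on holomorphic_deriv) (auto simp: disk_analytic_def)
qed (use assms in \<open>auto intro!: continuous_intros simp: norm_mult\<close>)

lemma radial_growth:
  assumes f: "f \<in> disk_analytic" "cmod \<zeta> = 1" and ab: "0 \<le> a" "a \<le> b" "b < 1"
    and \<Psi>: "\<And>x. a \<le> x \<Longrightarrow> x \<le> b \<Longrightarrow> (\<Psi> has_real_derivative \<psi> x) (at x)"
    and le: "\<And>x. a \<le> x \<Longrightarrow> x \<le> b \<Longrightarrow> cmod (deriv f (of_real x * \<zeta>)) \<le> \<psi> x"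
  shows "cmod (f (of_real b * \<zeta>) - f (of_real a * \<zeta>)) \<le> \<Psi> b - \<Psi> a"
proof (cases "a = b")
  case False
  show ?thesis
  proof (rule differentiable_bound_general[of a b "\<lambda>x. f (of_real x * \<zeta>)" \<Psi> "\<lambda>x. \<zeta> * deriv f (of_real x * \<zeta>)" \<psi>])
    show "continuous_on {a..b} (\<lambda>x. f (of_real x * \<zeta>))"
      using radial_has_vector_derivative[OF f] ab
      by (intro continuous_on_vector_derivative[of _ _ "\<lambda>x. \<zeta> * deriv f (of_real x * \<zeta>)"]) auto
    show "continuous_on {a..b} \<Psi>" using \<Psi> by (intro DERIV_continuous_on[of _ _ \<psi>]) (auto intro: has_field_derivative_at_within)
    fix x assume x: "a < x" "x < b"
    show "((\<lambda>x. f (of_real x * \<zeta>)) has_vector_derivative \<zeta> * deriv f (of_real x * \<zeta>)) (at x)"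
      using radial_has_vector_derivative[OF f, of x UNIV] ab x by simp
    show "(\<Psi> has_vector_derivative \<psi> x) (at x)"
      using \<Psi>[of x] x by (simp add: has_real_derivative_iff_has_vector_derivative)
    show "norm (\<zeta> * deriv f (of_real x * \<zeta>)) \<le> \<psi> x" using le[of x] x f(2) by (simp add: norm_mult)
  qed (use False ab in auto)
qed simp

text \<open>The integral form serves the critical exponent, where the derivative is controlled only
  on average along the radius and not by a pointwise majorant with a known primitive.\<close>

lemma radial_growth_nn_integral:
  assumes f: "f \<in> disk_analytic" "cmod \<zeta> = 1" and r: "0 \<le> r" "r < 1"
  shows "ennreal (cmod (f (of_real r * \<zeta>) - f 0)) \<le>
    (\<integral>\<^sup>+x. ennreal (cmod (deriv f (of_real x * \<zeta>))) * indicator {0..r} x \<partial>lborel)"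
proof -
  have hb: "has_bochner_integral lborel (\<lambda>x. indicator {0..r} x *\<^sub>R (\<zeta> * deriv f (of_real x * \<zeta>)))
    (f (of_real r * \<zeta>) - f (of_real 0 * \<zeta>))"
    using r by (intro has_bochner_integral_FTC_Icc radial_has_vector_derivative[OF f] continuous_intros radial_deriv_continuous[OF f]) auto
  have "ennreal (cmod (f (of_real r * \<zeta>) - f (of_real 0 * \<zeta>))) \<le>
      (\<integral>\<^sup>+x. ennreal (norm (indicator {0..r} x *\<^sub>R (\<zeta> * deriv f (of_real x * \<zeta>)))) \<partial>lborel)"
    by (rule has_bochner_integral_norm_bound[OF hb])
  also have "\<dots> = (\<integral>\<^sup>+x. ennreal (cmod (deriv f (of_real x * \<zeta>))) * indicator {0..r} x \<partial>lborel)"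
    by (intro nn_integral_cong) (auto simp: indicator_def f(2) norm_mult)
  finally show ?thesis by simp
qed

lemma disk_polar:
  assumes "z \<in> unit_disk"
  obtains r \<zeta> where "0 \<le> r" "r < 1" "cmod \<zeta> = 1" "z = of_real r * \<zeta>"
proof (cases "z = 0")
  case True
  show ?thesis by (rule that[of 0 1]) (use True in auto)
next
  case False
  show ?thesis by (rule that[of "cmod z" "sgn z"]) (use False assms in \<open>auto simp: norm_divide sgn_eq\<close>)
qed

text \<open>Hedberg's device: the global growth bound controls \<open>f'\<close> away from the boundary, the local
  quantity \<open>G\<close> controls it near the boundary, and the splitting point is optimised.\<close>

lemma radial_interpolation:
  assumes f: "f \<in> disk_analytic" "cmod \<zeta> = 1" and r: "0 \<le> r" "r < 1"
    and pos: "\<tau> > 0" "\<eta> > 0" "A > 0" "G > 0"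
    and bound1: "\<And>x. 0 \<le> x \<Longrightarrow> x \<le> r \<Longrightarrow> cmod (deriv f (of_real x * \<zeta>)) \<le> A * (1 - x) powr (- \<tau> - 1)"
    and bound2: "\<And>x. 0 \<le> x \<Longrightarrow> x \<le> r \<Longrightarrow> cmod (deriv f (of_real x * \<zeta>)) \<le> G * (1 - x) powr (\<eta> - 1)"
  shows "cmod (f (of_real r * \<zeta>) - f 0) \<le> (A / \<tau> + 1 / \<eta>) * G powr (\<tau> / (\<tau> + \<eta>))"
proof -
  \<comment> \<open>The distance to the boundary at which both contributions agree: \<sigma> powr
    (-\<tau>) = G \<sigma> powr \<eta> = G powr (\<tau> / (\<tau> + \<eta>)).\<close>
  define \<sigma> where "\<sigma> = G powr (- 1 / (\<tau> + \<eta>))"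
  define \<delta> where "\<delta> = min 1 \<sigma>"
  \<comment> \<open>The two truncations cover the degenerate cases: for \<sigma> \<ge> 1 the inner
    piece is empty, and for r \<le> 1 - \<delta> the outer piece is.\<close>
  define m where "m = min r (1 - \<delta>)"
  define g where "g = G powr (\<tau> / (\<tau> + \<eta>))"
  have \<sigma>: "\<sigma> > 0" "\<sigma> powr (- \<tau>) = g" "G * \<sigma> powr \<eta> = g"
  proof -
    show "\<sigma> > 0" using pos by (simp add: \<sigma>_def)
    show "\<sigma> powr (- \<tau>) = g" by (simp add: \<sigma>_def g_def powr_powr)
    have "G * \<sigma> powr \<eta> = G powr (1 + - \<eta> / (\<tau> + \<eta>))" unfolding powr_add using pos by (simp add: \<sigma>_def powr_powr)
    also have "1 + - \<eta> / (\<tau> + \<eta>) = \<tau> / (\<tau> + \<eta>)" using pos by (simp add: field_simps)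
    finally show "G * \<sigma> powr \<eta> = g" by (simp add: g_def)
  qed
  have \<delta>: "0 < \<delta>" "\<delta> \<le> 1" "\<delta> \<le> \<sigma>" using \<sigma>(1) by (auto simp: \<delta>_def)
  have m: "0 \<le> m" "m \<le> r" "m \<le> 1 - \<delta>" using r \<delta> by (auto simp: m_def)
  have g: "g > 0" using pos by (simp add: g_def)
  have "cmod (f (of_real m * \<zeta>) - f (of_real 0 * \<zeta>)) \<le> A / \<tau> * (1 - m) powr (- \<tau>) - A / \<tau> * (1 - 0) powr (- \<tau>)"
    using m r pos by (intro radial_growth[OF f, where \<psi> = "\<lambda>x. A * (1 - x) powr (- \<tau> - 1)"] bound1)
      (auto intro!: derivative_eq_intros simp: field_simps)
  also have "\<dots> \<le> A / \<tau> * g"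
  proof (cases "\<delta> = 1")
    case True
    hence "m = 0" using m by auto
    thus ?thesis using pos g by simp
  next
    case False
    hence "\<delta> = \<sigma>" by (auto simp: \<delta>_def)
    hence "(1 - m) powr (- \<tau>) \<le> g" unfolding \<sigma>(2)[symmetric] using m \<sigma>(1) pos by (intro powr_mono2') auto
    hence "A / \<tau> * (1 - m) powr (- \<tau>) \<le> A / \<tau> * g" using pos by (intro mult_left_mono) auto
    moreover have "A / \<tau> \<ge> 0" using pos by simp
    ultimately show ?thesis by simp
  qed
  finally have le1: "cmod (f (of_real m * \<zeta>) - f 0) \<le> A / \<tau> * g" by simp
  have "cmod (f (of_real r * \<zeta>) - f (of_real m * \<zeta>)) \<le> - (G / \<eta> * (1 - r) powr \<eta>) - - (G / \<eta> * (1 - m) powr \<eta>)"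
    using m r pos by (intro radial_growth[OF f, where \<psi> = "\<lambda>x. G * (1 - x) powr (\<eta> - 1)"] bound2)
      (auto intro!: derivative_eq_intros simp: field_simps)
  also have "\<dots> \<le> 1 / \<eta> * g"
  proof (cases "m = r")
    case False
    hence "m = 1 - \<delta>" by (auto simp: m_def min_def split: if_splits)
    hence "(1 - m) powr \<eta> \<le> \<sigma> powr \<eta>" using \<delta> pos by (intro powr_mono2) auto
    hence "G / \<eta> * (1 - m) powr \<eta> \<le> G / \<eta> * \<sigma> powr \<eta>" using pos by (intro mult_left_mono) auto
    also have "\<dots> = 1 / \<eta> * g" using \<sigma>(3) by (simp add: field_simps)
    finally have "G / \<eta> * (1 - m) powr \<eta> \<le> 1 / \<eta> * g" .
    moreover have "G / \<eta> * (1 - r) powr \<eta> \<ge> 0" using pos by simp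
    ultimately show ?thesis by linarith
  qed (use pos g in auto)
  finally have "cmod (f (of_real r * \<zeta>) - f (of_real m * \<zeta>)) \<le> 1 / \<eta> * g" .
  hence "cmod (f (of_real r * \<zeta>) - f 0) \<le> A / \<tau> * g + 1 / \<eta> * g"
    using le1 norm_triangle_ineq[of "f (of_real r * \<zeta>) - f (of_real m * \<zeta>)" "f (of_real m * \<zeta>) - f 0"] by simp
  thus ?thesis by (simp add: g_def distrib_right)
qed

lemma cmod_deriv_powr_le_imp:
  fixes p :: real
  assumes "p > 0" "0 < d" "B \<ge> 0" "x \<ge> 0" "x powr p * d powr a \<le> B"
  shows "x \<le> B powr (1 / p) * d powr (- a / p)"
proof -
  have "x powr p \<le> B / d powr a" using assms by (subst pos_le_divide_eq) auto
  hence "(x powr p) powr (1 / p) \<le> (B / d powr a) powr (1 / p)" using assms by (intro powr_mono2) auto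
  also have "\<dots> = B powr (1 / p) * d powr (- a / p)"
    using assms by (simp add: powr_divide powr_powr powr_minus_divide)
  finally show ?thesis using assms by (simp add: powr_powr)
qed

text \<open>In f the left side has degree q and the right side only degree p; the normalisation to
  unit energy makes up for the difference.\<close>

definition carleson_pointwise :: "real \<Rightarrow> real \<Rightarrow> real \<Rightarrow> (real \<Rightarrow> real) \<Rightarrow> bool" where
  "carleson_pointwise \<alpha> p q \<psi> \<longleftrightarrow> (\<exists>C>0. \<forall>f z. f \<in> disk_analytic \<and> dirichlet_energy \<alpha> p f \<le> 1 \<and> z \<in> unit_disk \<longrightarrow>
    ennreal (cmod (f z - f 0) powr q) \<le> ennreal C *
      (\<integral>\<^sup>+u. ennreal (dirichlet_density \<alpha> p f u / \<psi> (1 - cmod u)) * indicator (radial_cone z) u \<partial>disk_area))"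

context admissible_weight
begin

lemma half_ball_integral_le_cone:
  assumes "cmod \<zeta> = 1" "0 \<le> x" "x \<le> r" "r < 1"
  shows "local_energy \<alpha> p f (half_ball (of_real x * \<zeta>))
    \<le> local_energy \<alpha> p f (radial_cone (of_real r * \<zeta>))"
proof (rule nn_integral_mono)
  fix u
  have "half_ball (of_real x * \<zeta>) \<subseteq> radial_cone (of_real r * \<zeta>)"
    using half_ball_subset_radial_cone[OF assms] assms by (simp add: norm_mult)
  thus "ennreal (weighted_density \<alpha> p f u) * indicator (half_ball (of_real x * \<zeta>)) u
      \<le> ennreal (weighted_density \<alpha> p f u) * indicator (radial_cone (of_real r * \<zeta>)) u"
    by (auto simp: indicator_def)
qed

text \<open>If the cone integral vanishes then so does \<open>f'\<close> along the radius; if it is infinite there is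
  nothing to show.\<close>

lemma carleson_pointwiseI:
  assumes p: "p > 0" and C: "C > 0"
    and main: "\<And>f r \<zeta> B. f \<in> disk_analytic \<Longrightarrow> dirichlet_energy \<alpha> p f \<le> 1 \<Longrightarrow> 0 \<le> r \<Longrightarrow> r < 1 \<Longrightarrow> cmod \<zeta> = 1 \<Longrightarrow> B > 0 \<Longrightarrow>
      local_energy \<alpha> p f (radial_cone (of_real r * \<zeta>)) = ennreal B \<Longrightarrow>
      cmod (f (of_real r * \<zeta>) - f 0) powr q \<le> C * B"
  shows "carleson_pointwise \<alpha> p q \<psi>"
  unfolding carleson_pointwise_def
proof (intro exI[of _ C] conjI allI impI C)
  fix f z assume "f \<in> disk_analytic \<and> dirichlet_energy \<alpha> p f \<le> 1 \<and> z \<in> unit_disk"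
  hence f: "f \<in> disk_analytic" "dirichlet_energy \<alpha> p f \<le> 1" "z \<in> unit_disk" by auto
  obtain r \<zeta> where z: "0 \<le> r" "r < 1" "cmod \<zeta> = 1" "z = of_real r * \<zeta>" using disk_polar[OF f(3)] .
  define I where "I = local_energy \<alpha> p f (radial_cone (of_real r * \<zeta>))"
  have "ennreal (cmod (f z - f 0) powr q) \<le> ennreal C * I"
  proof (cases I)
    case top
    thus ?thesis using C by (simp add: ennreal_mult_top)
  next
    case (real B)
    show ?thesis
    proof (cases "B > 0")
      case True
      hence "cmod (f z - f 0) powr q \<le> C * B" using main[OF f(1,2) z(1-3)] real unfolding z(4) I_def by blast
      thus ?thesis using real C by (simp add: ennreal_leI flip: ennreal_mult)
    next
      case False
      hence I0: "I = 0" using real by simp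
      obtain C0 where C0: "C0 > 0" "local_bound \<alpha> p C0"
        using deriv_powr_le_weighted[OF p, of \<alpha>] by (elim exE conjE)
      have "cmod (deriv f (of_real x * \<zeta>)) \<le> 0" if x: "0 \<le> x" "x \<le> r" for x
      proof -
        define w where "w = of_real x * \<zeta>"
        have w: "cmod w = x" "w \<in> unit_disk" using x z by (auto simp: w_def norm_mult)
        have "ennreal (weighted_deriv \<alpha> p f w) \<le>
          ennreal C0 * local_energy \<alpha> p f (half_ball w)"
          using C0(2) f(1) w(2) by blast
        also have "\<dots> \<le> ennreal C0 * I"
          unfolding I_def w_def using x z by (intro mult_left_mono half_ball_integral_le_cone) auto
        finally have "cmod (deriv f w) powr p * (1 - x) powr (\<alpha> + 2) / \<psi> (1 - x) \<le> 0"
          using w I0 by (simp add: ennreal_eq_0_iff)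
        moreover have "\<psi> (1 - x) > 0" using x z by (intro weight_pos) auto
        moreover have "(1 - x) powr (\<alpha> + 2) > 0" using x z by simp
        ultimately have "cmod (deriv f w) powr p \<le> 0" by (simp add: divide_le_0_iff mult_le_0_iff)
        thus ?thesis unfolding w_def by simp
      qed
      hence "cmod (f (of_real r * \<zeta>) - f (of_real 0 * \<zeta>)) \<le> (\<lambda>_. 0) r - (\<lambda>_. 0) 0"
        using z by (intro radial_growth[OF f(1) z(3), where \<psi> = "\<lambda>_. 0"]) auto
      thus ?thesis unfolding z(4) by simp
    qed
  qed
  thus "ennreal (cmod (f z - f 0) powr q) \<le> ennreal C *
      (\<integral>\<^sup>+u. ennreal (dirichlet_density \<alpha> p f u / \<psi> (1 - cmod u)) * indicator (radial_cone z) u \<partial>disk_area)"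
    unfolding I_def weighted_density_def z(4) .
qed

end

text \<open>With s = q \<tau> the local bound on f' has order \<eta> - 1 for \<eta> = \<tau> (q - p)
  / p, positive since p < q and p < \<alpha> + 2. Then \<tau> / (\<tau> + \<eta>) = p / q, so the
  q-th power of the interpolated bound is a multiple of G powr p = C0 B.\<close>

lemma carleson_pointwise_powr:
  fixes \<alpha> p q :: real
  assumes pq: "0 < p" "p < q" and \<alpha>: "p < \<alpha> + 2"
  shows "carleson_pointwise \<alpha> p q (\<lambda>t. t powr (q * (\<alpha> + 2 - p) / p))"
proof -
  define \<tau> where "\<tau> = (\<alpha> + 2 - p) / p"
  define \<eta> where "\<eta> = \<tau> * (q - p) / p"
  define s where "s = q * (\<alpha> + 2 - p) / p"
  have pos: "\<tau> > 0" "\<eta> > 0" using pq \<alpha> by (auto simp: \<tau>_def \<eta>_def)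
  have e1: "- (\<alpha> + 2) / p = - \<tau> - 1" using pq by (simp add: \<tau>_def field_simps)
  have s: "s = q * \<tau>" by (simp add: s_def \<tau>_def)
  have p\<tau>: "p * \<tau> = \<alpha> + 2 - p" using pq by (simp add: \<tau>_def)
  have p\<eta>: "p * \<eta> = \<tau> * (q - p)" using pq by (simp add: \<eta>_def)
  have "p * (\<eta> - 1) = - (\<alpha> + 2 - s)" using p\<tau> p\<eta> s by (simp add: algebra_simps)
  hence e2: "- (\<alpha> + 2 - s) / p = \<eta> - 1" using pq by (simp add: field_simps)
  have "\<tau> + \<eta> = \<tau> * q / p" using pq by (simp add: \<eta>_def field_simps)
  hence e3: "\<tau> / (\<tau> + \<eta>) = p / q" using pos pq by (simp add: field_simps)
  interpret admissible_weight "\<lambda>t. t powr s" "2 powr \<bar>s\<bar>" by (rule admissible_weight_powr)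
  obtain A where A: "A > 0" "growth_bound \<alpha> p A"
    using deriv_growth[OF pq(1), of \<alpha>] by (elim exE conjE)
  obtain C0 where C0: "C0 > 0" "\<forall>f w. f \<in> disk_analytic \<and> w \<in> unit_disk \<longrightarrow>
    ennreal (cmod (deriv f w) powr p * (1 - cmod w) powr (\<alpha> + 2) / (1 - cmod w) powr s) \<le>
    ennreal C0 * local_energy \<alpha> p f (half_ball w)"
    using deriv_powr_le_weighted[OF pq(1), of \<alpha>] by (elim exE conjE)
  define M where "M = A / \<tau> + 1 / \<eta>"
  have M: "M > 0" using A pos by (simp add: M_def add_pos_pos)
  have "carleson_pointwise \<alpha> p q (\<lambda>t. t powr s)"
  proof (rule carleson_pointwiseI[where C = "M powr q * C0"])
    show "M powr q * C0 > 0" using M C0 by simp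
    fix f r \<zeta> B
    assume f: "f \<in> disk_analytic" "dirichlet_energy \<alpha> p f \<le> 1" and r: "0 \<le> r" "r < 1" and \<zeta>: "cmod \<zeta> = 1" and B: "(B::real) > 0"
      and I: "local_energy \<alpha> p f (radial_cone (of_real r * \<zeta>)) = ennreal B"
    define G where "G = (C0 * B) powr (1 / p)"
    have G: "G > 0" using C0 B by (simp add: G_def)
    have "cmod (f (of_real r * \<zeta>) - f 0) \<le> (A / \<tau> + 1 / \<eta>) * G powr (\<tau> / (\<tau> + \<eta>))"
    proof (rule radial_interpolation[OF f(1) \<zeta> r pos A(1) G])
      fix x assume x: "0 \<le> x" "x \<le> r"
      define w where "w = of_real x * \<zeta>"
      have w: "cmod w = x" "w \<in> unit_disk" using x r \<zeta> by (auto simp: w_def norm_mult)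
      show "cmod (deriv f (of_real x * \<zeta>)) \<le> A * (1 - x) powr (- \<tau> - 1)"
        using A(2) f w unfolding e1 w_def[symmetric] by blast
      have "ennreal (cmod (deriv f w) powr p * (1 - cmod w) powr (\<alpha> + 2) / (1 - cmod w) powr s) \<le>
          ennreal C0 * local_energy \<alpha> p f (half_ball w)"
        using C0(2) f(1) w(2) by blast
      also have "\<dots> \<le> ennreal C0 * ennreal B"
        unfolding I[symmetric] w_def using x r \<zeta> by (intro mult_left_mono half_ball_integral_le_cone) auto
      finally have "cmod (deriv f w) powr p * (1 - x) powr (\<alpha> + 2) / (1 - x) powr s \<le> C0 * B"
        using w B C0 by (simp add: ennreal_le_iff flip: ennreal_mult)
      hence "cmod (deriv f w) powr p * (1 - x) powr (\<alpha> + 2 - s) \<le> C0 * B" by (simp add: powr_diff)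
      hence "cmod (deriv f w) \<le> (C0 * B) powr (1 / p) * (1 - x) powr (- (\<alpha> + 2 - s) / p)"
        using pq x r B C0 by (intro cmod_deriv_powr_le_imp) auto
      thus "cmod (deriv f (of_real x * \<zeta>)) \<le> G * (1 - x) powr (\<eta> - 1)"
        unfolding e2 by (simp add: G_def w_def)
    qed
    hence "cmod (f (of_real r * \<zeta>) - f 0) powr q \<le> (M * G powr (p / q)) powr q"
      unfolding e3 M_def using pq by (intro powr_mono2) auto
    also have "\<dots> = M powr q * (C0 * B)"
      using M G pq C0 B by (simp add: powr_mult powr_powr G_def)
    finally show "cmod (f (of_real r * \<zeta>) - f 0) powr q \<le> M powr q * C0 * B" by (simp add: mult_ac)
  qed (rule pq)
  thus ?thesis by (simp add: s_def)
qed

text \<open>Here the growth exponent - (\<alpha> + 2) / p exceeds -1 and is integrable up to the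
  boundary.\<close>

lemma disk_analytic_oscillation_bounded:
  fixes \<alpha> p :: real
  assumes p: "p > 0" and \<alpha>: "-2 < \<alpha>" "\<alpha> + 2 < p"
  shows "\<exists>C>0. \<forall>f z. f \<in> disk_analytic \<and> dirichlet_energy \<alpha> p f \<le> 1 \<and> z \<in> unit_disk \<longrightarrow> cmod (f z - f 0) \<le> C"
proof -
  define \<eta> where "\<eta> = 1 - (\<alpha> + 2) / p"
  have \<eta>: "\<eta> > 0" "- (\<alpha> + 2) / p = \<eta> - 1" using p \<alpha> by (auto simp: \<eta>_def field_simps)
  obtain A where A: "A > 0" "growth_bound \<alpha> p A"
    using deriv_growth[OF p, of \<alpha>] by (elim exE conjE)
  show ?thesis
  proof (intro exI[of _ "A / \<eta>"] conjI allI impI)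
    show "A / \<eta> > 0" using A \<eta> by simp
    fix f z assume "f \<in> disk_analytic \<and> dirichlet_energy \<alpha> p f \<le> 1 \<and> z \<in> unit_disk"
    hence f: "f \<in> disk_analytic" "dirichlet_energy \<alpha> p f \<le> 1" "z \<in> unit_disk" by auto
    obtain r \<zeta> where z: "0 \<le> r" "r < 1" "cmod \<zeta> = 1" "z = of_real r * \<zeta>" using disk_polar[OF f(3)] .
    have "cmod (f (of_real r * \<zeta>) - f (of_real 0 * \<zeta>)) \<le> - (A / \<eta> * (1 - r) powr \<eta>) - - (A / \<eta> * (1 - 0) powr \<eta>)"
    proof (rule radial_growth[OF f(1) z(3), where \<psi> = "\<lambda>x. A * (1 - x) powr (\<eta> - 1)"])
      fix x assume x: "0 \<le> x" "x \<le> r"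
      show "((\<lambda>x. - (A / \<eta> * (1 - x) powr \<eta>)) has_real_derivative A * (1 - x) powr (\<eta> - 1)) (at x)"
        using x z \<eta>(1) by (auto intro!: derivative_eq_intros simp: field_simps)
      have "cmod (of_real x * \<zeta>) = x" "of_real x * \<zeta> \<in> unit_disk" using x z by (auto simp: norm_mult)
      thus "cmod (deriv f (of_real x * \<zeta>)) \<le> A * (1 - x) powr (\<eta> - 1)"
        using A(2) f(1,2) unfolding \<eta>(2) by metis
    qed (use z in auto)
    also have "\<dots> \<le> A / \<eta>" using A \<eta> by simp
    finally show "cmod (f z - f 0) \<le> A / \<eta>" unfolding z(4) by simp
  qed
qed

text \<open>Tonelli: a point \<open>u\<close> lies in the half balls around \<open>x \<zeta>\<close> only while \<open>1 - x\<close> is comparable to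
  \<open>1 - \<bar>u\<bar>\<close>.\<close>

lemma radial_integral_half_balls_le:
  assumes \<Phi>: "\<Phi> \<in> borel_measurable disk_area" and \<zeta>: "cmod \<zeta> = 1" and r: "0 \<le> r" "r < 1"
  shows "(\<integral>\<^sup>+x. ennreal (1 / (1 - x)) * indicator {0..r} x *
      (\<integral>\<^sup>+u. \<Phi> u * indicator (ball (of_real x * \<zeta>) ((1 - x) / 2)) u \<partial>disk_area) \<partial>lborel)
    \<le> 2 * (\<integral>\<^sup>+u. \<Phi> u * indicator (radial_cone (of_real r * \<zeta>)) u \<partial>disk_area)"
proof -
  note [measurable] = \<Phi>
  interpret ps: pair_sigma_finite lborel disk_area ..
  \<comment> \<open>The moving balls are written as sections of one measurable set in the product,
    as the exchange of integrals requires.\<close>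
  define E where "E = {xu :: real \<times> complex. dist (of_real (fst xu) * \<zeta>) (snd xu) < (1 - fst xu) / 2}"
  have [measurable]: "Measurable.pred (lborel \<Otimes>\<^sub>M disk_area) (\<lambda>xu. xu \<in> E)"
    unfolding E_def mem_Collect_eq by measurable
  have E: "indicator (ball (of_real x * \<zeta>) ((1 - x) / 2)) u = (indicator E (x, u) :: ennreal)" for x u
    by (simp add: E_def indicator_def)
  have "(\<integral>\<^sup>+x. ennreal (1 / (1 - x)) * indicator {0..r} x *
      (\<integral>\<^sup>+u. \<Phi> u * indicator (ball (of_real x * \<zeta>) ((1 - x) / 2)) u \<partial>disk_area) \<partial>lborel) =
    (\<integral>\<^sup>+x. (\<integral>\<^sup>+u. ennreal (1 / (1 - x)) * indicator {0..r} x * (\<Phi> u * indicator E (x, u)) \<partial>disk_area) \<partial>lborel)"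
    unfolding E by (intro nn_integral_cong nn_integral_cmult[symmetric]) measurable
  also have "\<dots> = (\<integral>\<^sup>+u. (\<integral>\<^sup>+x. ennreal (1 / (1 - x)) * indicator {0..r} x * (\<Phi> u * indicator E (x, u)) \<partial>lborel) \<partial>disk_area)"
    by (rule ps.Fubini'[symmetric]) measurable
  also have "\<dots> \<le> (\<integral>\<^sup>+u. 2 * (\<Phi> u * indicator (radial_cone (of_real r * \<zeta>)) u) \<partial>disk_area)"
  proof (rule nn_integral_mono)
    fix u assume "u \<in> space disk_area"
    hence u: "cmod u < 1" by simp
    define t where "t = 1 - cmod u"
    have t: "t > 0" using u by (simp add: t_def)
    \<comment> \<open>Membership in the half ball confines 1 - x to the range from 2 t / 3 to 2 t.
      There 1 / (1 - x) \<le> 3 / (2 t), and the window has length 4 t / 3; the product of these two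
      is the factor 2.\<close>
    have le: "ennreal (1 / (1 - x)) * indicator {0..r} x * (\<Phi> u * indicator E (x, u)) \<le>
      (\<Phi> u * indicator (radial_cone (of_real r * \<zeta>)) u) * (ennreal (3 / (2 * t)) * indicator {1 - 2 * t..1 - 2 / 3 * t} x)" for x
    proof (cases "x \<in> {0..r} \<and> (x, u) \<in> E")
      case True
      hence x: "0 \<le> x" "x \<le> r" "u \<in> ball (of_real x * \<zeta>) ((1 - x) / 2)" by (auto simp: E_def)
      have cm: "cmod (of_real x * \<zeta>) = x" using x \<zeta> by (simp add: norm_mult)
      have lt: "(1 - x) / 2 < t" "t < 3 / 2 * (1 - x)"
        using in_half_ball[of u "of_real x * \<zeta>"] x(3) cm by (auto simp: t_def)
      have "u \<in> radial_cone (of_real r * \<zeta>)" using half_ball_subset_radial_cone[OF \<zeta> x(1,2) r(2)] x(3) by blast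
      moreover have "1 / (1 - x) \<le> 3 / (2 * t)" using lt t x r by (simp add: field_simps)
      ultimately show ?thesis using True lt by (auto simp: mult.commute[of "\<Phi> u"] intro!: mult_right_mono ennreal_leI)
    qed (auto simp: indicator_def)
    have "(\<integral>\<^sup>+x. ennreal (1 / (1 - x)) * indicator {0..r} x * (\<Phi> u * indicator E (x, u)) \<partial>lborel) \<le>
      (\<integral>\<^sup>+x. (\<Phi> u * indicator (radial_cone (of_real r * \<zeta>)) u) * (ennreal (3 / (2 * t)) * indicator {1 - 2 * t..1 - 2 / 3 * t} x) \<partial>lborel)"
      by (intro nn_integral_mono le)
    also have "\<dots> = (\<Phi> u * indicator (radial_cone (of_real r * \<zeta>)) u) * (ennreal (3 / (2 * t)) * emeasure lborel {1 - 2 * t..1 - 2 / 3 * t})"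
      by (subst nn_integral_cmult) (auto simp: nn_integral_cmult)
    also have "ennreal (3 / (2 * t)) * emeasure lborel {1 - 2 * t..1 - 2 / 3 * t} = 2"
    proof -
      have "ennreal (3 / (2 * t)) * emeasure lborel {1 - 2 * t..1 - 2 / 3 * t} = ennreal (3 / (2 * t) * (4 / 3 * t))"
        using t by (subst ennreal_mult) auto
      also have "3 / (2 * t) * (4 / 3 * t) = 2" using t by (simp add: field_simps)
      finally show ?thesis by simp
    qed
    finally show "(\<integral>\<^sup>+x. ennreal (1 / (1 - x)) * indicator {0..r} x * (\<Phi> u * indicator E (x, u)) \<partial>lborel) \<le>
        2 * (\<Phi> u * indicator (radial_cone (of_real r * \<zeta>)) u)" by (simp add: mult.commute)
  qed
  also have "\<dots> = 2 * (\<integral>\<^sup>+u. \<Phi> u * indicator (radial_cone (of_real r * \<zeta>)) u \<partial>disk_area)"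
    by (intro nn_integral_cmult borel_measurable_times_ennreal borel_measurable_indicator \<Phi> radial_cone_measurable)
  finally show ?thesis .
qed

context admissible_weight
begin

text \<open>The local bound, averaged along the radius in dx / (1 - x): the half balls overlap
  boundedly, so summing them costs no more than a constant. At the critical exponent the bounds at
  single points lose too much.\<close>

lemma radial_weighted_integral_le:
  fixes \<alpha> p :: real
  assumes "p > 0"
  shows "\<exists>C>0. \<forall>f \<zeta> r. f \<in> disk_analytic \<and> cmod \<zeta> = 1 \<and> 0 \<le> r \<and> r < 1 \<longrightarrow>
    (\<integral>\<^sup>+x. ennreal (1 / (1 - x)) * indicator {0..r} x *
      ennreal (cmod (deriv f (of_real x * \<zeta>)) powr p * (1 - x) powr (\<alpha> + 2) / \<psi> (1 - x)) \<partial>lborel) \<le>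
    ennreal C * local_energy \<alpha> p f (radial_cone (of_real r * \<zeta>))"
proof -
  obtain C0 where C0: "C0 > 0" "local_bound \<alpha> p C0"
    using deriv_powr_le_weighted[OF assms, of \<alpha>] by (elim exE conjE)
  show ?thesis
  proof (intro exI[of _ "2 * C0"] conjI allI impI)
    show "2 * C0 > 0" using C0 by simp
    fix f \<zeta> r assume "f \<in> disk_analytic \<and> cmod \<zeta> = 1 \<and> 0 \<le> r \<and> r < (1::real)"
    hence f: "f \<in> disk_analytic" "cmod \<zeta> = 1" "0 \<le> r" "r < 1" by auto
    define \<Phi> where "\<Phi> = (\<lambda>u. ennreal C0 * ennreal (weighted_density \<alpha> p f u))"
    note [measurable] = weighted_density_measurable[OF f(1)]
    have \<Phi>: "\<Phi> \<in> borel_measurable disk_area" unfolding \<Phi>_def by measurable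
    have "(\<integral>\<^sup>+x. ennreal (1 / (1 - x)) * indicator {0..r} x *
        ennreal (cmod (deriv f (of_real x * \<zeta>)) powr p * (1 - x) powr (\<alpha> + 2) / \<psi> (1 - x)) \<partial>lborel) \<le>
      (\<integral>\<^sup>+x. ennreal (1 / (1 - x)) * indicator {0..r} x *
        (\<integral>\<^sup>+u. \<Phi> u * indicator (ball (of_real x * \<zeta>) ((1 - x) / 2)) u \<partial>disk_area) \<partial>lborel)"
    proof (rule nn_integral_mono)
      fix x :: real
      show "ennreal (1 / (1 - x)) * indicator {0..r} x *
          ennreal (cmod (deriv f (of_real x * \<zeta>)) powr p * (1 - x) powr (\<alpha> + 2) / \<psi> (1 - x)) \<le>
        ennreal (1 / (1 - x)) * indicator {0..r} x *
          (\<integral>\<^sup>+u. \<Phi> u * indicator (ball (of_real x * \<zeta>) ((1 - x) / 2)) u \<partial>disk_area)"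
      proof (cases "x \<in> {0..r}")
        case True
        define w where "w = of_real x * \<zeta>"
        have w: "cmod w = x" "w \<in> unit_disk" using True f by (auto simp: w_def norm_mult)
        have Bm: "ball w ((1 - x) / 2) \<in> sets disk_area"
          using half_ball_subset[OF w(2)] w(1) by (intro in_sets_disk_area) auto
        have "ennreal (weighted_deriv \<alpha> p f w) \<le>
          ennreal C0 * local_energy \<alpha> p f (half_ball w)"
          using C0(2) f(1) w(2) by blast
        also have "\<dots> = (\<integral>\<^sup>+u. \<Phi> u * indicator (ball w ((1 - x) / 2)) u \<partial>disk_area)"
          unfolding \<Phi>_def w(1) mult.assoc
          by (rule nn_integral_cmult[symmetric]) (intro borel_measurable_times_ennreal borel_measurable_indicator Bm, measurable)
        finally show ?thesis unfolding w(1) by (intro mult_left_mono) (auto simp: w_def)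
      qed simp
    qed
    also have "\<dots> \<le> 2 * (\<integral>\<^sup>+u. \<Phi> u * indicator (radial_cone (of_real r * \<zeta>)) u \<partial>disk_area)"
      by (rule radial_integral_half_balls_le[OF \<Phi> f(2-4)])
    also have "(\<integral>\<^sup>+u. \<Phi> u * indicator (radial_cone (of_real r * \<zeta>)) u \<partial>disk_area) =
      ennreal C0 * local_energy \<alpha> p f (radial_cone (of_real r * \<zeta>))"
      unfolding \<Phi>_def mult.assoc
      by (rule nn_integral_cmult) (intro borel_measurable_times_ennreal borel_measurable_indicator radial_cone_measurable, measurable)
    finally show "(\<integral>\<^sup>+x. ennreal (1 / (1 - x)) * indicator {0..r} x *
        ennreal (cmod (deriv f (of_real x * \<zeta>)) powr p * (1 - x) powr (\<alpha> + 2) / \<psi> (1 - x)) \<partial>lborel) \<le>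
      ennreal (2 * C0) * local_energy \<alpha> p f (radial_cone (of_real r * \<zeta>))"
      using C0(1) by (simp add: ennreal_mult' mult.assoc)
  qed
qed

end

lemma ennreal_linear_combination:
  fixes a b c k l :: real
  assumes "a \<ge> 0" "b \<ge> 0" "c \<ge> 0" "k \<ge> 0" "l \<ge> 0"
  shows "ennreal (a + (k * b + l * c)) = ennreal a + (ennreal k * ennreal b + ennreal l * ennreal c)"
  using assms by (simp add: ennreal_mult)

text \<open>Either h \<le> \<theta>, or the nonpositive exponent gives h powr (1 - p) \<le> \<theta>
  powr (1 - p).\<close>

lemma le_add_powr_mult:
  fixes h \<theta> p :: real
  assumes "p \<ge> 1" "\<theta> > 0" "h \<ge> 0"
  shows "h \<le> \<theta> + h powr p * \<theta> powr (1 - p)"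
proof (cases "h \<le> \<theta>")
  case False
  have "h = h powr p * h powr (1 - p)" using False assms by (simp flip: powr_add)
  also have "\<dots> \<le> h powr p * \<theta> powr (1 - p)" using False assms by (intro mult_left_mono powr_mono2') auto
  finally show ?thesis using assms by linarith
qed (use assms in \<open>auto intro: add_increasing2\<close>)

text \<open>The test function \<open>\<theta>\<close> in \<open>h \<le> \<theta> + h\<^sup>p \<theta>\<^sup>1\<^sup>-\<^sup>p\<close> balances the unweighted energy along the radius
  against the one weighted by the power \<open>\<kappa>\<close> of the logarithm \<open>L\<close>.\<close>

lemma carleson_pointwise_log:
  fixes p q :: real
  assumes pq: "1 < p" "p < q"
  shows "carleson_pointwise (p - 2) p q (\<lambda>t. (2 - ln t) powr ((1 / p - 1) * q))"
proof -
  define \<kappa> where "\<kappa> = (1 - 1 / p) * q"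
  have \<kappa>: "\<kappa> > 0" "(1 / p - 1) * q = - \<kappa>" using pq by (auto simp: \<kappa>_def field_simps)
  define \<psi> where "\<psi> = (\<lambda>t::real. (2 - ln t) powr (- \<kappa>))"
  interpret one: admissible_weight "\<lambda>_. 1" 1 by (rule admissible_weight_1)
  interpret admissible_weight \<psi> "2 powr \<bar>- \<kappa>\<bar>" unfolding \<psi>_def by (rule admissible_weight_log)
  have p0: "p > 0" using pq by simp
  obtain C1 where C1: "C1 > 0" "\<forall>f \<zeta> r. f \<in> disk_analytic \<and> cmod \<zeta> = 1 \<and> 0 \<le> r \<and> r < 1 \<longrightarrow>
    (\<integral>\<^sup>+x. ennreal (1 / (1 - x)) * indicator {0..r} x *
      ennreal (cmod (deriv f (of_real x * \<zeta>)) powr p * (1 - x) powr (p - 2 + 2) / 1) \<partial>lborel) \<le>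
    ennreal C1 * one.local_energy (p - 2) p f (radial_cone (of_real r * \<zeta>))"
    using one.radial_weighted_integral_le[OF p0, of "p - 2"] by (elim exE conjE)
  obtain C2 where C2: "C2 > 0" "\<forall>f \<zeta> r. f \<in> disk_analytic \<and> cmod \<zeta> = 1 \<and> 0 \<le> r \<and> r < 1 \<longrightarrow>
    (\<integral>\<^sup>+x. ennreal (1 / (1 - x)) * indicator {0..r} x *
      ennreal (cmod (deriv f (of_real x * \<zeta>)) powr p * (1 - x) powr (p - 2 + 2) / \<psi> (1 - x)) \<partial>lborel) \<le>
    ennreal C2 * local_energy (p - 2) p f (radial_cone (of_real r * \<zeta>))"
    using radial_weighted_integral_le[OF p0, of "p - 2"] by (elim exE conjE)
  define e where "e = q / p - 1"
  have e: "e > 0" using pq by (simp add: e_def)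
  define M where "M = 1 / e + 2 powr \<kappa> * C1 + 2 powr \<kappa> * C2"
  have M: "M > 0" using e C1 C2 by (simp add: M_def add_pos_pos)
  have "carleson_pointwise (p - 2) p q \<psi>"
  proof (rule carleson_pointwiseI[OF p0, where C = "M powr q"])
    show "M powr q > 0" using M by simp
    fix f r \<zeta> B
    assume f: "f \<in> disk_analytic" "dirichlet_energy (p - 2) p f \<le> 1" and r: "0 \<le> r" "r < 1" and \<zeta>: "cmod \<zeta> = 1" and B: "(B::real) > 0"
      and I: "local_energy (p - 2) p f (radial_cone (of_real r * \<zeta>)) = ennreal B"
    \<comment> \<open>\<open>T\<close> is the value of the logarithm at which the weight
      \<open>L x powr \<kappa>\<close> reaches \<open>B\<close>; there the two energies
      balance.\<close>
    define T where "T = B powr (1 / \<kappa>)"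
    have T: "T > 0" "T powr \<kappa> = B" using B \<kappa> by (auto simp: T_def powr_powr)
    \<comment> \<open>\<open>N\<close> is the size of the final bound, since N powr q = T powr
      \<kappa> = B.\<close>
    define N where "N = T powr (1 - 1 / p)"
    have N: "N > 0" using T by (simp add: N_def)
    define L where "L = (\<lambda>x::real. 2 - ln (1 - x))"
    have L: "L x \<ge> 2" if "0 \<le> x" "x \<le> r" for x
    proof -
      have "ln (1 - x) \<le> 0" using that r by simp
      thus ?thesis by (simp add: L_def)
    qed
    \<comment> \<open>Two demands fix \<theta>. Its power 1 - p equals N (1 + L / T) powr \<kappa>,
      hence is at most a multiple of N (1 + L powr \<kappa> / B), which pairs with the two energies.
      And \<theta> / (1 - x) has an elementary primitive, bounded because
      \<open>e = q / p - 1\<close> is positive.\<close>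
    define \<theta> where "\<theta> = (\<lambda>x. T powr (- 1 / p) * (1 + L x / T) powr (- q / p))"
    \<comment> \<open>Clamping x to the range from 0 to r makes \<open>y\<close> continuous on the
      whole line, hence Borel measurable.\<close>
    define y where "y = (\<lambda>x. cmod (deriv f (of_real (max 0 (min x r)) * \<zeta>)))"
    have y: "y x = cmod (deriv f (of_real x * \<zeta>))" if "0 \<le> x" "x \<le> r" for x using that by (simp add: y_def)
    have "continuous_on UNIV (\<lambda>x. deriv f (of_real (max 0 (min x r)) * \<zeta>))"
      by (rule continuous_on_compose2[OF radial_deriv_continuous[OF f(1) \<zeta> r(2)]])
        (use r in \<open>auto intro!: continuous_intros\<close>)
    hence [measurable]: "y \<in> borel_measurable borel"
      unfolding y_def by (intro borel_measurable_continuous_onI continuous_on_norm)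
    have [measurable]: "L \<in> borel_measurable borel" unfolding L_def by measurable
    have [measurable]: "\<theta> \<in> borel_measurable borel" unfolding \<theta>_def by measurable
    define b where "b = (\<lambda>x. ennreal (1 / (1 - x)) * indicator {0..r} x * ennreal (y x powr p * (1 - x) powr (p - 2 + 2) / 1))"
    define c where "c = (\<lambda>x. ennreal (1 / (1 - x)) * indicator {0..r} x * ennreal (y x powr p * (1 - x) powr (p - 2 + 2) / \<psi> (1 - x)))"
    have [measurable]: "b \<in> borel_measurable borel" "c \<in> borel_measurable borel" unfolding b_def c_def by measurable
    define k where "k = N * 2 powr \<kappa>"
    have k: "k > 0" using N by (simp add: k_def)
    have pw: "ennreal (y x) * indicator {0..r} x \<le>
        ennreal (\<theta> x / (1 - x)) * indicator {0..r} x + (ennreal k * b x + ennreal (k / B) * c x)" for x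
    proof (cases "x \<in> {0..r}")
      case True
      hence x: "0 \<le> x" "x \<le> r" "x < 1" using r by auto
      define h where "h = y x * (1 - x)"
      define d where "d = 1 - x"
      have d: "d > 0" using x by (simp add: d_def)
      have h: "h \<ge> 0" using x by (simp add: h_def y_def)
      have "1 + L x / T > 0" using T L[OF x(1,2)] by (simp add: add_pos_nonneg)
      hence th: "\<theta> x > 0" using T by (simp add: \<theta>_def)
      have th_p: "\<theta> x powr (1 - p) \<le> k * (1 + L x powr \<kappa> / B)"
      proof -
        have ex: "- 1 / p * (1 - p) = 1 - 1 / p" "- q / p * (1 - p) = \<kappa>"
          using p0 by (auto simp: \<kappa>_def field_simps)
        have "\<theta> x powr (1 - p) = (T powr (- 1 / p)) powr (1 - p) * ((1 + L x / T) powr (- q / p)) powr (1 - p)"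
          unfolding \<theta>_def by (rule powr_mult)
        hence "\<theta> x powr (1 - p) = N * (1 + L x / T) powr \<kappa>" unfolding powr_powr ex N_def .
        also have "\<dots> \<le> N * (2 powr \<kappa> * (1 powr \<kappa> + (L x / T) powr \<kappa>))"
          using T N L[OF x(1,2)] \<kappa> by (intro mult_left_mono powr_add_le) auto
        also have "\<dots> = k * (1 + L x powr \<kappa> / B)"
          using T L[OF x(1,2)] by (simp add: k_def powr_divide)
        finally show ?thesis .
      qed
      have "h \<le> \<theta> x + h powr p * \<theta> x powr (1 - p)" using th h pq by (intro le_add_powr_mult) auto
      also have "\<dots> \<le> \<theta> x + h powr p * (k * (1 + L x powr \<kappa> / B))" using th_p by (intro add_left_mono mult_left_mono) auto
      finally have "h / d \<le> (\<theta> x + h powr p * (k * (1 + L x powr \<kappa> / B))) / d" using d by (intro divide_right_mono) auto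
      also have "\<dots> = \<theta> x / d + (k * (1 / d * h powr p) + k / B * (1 / d * (h powr p * L x powr \<kappa>)))"
        using d B by (simp add: field_simps)
      also have "h / d = y x" using d by (simp add: h_def d_def)
      also have "h powr p = y x powr p * d powr p" using d by (simp add: h_def d_def powr_mult y_def)
      finally have main: "y x \<le> \<theta> x / d + (k * (1 / d * (y x powr p * d powr p)) + k / B * (1 / d * (y x powr p * d powr p * L x powr \<kappa>)))" .
      have "\<psi> d = 1 / L x powr \<kappa>" using powr_minus_divide by (simp add: \<psi>_def L_def d_def)
      hence "c x = ennreal (1 / d) * ennreal (y x powr p * d powr p * L x powr \<kappa>)"
        using True by (simp add: c_def d_def)
      hence cx: "c x = ennreal (1 / d * (y x powr p * d powr p * L x powr \<kappa>))"
        using d by (subst ennreal_mult') auto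
      have "b x = ennreal (1 / d) * ennreal (y x powr p * d powr p)"
        using True by (simp add: b_def d_def)
      hence bx: "b x = ennreal (1 / d * (y x powr p * d powr p))"
        using d by (subst ennreal_mult') auto
      have "ennreal (y x) \<le> ennreal (\<theta> x / d + (k * (1 / d * (y x powr p * d powr p)) + k / B * (1 / d * (y x powr p * d powr p * L x powr \<kappa>))))"
        by (rule ennreal_leI[OF main])
      also have "\<dots> = ennreal (\<theta> x / d) + (ennreal k * b x + ennreal (k / B) * c x)"
        unfolding bx cx by (rule ennreal_linear_combination) (use th d k B in auto)
      finally show ?thesis using True by (simp add: d_def)
    qed (simp add: b_def c_def)
    \<comment> \<open>A primitive of \<theta> / (1 - x), since L has derivative 1 / (1 - x) and - e
      - 1 = - q / p.\<close>
    define \<Psi> where "\<Psi> = (\<lambda>x. - (N / e * (1 + L x / T) powr (- e)))"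
    have Itheta: "(\<integral>\<^sup>+x. ennreal (\<theta> x / (1 - x)) * indicator {0..r} x \<partial>lborel) = \<Psi> r - \<Psi> 0"
    proof (rule nn_integral_FTC_Icc)
      show "(\<lambda>x. \<theta> x / (1 - x)) \<in> borel_measurable borel" by measurable
      fix x assume "x \<in> {0..r}"
      hence x: "0 \<le> x" "x \<le> r" "x < 1" using r by auto
      have Lx: "1 + L x / T > 0" using T L[OF x(1,2)] by (simp add: add_pos_nonneg)
      show "0 \<le> \<theta> x / (1 - x)" using x by (simp add: \<theta>_def)
      have "(L has_real_derivative 1 / (1 - x)) (at x)"
        unfolding L_def using x by (auto intro!: derivative_eq_intros)
      hence D: "((\<lambda>x. 1 + L x / T) has_real_derivative 1 / (1 - x) / T) (at x)"
        using T by (auto intro!: derivative_eq_intros)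
      have "((\<lambda>x. (1 + L x / T) powr (- e)) has_real_derivative - e * (1 + L x / T) powr (- e - 1) * (1 / (1 - x) / T)) (at x)"
        using DERIV_fun_powr[where g = "\<lambda>x. 1 + L x / T" and r = "- e", OF D Lx] by simp
      hence "(\<Psi> has_real_derivative - (N / e * (- e * (1 + L x / T) powr (- e - 1) * (1 / (1 - x) / T)))) (at x)"
        unfolding \<Psi>_def by (intro DERIV_minus DERIV_cmult)
      moreover have "- (N / e * (- e * (1 + L x / T) powr (- e - 1) * (1 / (1 - x) / T))) =
          N / T * (1 + L x / T) powr (- e - 1) / (1 - x)" using e by simp
      moreover have "- e - 1 = - q / p" by (simp add: e_def)
      moreover have "N / T = T powr (- 1 / p)" using T by (simp add: N_def powr_diff powr_minus_divide)
      ultimately show "(\<Psi> has_real_derivative \<theta> x / (1 - x)) (at x)"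
        unfolding \<theta>_def by simp
    qed (use r in auto)
    have "1 + L 0 / T \<ge> 1" using T by (simp add: L_def)
    hence "(1 + L 0 / T) powr (- e) \<le> 1" using powr_mono2'[of "- e" 1 "1 + L 0 / T"] e by simp
    hence "N / e * (1 + L 0 / T) powr (- e) \<le> N / e * 1" using N e by (intro mult_left_mono) auto
    moreover have "\<Psi> r \<le> 0" using N e by (simp add: \<Psi>_def)
    ultimately have Psi: "\<Psi> r - \<Psi> 0 \<le> N / e" by (simp add: \<Psi>_def)
    have cone_le: "one.local_energy (p - 2) p f (radial_cone (of_real r * \<zeta>)) \<le> 1"
      using f(2) unfolding dirichlet_energy_def one.weighted_density_def
      by (elim order_trans[rotated]) (intro nn_integral_mono, auto simp: indicator_def)
    have "integral\<^sup>N lborel b = (\<integral>\<^sup>+x. ennreal (1 / (1 - x)) * indicator {0..r} x *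
      ennreal (cmod (deriv f (of_real x * \<zeta>)) powr p * (1 - x) powr (p - 2 + 2) / 1) \<partial>lborel)"
      unfolding b_def by (intro nn_integral_cong) (auto simp: indicator_def y)
    also have "\<dots> \<le> ennreal C1 * one.local_energy (p - 2) p f (radial_cone (of_real r * \<zeta>))"
      using C1(2) f(1) \<zeta> r by blast
    also have "\<dots> \<le> ennreal C1 * 1" by (intro mult_left_mono cone_le) auto
    finally have Ib: "integral\<^sup>N lborel b \<le> ennreal C1" by simp
    have "integral\<^sup>N lborel c = (\<integral>\<^sup>+x. ennreal (1 / (1 - x)) * indicator {0..r} x *
      ennreal (cmod (deriv f (of_real x * \<zeta>)) powr p * (1 - x) powr (p - 2 + 2) / \<psi> (1 - x)) \<partial>lborel)"
      unfolding c_def by (intro nn_integral_cong) (auto simp: indicator_def y)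
    also have "\<dots> \<le> ennreal C2 * ennreal B" unfolding I[symmetric] using C2(2) f(1) \<zeta> r by blast
    finally have Ic: "integral\<^sup>N lborel c \<le> ennreal (C2 * B)" using C2 by (simp add: ennreal_mult')
    have "ennreal (cmod (f (of_real r * \<zeta>) - f 0)) \<le> (\<integral>\<^sup>+x. ennreal (cmod (deriv f (of_real x * \<zeta>))) * indicator {0..r} x \<partial>lborel)"
      by (rule radial_growth_nn_integral[OF f(1) \<zeta> r])
    also have "\<dots> = (\<integral>\<^sup>+x. ennreal (y x) * indicator {0..r} x \<partial>lborel)"
      by (intro nn_integral_cong) (auto simp: indicator_def y)
    also have "\<dots> \<le> (\<integral>\<^sup>+x. ennreal (\<theta> x / (1 - x)) * indicator {0..r} x + (ennreal k * b x + ennreal (k / B) * c x) \<partial>lborel)"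
      by (intro nn_integral_mono pw)
    also have "\<dots> = ennreal (\<Psi> r - \<Psi> 0) + (ennreal k * integral\<^sup>N lborel b + ennreal (k / B) * integral\<^sup>N lborel c)"
      by (simp add: nn_integral_add nn_integral_cmult Itheta)
    also have "\<dots> \<le> ennreal (N / e) + (ennreal k * ennreal C1 + ennreal (k / B) * ennreal (C2 * B))"
      by (intro add_mono mult_left_mono Ib Ic ennreal_leI Psi) auto
    also have "\<dots> = ennreal (N * M)"
      using N e k C1 C2 B
      by (simp add: M_def k_def algebra_simps flip: ennreal_mult ennreal_plus)
    finally have "cmod (f (of_real r * \<zeta>) - f 0) \<le> N * M" using N M by simp
    hence "cmod (f (of_real r * \<zeta>) - f 0) powr q \<le> (N * M) powr q" using pq by (intro powr_mono2) auto
    also have "\<dots> = M powr q * B"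
      using N M T(1) by (simp add: powr_mult N_def powr_powr flip: T(2) \<kappa>_def)
    finally show "cmod (f (of_real r * \<zeta>) - f 0) powr q \<le> M powr q * B" .
  qed
  thus ?thesis by (simp add: \<psi>_def \<kappa>(2))
qed

text \<open>Integrating the pointwise estimate in \<open>\<nu>\<close> and applying Tonelli leaves,
  for each u, the mass of the points z whose cone contains u; its bound cancels \<psi> and leaves
  the energy density. The constant is chosen before \<open>\<nu>\<close>, as the lemma is applied to
  restrictions of \<mu> to varying annuli.\<close>

lemma carleson_embedding:
  assumes "carleson_pointwise \<alpha> p q \<psi>"
    and pos: "\<forall>t. 0 < t \<and> t \<le> 1 \<longrightarrow> \<psi> t > 0" and [measurable]: "\<psi> \<in> borel_measurable borel"
  shows "\<exists>C>0. \<forall>\<nu> \<epsilon> f. sets \<nu> = sets disk_area \<and> finite_measure \<nu> \<and> \<epsilon> \<ge> 0 \<and> f \<in> disk_analytic \<and> dirichlet_energy \<alpha> p f \<le> 1 \<and>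
      (\<forall>u\<in>unit_disk. emeasure \<nu> {z \<in> unit_disk. u \<in> radial_cone z} \<le> ennreal (\<epsilon> * \<psi> (1 - cmod u))) \<longrightarrow>
    (\<integral>\<^sup>+z. ennreal (cmod (f z - f 0) powr q) \<partial>\<nu>) \<le> ennreal (C * \<epsilon>)"
proof -
  obtain C where C: "C > 0" "\<forall>f z. f \<in> disk_analytic \<and> dirichlet_energy \<alpha> p f \<le> 1 \<and> z \<in> unit_disk \<longrightarrow>
    ennreal (cmod (f z - f 0) powr q) \<le> ennreal C *
      (\<integral>\<^sup>+u. ennreal (dirichlet_density \<alpha> p f u / \<psi> (1 - cmod u)) * indicator (radial_cone z) u \<partial>disk_area)"
    using assms(1) unfolding carleson_pointwise_def by (elim exE conjE)
  show ?thesis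
  proof (intro exI[of _ C] conjI allI impI C(1))
    fix \<nu> :: "complex measure" and \<epsilon> f
    assume "sets \<nu> = sets disk_area \<and> finite_measure \<nu> \<and> \<epsilon> \<ge> 0 \<and> f \<in> disk_analytic \<and> dirichlet_energy \<alpha> p f \<le> 1 \<and>
      (\<forall>u\<in>unit_disk. emeasure \<nu> {z \<in> unit_disk. u \<in> radial_cone z} \<le> ennreal (\<epsilon> * \<psi> (1 - cmod u)))"
    hence \<nu>: "sets \<nu> = sets disk_area" "finite_measure \<nu>" and \<epsilon>: "\<epsilon> \<ge> 0" and f: "f \<in> disk_analytic" "dirichlet_energy \<alpha> p f \<le> 1"
      and small: "\<And>u. u \<in> unit_disk \<Longrightarrow> emeasure \<nu> {z \<in> unit_disk. u \<in> radial_cone z} \<le> ennreal (\<epsilon> * \<psi> (1 - cmod u))"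
      by auto
    note [measurable_cong] = \<nu>(1)
    have sp: "space \<nu> = unit_disk" using sets_eq_imp_space_eq[OF \<nu>(1)] by simp
    interpret \<nu>: finite_measure \<nu> by (rule \<nu>(2))
    interpret ps: pair_sigma_finite \<nu> disk_area ..
    note [measurable] = borel_measurable_dirichlet_density[OF f(1)]
    define \<Phi> where "\<Phi> = (\<lambda>u. ennreal (dirichlet_density \<alpha> p f u / \<psi> (1 - cmod u)))"
    have [measurable]: "\<Phi> \<in> borel_measurable disk_area" unfolding \<Phi>_def by measurable
    define E where "E = {zu :: complex \<times> complex. cmod (fst zu - snd zu) < 3 * (1 - cmod (snd zu))}"
    have [measurable]: "Measurable.pred (\<nu> \<Otimes>\<^sub>M disk_area) (\<lambda>zu. zu \<in> E)"
      unfolding E_def mem_Collect_eq by measurable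
    have E: "u \<in> radial_cone z \<longleftrightarrow> (z, u) \<in> E" if "u \<in> unit_disk" for z u using that by (simp add: E_def radial_cone_def)
    have "(\<integral>\<^sup>+z. ennreal (cmod (f z - f 0) powr q) \<partial>\<nu>) \<le>
      (\<integral>\<^sup>+z. ennreal C * (\<integral>\<^sup>+u. \<Phi> u * indicator E (z, u) \<partial>disk_area) \<partial>\<nu>)"
    proof (rule nn_integral_mono)
      fix z assume "z \<in> space \<nu>"
      hence "ennreal (cmod (f z - f 0) powr q) \<le> ennreal C * (\<integral>\<^sup>+u. \<Phi> u * indicator (radial_cone z) u \<partial>disk_area)"
        using C(2) f unfolding \<Phi>_def sp by blast
      also have "(\<integral>\<^sup>+u. \<Phi> u * indicator (radial_cone z) u \<partial>disk_area) = (\<integral>\<^sup>+u. \<Phi> u * indicator E (z, u) \<partial>disk_area)"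
        by (intro nn_integral_cong) (auto simp: indicator_def E)
      finally show "ennreal (cmod (f z - f 0) powr q) \<le> ennreal C * (\<integral>\<^sup>+u. \<Phi> u * indicator E (z, u) \<partial>disk_area)" .
    qed
    also have "\<dots> = ennreal C * (\<integral>\<^sup>+z. (\<integral>\<^sup>+u. \<Phi> u * indicator E (z, u) \<partial>disk_area) \<partial>\<nu>)"
      by (intro nn_integral_cmult) measurable
    also have "(\<integral>\<^sup>+z. (\<integral>\<^sup>+u. \<Phi> u * indicator E (z, u) \<partial>disk_area) \<partial>\<nu>) = (\<integral>\<^sup>+u. (\<integral>\<^sup>+z. \<Phi> u * indicator E (z, u) \<partial>\<nu>) \<partial>disk_area)"
      by (rule ps.Fubini'[symmetric]) measurable
    also have "\<dots> \<le> (\<integral>\<^sup>+u. ennreal \<epsilon> * ennreal (dirichlet_density \<alpha> p f u) \<partial>disk_area)"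
    proof (rule nn_integral_mono)
      fix u assume "u \<in> space disk_area"
      hence u: "u \<in> unit_disk" by simp
      hence \<psi>: "\<psi> (1 - cmod u) > 0" by (intro pos[rule_format]) auto
      have "{z \<in> unit_disk. u \<in> radial_cone z} = {z \<in> space \<nu>. (z, u) \<in> E}" using E[OF u] sp by auto
      moreover have "{z \<in> space \<nu>. (z, u) \<in> E} \<in> sets \<nu>" by measurable (use u in auto)
      ultimately have "(\<integral>\<^sup>+z. \<Phi> u * indicator E (z, u) \<partial>\<nu>) = \<Phi> u * emeasure \<nu> {z \<in> unit_disk. u \<in> radial_cone z}"
        by (subst nn_integral_cmult_indicator[symmetric]) (auto intro!: nn_integral_cong simp: indicator_def)
      also have "\<dots> \<le> \<Phi> u * ennreal (\<epsilon> * \<psi> (1 - cmod u))" by (intro mult_left_mono small u) auto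
      also have "\<dots> = ennreal \<epsilon> * ennreal (dirichlet_density \<alpha> p f u)"
        using \<psi> \<epsilon> dirichlet_density_nonneg[of \<alpha> p f u] by (simp add: \<Phi>_def flip: ennreal_mult)
      finally show "(\<integral>\<^sup>+z. \<Phi> u * indicator E (z, u) \<partial>\<nu>) \<le> ennreal \<epsilon> * ennreal (dirichlet_density \<alpha> p f u)" .
    qed
    also have "\<dots> = ennreal \<epsilon> * dirichlet_energy \<alpha> p f"
      unfolding dirichlet_energy_def by (intro nn_integral_cmult) measurable
    also have "\<dots> \<le> ennreal \<epsilon> * 1" by (intro mult_left_mono f) auto
    finally show "(\<integral>\<^sup>+z. ennreal (cmod (f z - f 0) powr q) \<partial>\<nu>) \<le> ennreal (C * \<epsilon>)"
      using C \<epsilon> by (simp add: ennreal_mult mult_left_mono)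
  qed
qed

section \<open>Compactness of the Volterra operator\<close>

lemma dirichlet_quasi_metric_topology:
  assumes "p > 0"
  shows "quasi_metric_topology (dirichlet_topology \<alpha> p) (dirichlet_space \<alpha> p)
    (\<lambda>f h. dirichlet_norm \<alpha> p (\<lambda>z. f z - h z)) (2 * 2 powr (1 / p))"
proof
  show "dirichlet_norm \<alpha> p (\<lambda>z. f z - f z) = 0" for f
    by (simp add: dirichlet_norm_def dirichlet_density_def)
  show "dirichlet_norm \<alpha> p (\<lambda>z. f z - h z) = dirichlet_norm \<alpha> p (\<lambda>z. h z - f z)"
    if "f \<in> dirichlet_space \<alpha> p" "h \<in> dirichlet_space \<alpha> p" for f h
    using that by (intro dirichlet_norm_diff_commute) (auto simp: dirichlet_space_iff)
  show "dirichlet_norm \<alpha> p (\<lambda>z. f z - k z) \<le> (2 * 2 powr (1 / p)) *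
      (dirichlet_norm \<alpha> p (\<lambda>z. f z - h z) + dirichlet_norm \<alpha> p (\<lambda>z. h z - k z))"
    if "f \<in> dirichlet_space \<alpha> p" "h \<in> dirichlet_space \<alpha> p" "k \<in> dirichlet_space \<alpha> p" for f h k
    by (rule dirichlet_norm_quasi_triangle[OF that assms])
qed (simp_all add: openin_dirichlet_topology)

section \<open>Scaling, Fatou and Montel in Dirichlet spaces\<close>

lemma zero_in_dirichlet_space: "(\<lambda>_. 0) \<in> dirichlet_space \<alpha> p"
  by (simp add: dirichlet_space_iff disk_analytic_def dirichlet_energy_def dirichlet_density_def)

lemma disk_analytic_cmult: "f \<in> disk_analytic \<Longrightarrow> (\<lambda>z. c * f z) \<in> disk_analytic"
  by (auto simp: disk_analytic_def intro: holomorphic_intros)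

lemma dirichlet_energy_cmult:
  assumes "f \<in> disk_analytic"
  shows "dirichlet_energy \<alpha> p (\<lambda>z. c * f z) = ennreal (cmod c powr p) * dirichlet_energy \<alpha> p f"
proof -
  note [measurable] = borel_measurable_dirichlet_density[OF assms]
  have "deriv (\<lambda>z. c * f z) z = c * deriv f z" if "z \<in> unit_disk" for z
    by (intro DERIV_imp_deriv DERIV_cmult disk_analytic_deriv assms that)
  moreover have m: "(\<lambda>z. ennreal (dirichlet_density \<alpha> p f z)) \<in> borel_measurable disk_area" by measurable
  ultimately show ?thesis unfolding dirichlet_energy_def nn_integral_cmult[OF m, symmetric]
    by (auto intro!: nn_integral_cong simp: dirichlet_density_def norm_mult powr_mult mult_ac simp flip: ennreal_mult)
qed

text \<open>Fatou's lemma. Only moduli of derivatives are compared because in one application the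
  derivatives converge to the negative of \<open>deriv h\<close>.\<close>

lemma dirichlet_energy_le_liminf:
  assumes "\<And>n. f n \<in> disk_analytic"
    and "\<And>z. z \<in> unit_disk \<Longrightarrow> (\<lambda>n. cmod (deriv (f n) z)) \<longlonglongrightarrow> cmod (deriv h z)" and p: "p > 0"
  shows "dirichlet_energy \<alpha> p h \<le> liminf (\<lambda>n. dirichlet_energy \<alpha> p (f n))"
proof -
  have "dirichlet_energy \<alpha> p h = (\<integral>\<^sup>+z. liminf (\<lambda>n. ennreal (dirichlet_density \<alpha> p (f n) z)) \<partial>disk_area)"
    unfolding dirichlet_energy_def
  proof (intro nn_integral_cong)
    fix z assume "z \<in> space disk_area"
    hence "(\<lambda>n. cmod (deriv (f n) z) powr p) \<longlonglongrightarrow> cmod (deriv h z) powr p"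
      using p assms(2)[of z] by (intro tendsto_powr') auto
    hence "(\<lambda>n. ennreal (dirichlet_density \<alpha> p (f n) z)) \<longlonglongrightarrow> ennreal (dirichlet_density \<alpha> p h z)"
      unfolding dirichlet_density_def by (intro tendsto_ennrealI tendsto_mult tendsto_const)
    thus "ennreal (dirichlet_density \<alpha> p h z) = liminf (\<lambda>n. ennreal (dirichlet_density \<alpha> p (f n) z))"
      by (intro lim_imp_Liminf[symmetric]) auto
  qed
  also have "\<dots> \<le> liminf (\<lambda>n. dirichlet_energy \<alpha> p (f n))"
    unfolding dirichlet_energy_def using borel_measurable_dirichlet_density[OF assms(1)]
    by (intro nn_integral_liminf) auto
  finally show ?thesis .
qed

text \<open>Division by M reduces to unit energy, where the growth bound controls the derivative on
  a disk around \<open>K\<close>; the control at 0 fixes the additive constant. This is the local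
  boundedness needed for Montel's theorem.\<close>

lemma disk_analytic_bounded_on_compact:
  fixes \<alpha> p M :: real
  assumes p: "p > 0" and \<alpha>: "\<alpha> > -2" and M: "M > 0" and K: "compact K" "K \<subseteq> unit_disk"
  shows "\<exists>B. \<forall>f z. f \<in> disk_analytic \<and> cmod (f 0) \<le> M \<and> dirichlet_energy \<alpha> p f \<le> ennreal (M powr p) \<and> z \<in> K \<longrightarrow> cmod (f z) \<le> B"
proof -
  obtain \<rho> where \<rho>: "0 < \<rho>" "\<rho> < 1" "K \<subseteq> cball 0 \<rho>"
  proof (cases "K = {}")
    case True
    show ?thesis by (rule that[of "1 / 2"]) (use True in auto)
  next
    case False
    then obtain x where x: "x \<in> K" "\<And>y. y \<in> K \<Longrightarrow> cmod y \<le> cmod x"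
      using continuous_attains_sup[OF K(1), of cmod] continuous_on_norm_id by blast
    hence "cmod x < 1" using K by auto
    show ?thesis
      by (rule that[of "(1 + cmod x) / 2"]) (use x \<open>cmod x < 1\<close> in \<open>force simp: add_pos_nonneg\<close>)+
  qed
  obtain A where A: "A > 0" "growth_bound \<alpha> p A"
    using deriv_growth[OF p, of \<alpha>] by (elim exE conjE)
  define D where "D = M * (A * (1 - \<rho>) powr (- (\<alpha> + 2) / p))"
  show ?thesis
  proof (intro exI[of _ "M + D"] allI impI)
    fix f z assume "f \<in> disk_analytic \<and> cmod (f 0) \<le> M \<and> dirichlet_energy \<alpha> p f \<le> ennreal (M powr p) \<and> z \<in> K"
    hence f: "f \<in> disk_analytic" "cmod (f 0) \<le> M" "dirichlet_energy \<alpha> p f \<le> ennreal (M powr p)" "z \<in> K" by auto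
    have sub: "cball 0 \<rho> \<subseteq> unit_disk" using \<rho> by auto
    have "dirichlet_energy \<alpha> p (\<lambda>z. of_real (1 / M) * f z) \<le> ennreal ((1 / M) powr p) * ennreal (M powr p)"
      unfolding dirichlet_energy_cmult[OF f(1)] using M by (intro mult_mono f(3)) (auto simp: norm_divide)
    also have "\<dots> = 1" using M p by (simp add: powr_divide flip: ennreal_mult)
    finally have en: "dirichlet_energy \<alpha> p (\<lambda>z. of_real (1 / M) * f z) \<le> 1" .
    have db: "cmod (deriv f w) \<le> D" if w: "w \<in> cball 0 \<rho>" for w
    proof -
      have wd: "w \<in> unit_disk" using w sub by blast
      have "deriv (\<lambda>z. of_real (1 / M) * f z) w = of_real (1 / M) * deriv f w"
        by (intro DERIV_imp_deriv DERIV_cmult disk_analytic_deriv f wd)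
      moreover have "cmod (deriv (\<lambda>z. of_real (1 / M) * f z) w) \<le> A * (1 - cmod w) powr (- (\<alpha> + 2) / p)"
        using A(2) en disk_analytic_cmult[OF f(1)] wd by blast
      moreover have "cmod (of_real (1 / M) * deriv f w) = cmod (deriv f w) / M"
        using M by (simp add: norm_mult norm_divide)
      ultimately have "cmod (deriv f w) / M \<le> A * (1 - cmod w) powr (- (\<alpha> + 2) / p)" by simp
      also have "\<dots> \<le> A * (1 - \<rho>) powr (- (\<alpha> + 2) / p)"
        using A w \<rho> \<alpha> p by (intro mult_left_mono powr_mono2') (auto simp: divide_le_0_iff)
      finally show ?thesis using M by (simp add: D_def field_simps)
    qed
    have "cmod (f z - f 0) \<le> D * cmod (z - 0)"
      using sub f \<rho> db disk_analytic_deriv[OF f(1)]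
      by (intro field_differentiable_bound[of "cball 0 \<rho>" f "deriv f"]) (auto intro: has_field_derivative_at_within)
    also have "\<dots> \<le> D * 1"
    proof (rule mult_left_mono)
      show "cmod (z - 0) \<le> 1" using f(4) K(2) by auto
      show "D \<ge> 0" using A M by (simp add: D_def)
    qed
    finally show "cmod (f z) \<le> M + D" using norm_triangle_ineq[of "f z - f 0" "f 0"] f(2) by simp
  qed
qed

lemma dirichlet_montel:
  fixes \<alpha> p M :: real and f :: "nat \<Rightarrow> complex \<Rightarrow> complex"
  assumes p: "p > 0" and \<alpha>: "\<alpha> > -2" and M: "M > 0"
    and f: "\<And>n. f n \<in> disk_analytic" "\<And>n. cmod (f n 0) \<le> M" "\<And>n. dirichlet_energy \<alpha> p (f n) \<le> ennreal (M powr p)"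
  shows "\<exists>h r. h \<in> disk_analytic \<and> dirichlet_energy \<alpha> p h \<le> ennreal (M powr p) \<and> strict_mono (r :: nat \<Rightarrow> nat) \<and>
    (\<forall>K. compact K \<and> K \<subseteq> unit_disk \<longrightarrow> uniform_limit K (\<lambda>n. f (r n)) h sequentially)"
proof -
  let ?H = "{f \<in> disk_analytic. cmod (f 0) \<le> M \<and> dirichlet_energy \<alpha> p f \<le> ennreal (M powr p)}"
  have bdd: "\<exists>B. \<forall>h\<in>?H. \<forall>z\<in>K. cmod (h z) \<le> B" if "compact K" "K \<subseteq> unit_disk" for K
    using disk_analytic_bounded_on_compact[OF p \<alpha> M that] by blast
  have rng: "range f \<subseteq> ?H" using f by blast
  obtain h0 r where h0: "h0 holomorphic_on unit_disk" "strict_mono (r :: nat \<Rightarrow> nat)"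
    and ul: "\<And>K. compact K \<Longrightarrow> K \<subseteq> unit_disk \<Longrightarrow> uniform_limit K (f \<circ> r) h0 sequentially"
    by (rule Montel[OF open_ball _ bdd rng]) (auto simp: disk_analytic_def)
  \<comment> \<open>Montel's theorem determines the limit on the disk only; the value 0 elsewhere
    selects the representative in \<open>disk_analytic\<close>.\<close>
  define h where "h = (\<lambda>z. if z \<in> unit_disk then h0 z else 0)"
  have h: "h \<in> disk_analytic"
    unfolding disk_analytic_def using holomorphic_transform[OF h0(1), of h] by (simp add: h_def)
  have ul': "uniform_limit K (\<lambda>n. f (r n)) h sequentially" if "compact K" "K \<subseteq> unit_disk" for K
  proof -
    have "h x = h0 x" if "x \<in> K" for x using that \<open>K \<subseteq> unit_disk\<close> by (auto simp: h_def)
    thus ?thesis using ul[OF that] unfolding uniform_limit_iff by (simp add: o_def cong: ball_cong)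
  qed
  have "dirichlet_energy \<alpha> p h \<le> liminf (\<lambda>n. dirichlet_energy \<alpha> p (f (r n)))"
  proof (rule dirichlet_energy_le_liminf[OF f(1) _ p])
    fix z assume z: "z \<in> unit_disk"
    define \<delta> where "\<delta> = (1 - cmod z) / 2"
    have \<delta>: "\<delta> > 0" using z by (simp add: \<delta>_def)
    have sub: "cball z \<delta> \<subseteq> unit_disk"
    proof
      fix x assume "x \<in> cball z \<delta>"
      hence "cmod x \<le> cmod z + \<delta>" using norm_triangle_ineq2[of x z] by (simp add: dist_norm norm_minus_commute)
      thus "x \<in> unit_disk" using z by (simp add: \<delta>_def field_simps)
    qed
    \<comment> \<open>Uniform convergence on a neighbourhood of z carries over to the derivatives at
      z.\<close>
    have "uniform_limit (ball z \<delta>) (\<lambda>n. f (r n)) h sequentially"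
      by (rule uniform_limit_on_subset[OF ul'[OF compact_cball sub]]) auto
    moreover have "f n holomorphic_on ball z \<delta>" for n
      by (rule holomorphic_on_subset[OF disk_analytic_holomorphic[OF f(1)] order_trans[OF ball_subset_cball sub]])
    ultimately have "(\<lambda>n. deriv (f (r n)) z) \<longlonglongrightarrow> deriv h z"
      using \<delta> by (intro deriv_complex_uniform_limit[where A = "ball z \<delta>"]) auto
    thus "(\<lambda>n. cmod (deriv (f (r n)) z)) \<longlonglongrightarrow> cmod (deriv h z)" by (rule tendsto_norm)
  qed
  also have "\<dots> \<le> ennreal (M powr p)"
    using f(3) by (intro Liminf_le) auto
  finally show ?thesis by (intro exI[of _ h] exI[of _ r] conjI allI impI h h0(2) ul') auto
qed

abbreviation tail_integral :: "complex measure \<Rightarrow> real \<Rightarrow> real \<Rightarrow> (complex \<Rightarrow> complex) \<Rightarrow> ennreal" where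
  "tail_integral M q R f \<equiv> \<integral>\<^sup>+z. ennreal (cmod (f z - f 0) powr q) * indicator {z. R \<le> cmod z} z \<partial>M"

text \<open>A bounded sequence has a subsequence converging uniformly on every smaller disk. On such
  a disk the finite mass of \<mu> turns this into smallness in the mean; outside it the tails are
  uniformly small. The tails control only oscillations f - f(0), so the values at 0 are compared
  separately.\<close>

lemma compact_volterra_if_tails_small:
  fixes \<alpha> \<beta> p q :: real
  assumes p: "p > 0" and q: "q > 0" and \<alpha>: "\<alpha> > -2" and g: "g \<in> disk_analytic"
    and fin: "finite_measure (dirichlet_measure g q \<beta>)"
    and tail: "\<And>\<epsilon>. \<epsilon> > 0 \<Longrightarrow> \<exists>R. 0 \<le> R \<and> R < 1 \<and> (\<forall>f\<in>disk_analytic. dirichlet_energy \<alpha> p f \<le> 1 \<longrightarrow>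
      tail_integral (dirichlet_measure g q \<beta>) q R f \<le> ennreal \<epsilon>)"
  shows "compact_dirichlet_operator \<alpha> p \<beta> q (volterra g)"
proof -
  define \<mu> where "\<mu> = dirichlet_measure g q \<beta>"
  interpret \<mu>: finite_measure \<mu> unfolding \<mu>_def by (rule fin)
  have [measurable_cong]: "sets \<mu> = sets disk_area" by (simp add: \<mu>_def)
  have sp: "space \<mu> = unit_disk" by (simp add: \<mu>_def)
  have meas [measurable]: "f \<in> borel_measurable disk_area" if "f \<in> disk_analytic" for f
    using borel_measurable_disk_analytic(1)[OF that] .
  have tail_set [measurable]: "Measurable.pred disk_area (\<lambda>z. z \<in> {z. R \<le> cmod z})" for R
    unfolding mem_Collect_eq by measurable
  \<comment> \<open>Homogeneity: f / M has unit energy, and the tail integral has degree q.\<close>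
  have tailM: "\<exists>R. 0 \<le> R \<and> R < 1 \<and> (\<forall>f\<in>disk_analytic. dirichlet_energy \<alpha> p f \<le> ennreal (M powr p) \<longrightarrow>
      tail_integral \<mu> q R f \<le> ennreal \<epsilon>)"
    if \<epsilon>: "\<epsilon> > 0" and M: "M > 0" for \<epsilon> M
  proof -
    have "\<epsilon> / M powr q > 0" using \<epsilon> M by simp
    from tail[OF this] obtain R where R: "0 \<le> R" "R < 1" "\<forall>f\<in>disk_analytic. dirichlet_energy \<alpha> p f \<le> 1 \<longrightarrow>
      tail_integral \<mu> q R f \<le> ennreal (\<epsilon> / M powr q)"
      unfolding \<mu>_def by (elim exE conjE)
    have "tail_integral \<mu> q R f \<le> ennreal \<epsilon>"
      if f: "f \<in> disk_analytic" "dirichlet_energy \<alpha> p f \<le> ennreal (M powr p)" for f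
    proof -
      define h where "h = (\<lambda>z. of_real (1 / M) * f z)"
      have "dirichlet_energy \<alpha> p h \<le> ennreal ((1 / M) powr p) * ennreal (M powr p)"
        unfolding h_def dirichlet_energy_cmult[OF f(1)] using M by (intro mult_mono f(2)) (auto simp: norm_divide)
      also have "\<dots> = 1" using M p by (simp add: powr_divide flip: ennreal_mult)
      finally have he: "dirichlet_energy \<alpha> p h \<le> 1" .
      have hd: "h \<in> disk_analytic" unfolding h_def by (rule disk_analytic_cmult[OF f(1)])
      have hR: "tail_integral \<mu> q R h \<le> ennreal (\<epsilon> / M powr q)"
        using R(3) hd he by blast
      have [measurable]: "h \<in> borel_measurable disk_area" unfolding h_def by (intro meas disk_analytic_cmult f)
      have "cmod (f z - f 0) = M * cmod (h z - h 0)" for z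
      proof -
        have "f z - f 0 = of_real M * (h z - h 0)" using M by (simp add: h_def right_diff_distrib)
        thus ?thesis using M by (simp add: norm_mult)
      qed
      hence "tail_integral \<mu> q R f =
          (\<integral>\<^sup>+z. ennreal (M powr q) * (ennreal (cmod (h z - h 0) powr q) * indicator {z. R \<le> cmod z} z) \<partial>\<mu>)"
        using M by (intro nn_integral_cong) (simp add: powr_mult ennreal_mult mult.assoc)
      also have "\<dots> = ennreal (M powr q) * tail_integral \<mu> q R h"
        by (intro nn_integral_cmult) measurable
      also have "\<dots> \<le> ennreal (M powr q) * ennreal (\<epsilon> / M powr q)" by (intro mult_left_mono hR) auto
      also have "\<dots> = ennreal \<epsilon>" using M \<epsilon> by (simp flip: ennreal_mult)
      finally show ?thesis .
    qed
    thus ?thesis using R(1,2) by blast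
  qed
  have mass: "(\<integral>\<^sup>+z. ennreal K \<partial>\<mu>) = ennreal (K * measure \<mu> unit_disk)" if "K \<ge> 0" for K
    using that by (simp add: sp \<mu>.emeasure_eq_measure ennreal_mult)
  \<comment> \<open>The case of a single function: f is bounded on a closed smaller disk, and the
    tail estimate with bound 1 covers the rest.\<close>
  have into: "volterra g f \<in> dirichlet_space \<beta> q" if f: "f \<in> dirichlet_space \<alpha> p" for f
  proof -
    have fd: "f \<in> disk_analytic" and fe: "dirichlet_energy \<alpha> p f < \<infinity>" using f by (auto simp: dirichlet_space_iff)
    note [measurable] = meas[OF fd]
    define M where "M = (1 + enn2real (dirichlet_energy \<alpha> p f)) powr (1 / p)"
    have "M powr p = 1 + enn2real (dirichlet_energy \<alpha> p f)" using p by (simp add: M_def powr_powr)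
    hence "dirichlet_energy \<alpha> p f \<le> ennreal (M powr p)"
      using fe by (subst ennreal_enn2real[symmetric]) (auto intro!: ennreal_leI)
    note fM = this
    have "1 + enn2real (dirichlet_energy \<alpha> p f) > 0" by (rule add_pos_nonneg) auto
    hence M: "M > 0" by (simp add: M_def)
    obtain R where R: "0 \<le> R" "R < 1" and R': "\<forall>f\<in>disk_analytic. dirichlet_energy \<alpha> p f \<le> ennreal (M powr p) \<longrightarrow>
        tail_integral \<mu> q R f \<le> ennreal 1"
      using tailM[OF zero_less_one M] by (elim exE conjE)
    have R3: "tail_integral \<mu> q R f \<le> ennreal 1"
      using R' fd fM by blast
    have "cball 0 R \<subseteq> unit_disk" using R by auto
    hence "continuous_on (cball 0 R) f"
      using disk_analytic_holomorphic[OF fd] holomorphic_on_imp_continuous_on continuous_on_subset by blast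
    hence "bounded (f ` cball 0 R)" by (intro compact_imp_bounded compact_continuous_image) auto
    then obtain b where b: "b > 0" "\<forall>x\<in>f ` cball 0 R. cmod x \<le> b" unfolding bounded_pos by blast
    define K where "K = b powr q + 2 powr q * cmod (f 0) powr q"
    have K: "K \<ge> 0" by (simp add: K_def)
    have "(\<integral>\<^sup>+z. ennreal (cmod (f z) powr q) \<partial>\<mu>) \<le>
      (\<integral>\<^sup>+z. ennreal K + ennreal (2 powr q) * (ennreal (cmod (f z - f 0) powr q) * indicator {z. R \<le> cmod z} z) \<partial>\<mu>)"
    proof (rule nn_integral_mono)
      fix z
      show "ennreal (cmod (f z) powr q) \<le> ennreal K + ennreal (2 powr q) * (ennreal (cmod (f z - f 0) powr q) * indicator {z. R \<le> cmod z} z)"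
      proof (cases "R \<le> cmod z")
        case True
        have "cmod (f z) powr q \<le> 2 powr q * (cmod (f z - f 0) powr q + cmod (- f 0) powr q)"
          using norm_diff_powr_le[OF q, of "f z - f 0" "- f 0"] by simp
        also have "\<dots> \<le> K + 2 powr q * cmod (f z - f 0) powr q" by (simp add: K_def algebra_simps)
        finally have "ennreal (cmod (f z) powr q) \<le> ennreal (K + 2 powr q * cmod (f z - f 0) powr q)" by (rule ennreal_leI)
        thus ?thesis using True K by (simp add: ennreal_mult)
      next
        case False
        have "cmod (f z) powr q \<le> b powr q" using b(2) False q by (intro powr_mono2) auto
        also have "\<dots> \<le> K" by (simp add: K_def)
        finally show ?thesis using False by (simp add: ennreal_leI)
      qed
    qed
    also have "\<dots> = (\<integral>\<^sup>+z. ennreal K \<partial>\<mu>) + ennreal (2 powr q) * tail_integral \<mu> q R f"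
      by (subst nn_integral_add) (measurable, simp add: nn_integral_cmult)
    also have "\<dots> < \<infinity>" using R3 K by (simp add: \<mu>.emeasure_eq_measure ennreal_mult_less_top order.strict_trans1[OF R3])
    finally show ?thesis
      using dirichlet_energy_volterra[OF g fd, of \<beta> q] volterra_disk_analytic[OF fd g]
      by (simp add: dirichlet_space_iff \<mu>_def)
  qed
  interpret Q: quasi_metric_topology "dirichlet_topology \<beta> q" "dirichlet_space \<beta> q"
    "\<lambda>f h. dirichlet_norm \<beta> q (\<lambda>z. f z - h z)" "2 * 2 powr (1 / q)"
    by (rule dirichlet_quasi_metric_topology[OF q])
  have "relatively_compactin (dirichlet_topology \<beta> q) (volterra g ` S)" if S: "dirichlet_bounded \<alpha> p S" for S
  proof (rule Q.relatively_compactin_if_sequential)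
    have SM: "S \<subseteq> dirichlet_space \<alpha> p" using S by (simp add: dirichlet_bounded_def)
    show "volterra g ` S \<subseteq> dirichlet_space \<beta> q"
      by (rule image_subsetI, rule into) (use SM in auto)
    obtain C where C: "\<And>f. f \<in> S \<Longrightarrow> dirichlet_norm \<alpha> p f \<le> C" using S by (auto simp: dirichlet_bounded_def)
    define M where "M = max C 1"
    have M: "M > 0" by (simp add: M_def)
    fix k :: "nat \<Rightarrow> complex \<Rightarrow> complex" assume "range k \<subseteq> volterra g ` S"
    hence "k n \<in> volterra g ` S" for n by (rule range_subsetD)
    hence "\<exists>f. f \<in> S \<and> k n = volterra g f" for n by (auto simp: image_iff)
    then obtain f where f: "\<And>n. f n \<in> S" "\<And>n. k n = volterra g (f n)" by metis
    have fs: "f n \<in> dirichlet_space \<alpha> p" for n using subsetD[OF SM f(1)] .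
    hence fd: "f n \<in> disk_analytic" for n by (simp add: dirichlet_space_iff)
    have "dirichlet_norm \<alpha> p (f n) \<le> M" for n using C[OF f(1)[of n]] by (simp add: M_def)
    note fM = dirichlet_norm_leD[OF fs p this]
    obtain h r where h: "h \<in> disk_analytic" "dirichlet_energy \<alpha> p h \<le> ennreal (M powr p)" and r: "strict_mono (r :: nat \<Rightarrow> nat)"
      and ul: "\<forall>K. compact K \<and> K \<subseteq> unit_disk \<longrightarrow> uniform_limit K (\<lambda>n. f (r n)) h sequentially"
      using dirichlet_montel[where f = f, OF p \<alpha> M fd fM] by (elim exE conjE)
    have hs: "h \<in> dirichlet_space \<alpha> p"
      unfolding dirichlet_space_iff using h(1) order.strict_trans1[OF h(2) ennreal_less_top] by simp
    note [measurable] = meas[OF fd] meas[OF h(1)]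
    have ev: "\<forall>\<^sub>F n in sequentially. (\<integral>\<^sup>+z. ennreal (cmod (f (r n) z - h z) powr q) \<partial>\<mu>) \<le> ennreal e" if e: "e > 0" for e :: real
    proof -
      \<comment> \<open>The tails of the sequence term and of the limit enter with factor
        \<open>2 powr q * 2 powr q\<close>, so each contributes e / 4; half of e remains for uniform
        convergence.\<close>
      define \<epsilon>' where "\<epsilon>' = e / (4 * (2 powr q * 2 powr q))"
      have \<epsilon>': "\<epsilon>' > 0" using e by (simp add: \<epsilon>'_def)
      obtain R where R: "0 \<le> R" "R < 1" "\<forall>f\<in>disk_analytic. dirichlet_energy \<alpha> p f \<le> ennreal (M powr p) \<longrightarrow>
        tail_integral \<mu> q R f \<le> ennreal \<epsilon>'"
        using tailM[OF \<epsilon>' M] by (elim exE conjE)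
      \<comment> \<open>In the first factor the 1 comes from the inner disk and
        \<open>2 powr q\<close> from the difference of the values at 0 on the tail; the summand 1 in
        the second keeps \<open>m\<close> positive when \<mu> vanishes.\<close>
      define m where "m = (1 + 2 powr q) * (measure \<mu> unit_disk + 1)"
      have m: "m > 0" by (simp add: m_def add_nonneg_pos)
      define \<delta> where "\<delta> = (e / (2 * m)) powr (1 / q)"
      have \<delta>: "\<delta> > 0" "\<delta> powr q = e / (2 * m)" using e m q by (auto simp: \<delta>_def powr_powr)
      have "cball 0 R \<subseteq> unit_disk" using R by auto
      hence "uniform_limit (cball 0 R) (\<lambda>n. f (r n)) h sequentially" using ul compact_cball by blast
      hence "\<forall>\<^sub>F n in sequentially. \<forall>z\<in>cball 0 R. dist (f (r n) z) (h z) < \<delta>"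
        using \<delta>(1) by (simp add: uniform_limit_iff)
      thus ?thesis
      proof eventually_elim
        case (elim n)
        define F where "F = f (r n)"
        note [measurable] = meas[OF fd[of "r n"], folded F_def]
        have close: "cmod (F z - h z) \<le> \<delta>" if "cmod z \<le> R" for z
          using elim that by (auto simp: F_def dist_norm intro: less_imp_le)
        define K where "K = (1 + 2 powr q) * \<delta> powr q"
        have K: "K \<ge> 0" by (simp add: K_def)
        define c where "c = 2 powr q * 2 powr q"
        have c: "c > 0" by (simp add: c_def)
        have "(\<integral>\<^sup>+z. ennreal (cmod (F z - h z) powr q) \<partial>\<mu>) \<le>
          (\<integral>\<^sup>+z. ennreal K + (ennreal c * (ennreal (cmod (F z - F 0) powr q) * indicator {z. R \<le> cmod z} z)
            + ennreal c * (ennreal (cmod (h z - h 0) powr q) * indicator {z. R \<le> cmod z} z)) \<partial>\<mu>)"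
        proof (rule nn_integral_mono)
          fix z
          show "ennreal (cmod (F z - h z) powr q) \<le>
            ennreal K + (ennreal c * (ennreal (cmod (F z - F 0) powr q) * indicator {z. R \<le> cmod z} z)
              + ennreal c * (ennreal (cmod (h z - h 0) powr q) * indicator {z. R \<le> cmod z} z))"
          proof (cases "R \<le> cmod z")
            case True
            \<comment> \<open>F - h is regrouped into the two oscillations and the difference of the
              values at 0, the latter at most \<open>\<delta>\<close> because 0 lies in the inner
              disk.\<close>
            have "cmod (F z - h z) powr q \<le> 2 powr q * (cmod ((F z - F 0) - (h z - h 0)) powr q + cmod (h 0 - F 0) powr q)"
              using norm_diff_powr_le[OF q, of "(F z - F 0) - (h z - h 0)" "h 0 - F 0"] by simp
            also have "\<dots> \<le> 2 powr q * (2 powr q * (cmod (F z - F 0) powr q + cmod (h z - h 0) powr q) + \<delta> powr q)"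
              using close[of 0] R q
              by (intro mult_left_mono add_mono norm_diff_powr_le powr_mono2) (auto simp: norm_minus_commute)
            also have "\<dots> \<le> K + (c * cmod (F z - F 0) powr q + c * cmod (h z - h 0) powr q)"
              by (simp add: K_def c_def algebra_simps)
            finally have "ennreal (cmod (F z - h z) powr q) \<le> ennreal (K + (c * cmod (F z - F 0) powr q + c * cmod (h z - h 0) powr q))"
              by (rule ennreal_leI)
            thus ?thesis using True K c by (simp add: ennreal_mult)
          next
            case False
            have "cmod (F z - h z) powr q \<le> \<delta> powr q" using close[of z] False q by (intro powr_mono2) auto
            also have "\<dots> \<le> K" by (simp add: K_def algebra_simps)
            finally show ?thesis using False by (simp add: ennreal_leI)
          qed
        qed
        also have "\<dots> = (\<integral>\<^sup>+z. ennreal K \<partial>\<mu>) + (ennreal c * tail_integral \<mu> q R F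
            + ennreal c * tail_integral \<mu> q R h)"
          by (subst nn_integral_add, measurable)+ (simp add: nn_integral_cmult)
        also have m1: "(\<integral>\<^sup>+z. ennreal K \<partial>\<mu>) = ennreal (K * measure \<mu> unit_disk)" by (rule mass[OF K])
        also have "\<dots> + (ennreal c * tail_integral \<mu> q R F
            + ennreal c * tail_integral \<mu> q R h)
          \<le> ennreal (K * measure \<mu> unit_disk) + (ennreal c * ennreal \<epsilon>' + ennreal c * ennreal \<epsilon>')"
          using R(3)[rule_format, OF fd[of "r n"] fM(2)] R(3)[rule_format, OF h]
          by (intro add_mono mult_left_mono order_refl) (auto simp: F_def)
        also have "\<dots> = ennreal (K * measure \<mu> unit_disk + (c * \<epsilon>' + c * \<epsilon>'))"
          by (rule ennreal_linear_combination[symmetric]) (use K c \<epsilon>' in auto)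
        also have "\<dots> \<le> ennreal e"
        proof (rule ennreal_leI)
          have "K * measure \<mu> unit_disk = \<delta> powr q * ((1 + 2 powr q) * measure \<mu> unit_disk)" by (simp add: K_def)
          also have "\<dots> \<le> \<delta> powr q * m" unfolding m_def by (intro mult_left_mono) auto
          also have "\<dots> = e / 2" using m by (simp add: \<delta>(2))
          finally have "K * measure \<mu> unit_disk \<le> e / 2" .
          moreover have "c * \<epsilon>' = e / 4" by (simp add: \<epsilon>'_def c_def)
          ultimately show "K * measure \<mu> unit_disk + (c * \<epsilon>' + c * \<epsilon>') \<le> e" by linarith
        qed
        finally show ?case by (simp add: F_def)
      qed
    qed
    have "(\<lambda>n. dirichlet_norm \<beta> q (\<lambda>z. k (r n) z - volterra g h z)) \<longlonglongrightarrow> 0"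
    proof (rule tendstoI)
      fix e :: real assume e: "e > 0"
      have "(e / 2) powr q > 0" using e by simp
      from ev[OF this] show "\<forall>\<^sub>F n in sequentially. dist (dirichlet_norm \<beta> q (\<lambda>z. k (r n) z - volterra g h z)) 0 < e"
      proof eventually_elim
        case (elim n)
        have en: "dirichlet_energy \<beta> q (\<lambda>z. k (r n) z - volterra g h z) \<le> ennreal ((e / 2) powr q)"
          using elim unfolding f(2) dirichlet_energy_volterra_diff[OF g fd h(1)] \<mu>_def .
        have kd: "(\<lambda>z. k (r n) z - volterra g h z) \<in> disk_analytic"
          unfolding f(2) by (intro disk_analytic_diff volterra_disk_analytic fd h(1) g)
        have "dirichlet_norm \<beta> q (\<lambda>z. k (r n) z - volterra g h z) \<le> (0 powr q + (e / 2) powr q) powr (1 / q)"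
          by (rule dirichlet_norm_leI[OF kd q _ _ _ en]) (auto simp: f(2))
        also have "\<dots> = e / 2" using e q by (simp add: powr_powr)
        finally show ?case using e dirichlet_norm_nonneg[of \<beta> q] by (simp add: dist_real_def)
      qed
    qed
    thus "\<exists>l\<in>dirichlet_space \<beta> q. \<exists>r. strict_mono r \<and> (\<lambda>n. dirichlet_norm \<beta> q (\<lambda>z. k (r n) z - l z)) \<longlonglongrightarrow> 0"
      by (intro bexI[OF _ into[OF hs]] exI[of _ r] conjI r)
  qed (rule dirichlet_norm_nonneg)
  moreover have "volterra g ` dirichlet_space \<alpha> p \<subseteq> dirichlet_space \<beta> q" by (rule image_subsetI, rule into)
  ultimately show ?thesis unfolding compact_dirichlet_operator_def by simp
qed

text \<open>Compactness gives the images a cluster point \<open>l\<close>. Since the functions tend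
  to 0 pointwise, so do the derivatives of their images, and Fatou leaves \<open>l\<close> no
  energy. Hence images of arbitrarily small norm occur, against the lower bound
  \<open>e\<close>.\<close>

lemma compact_volterra_contradiction:
  fixes \<alpha> \<beta> p q e M :: real and f :: "nat \<Rightarrow> complex \<Rightarrow> complex"
  assumes comp: "compact_dirichlet_operator \<alpha> p \<beta> q (volterra g)" and q: "q > 0" and g: "g \<in> disk_analytic"
    and f: "\<And>n. f n \<in> dirichlet_space \<alpha> p" "\<And>n. dirichlet_norm \<alpha> p (f n) \<le> M"
    and f0: "\<And>z. z \<in> unit_disk \<Longrightarrow> (\<lambda>n. f n z) \<longlonglongrightarrow> 0"
    and e: "e > 0" and ge: "\<And>n. ennreal e \<le> (\<integral>\<^sup>+z. ennreal (cmod (f n z) powr q) \<partial>dirichlet_measure g q \<beta>)"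
  shows False
proof -
  interpret Q: quasi_metric_topology "dirichlet_topology \<beta> q" "dirichlet_space \<beta> q"
    "\<lambda>f h. dirichlet_norm \<beta> q (\<lambda>z. f z - h z)" "2 * 2 powr (1 / q)"
    by (rule dirichlet_quasi_metric_topology[OF q])
  have fd: "f n \<in> disk_analytic" for n using f(1) by (simp add: dirichlet_space_iff)
  define k where "k = (\<lambda>n. volterra g (f n))"
  have "dirichlet_bounded \<alpha> p (range f)" unfolding dirichlet_bounded_def
    by (intro conjI exI[of _ M]) (use f in auto)
  hence "relatively_compactin (dirichlet_topology \<beta> q) (volterra g ` range f)"
    using comp by (simp add: compact_dirichlet_operator_def)
  hence sub: "volterra g ` range f \<subseteq> topspace (dirichlet_topology \<beta> q)"
    and cpt: "compactin (dirichlet_topology \<beta> q) (dirichlet_topology \<beta> q closure_of (volterra g ` range f))"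
    by (auto simp: relatively_compactin_def)
  have kin: "k n \<in> dirichlet_topology \<beta> q closure_of (volterra g ` range f)" for n
    using closure_of_subset[OF sub] by (auto simp: k_def)
  have ks: "k n \<in> dirichlet_space \<beta> q" for n using sub by (auto simp: k_def topspace_dirichlet_topology)
  obtain l where l: "l \<in> dirichlet_topology \<beta> q closure_of (volterra g ` range f)"
    and cluster: "\<forall>r>0. \<forall>N. \<exists>n\<ge>N. dirichlet_norm \<beta> q (\<lambda>z. k n z - l z) < r"
    using Q.compactin_cluster_point[OF cpt, of k, OF kin] by (elim bexE)
  have ls: "l \<in> dirichlet_space \<beta> q"
    using l closure_of_subset_topspace topspace_dirichlet_topology by (metis subsetD)
  hence ld: "l \<in> disk_analytic" by (simp add: dirichlet_space_iff)
  \<comment> \<open>Indices with \<open>n j \<ge> j\<close> tend to infinity, which suffices for the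
    pointwise limits below; strict monotonicity is not arranged.\<close>
  have "\<exists>n\<ge>j. dirichlet_norm \<beta> q (\<lambda>z. k n z - l z) < 1 / Suc j" for j
    by (rule cluster[rule_format]) simp
  then obtain n where n: "\<And>j. n j \<ge> j" "\<And>j. dirichlet_norm \<beta> q (\<lambda>z. k (n j) z - l z) < 1 / Suc j" by metis
  have nlim: "filterlim n at_top sequentially"
    unfolding filterlim_at_top using n(1) by (meson eventually_sequentially order_trans)
  have ds: "(\<lambda>z. k (n j) z - l z) \<in> dirichlet_space \<beta> q" for j by (intro dirichlet_space_diff ks ls q)
  note dl = dirichlet_norm_leD[OF ds q less_imp_le[OF n(2)]]
  have to0: "(\<lambda>j. 1 / real (Suc j)) \<longlonglongrightarrow> 0" by (rule LIMSEQ_Suc[OF lim_1_over_n])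
  have "dirichlet_energy \<beta> q l \<le> liminf (\<lambda>j. dirichlet_energy \<beta> q (\<lambda>z. k (n j) z - l z))"
  proof (rule dirichlet_energy_le_liminf[OF _ _ q])
    show "(\<lambda>z. k (n j) z - l z) \<in> disk_analytic" for j using ds by (simp add: dirichlet_space_iff)
    fix z assume z: "z \<in> unit_disk"
    have "deriv (\<lambda>z. k (n j) z - l z) z = f (n j) z * deriv g z - deriv l z" for j
      unfolding k_def by (intro DERIV_imp_deriv DERIV_diff volterra_deriv disk_analytic_deriv fd g ld z)
    moreover have "(\<lambda>j. f (n j) z) \<longlonglongrightarrow> 0" using filterlim_compose[OF f0[OF z] nlim] .
    \<comment> \<open>The derivatives converge to \<open>- deriv l z\<close>, with the same modulus
      as \<open>deriv l z\<close>.\<close>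
    hence "(\<lambda>j. cmod (f (n j) z * deriv g z - deriv l z)) \<longlonglongrightarrow> cmod (0 * deriv g z - deriv l z)"
      by (intro tendsto_intros)
    ultimately show "(\<lambda>j. cmod (deriv (\<lambda>z. k (n j) z - l z) z)) \<longlonglongrightarrow> cmod (deriv l z)" by simp
  qed
  also have "\<dots> \<le> liminf (\<lambda>j. ennreal ((1 / Suc j) powr q))"
    by (intro Liminf_mono always_eventually allI dl(2))
  also have "\<dots> = 0"
  proof -
    have "(\<lambda>j. (1 / real (Suc j)) powr q) \<longlonglongrightarrow> 0 powr q" using q to0 by (intro tendsto_powr') auto
    hence "(\<lambda>j. ennreal ((1 / real (Suc j)) powr q)) \<longlonglongrightarrow> ennreal (0 powr q)" by (intro tendsto_ennrealI)
    thus ?thesis by (auto dest: lim_imp_Liminf[rotated])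
  qed
  finally have el: "dirichlet_energy \<beta> q l = 0" by simp
  have "cmod (l 0) \<le> 1 / Suc j" for j using dl(1)[of j] by (simp add: k_def)
  hence l0: "cmod (l 0) \<le> 0" by (intro LIMSEQ_le_const[OF to0]) auto
  \<comment> \<open>A vanishing quasi-norm suffices: one quasi-triangle inequality, with the zero
    function as third point, makes the images themselves small.\<close>
  have "dirichlet_norm \<beta> q l = 0" using l0 q by (simp add: dirichlet_norm_eq[OF ld] el)
  note l_null = this
  have tri: "dirichlet_norm \<beta> q (k (n j)) \<le> 2 * 2 powr (1 / q) * (1 / Suc j)" for j
  proof -
    have "dirichlet_norm \<beta> q (k (n j)) \<le> 2 * 2 powr (1 / q) *
        (dirichlet_norm \<beta> q (\<lambda>z. k (n j) z - l z) + dirichlet_norm \<beta> q l)"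
      using dirichlet_norm_quasi_triangle[OF ks ls zero_in_dirichlet_space q, of "n j"] by simp
    also have "\<dots> \<le> 2 * 2 powr (1 / q) * (1 / Suc j + 0)"
      using n(2)[of j] l_null by (intro mult_left_mono add_mono) auto
    finally show ?thesis by simp
  qed
  have "e \<le> (2 * 2 powr (1 / q) * (1 / Suc j)) powr q" for j
  proof -
    have "ennreal e \<le> dirichlet_energy \<beta> q (k (n j))"
      using ge[of "n j"] unfolding k_def dirichlet_energy_volterra[OF g fd] .
    also have "\<dots> \<le> ennreal ((2 * 2 powr (1 / q) * (1 / Suc j)) powr q)"
      by (rule dirichlet_norm_leD(2)[OF ks q tri])
    finally show ?thesis by (simp add: ennreal_le_iff)
  qed
  moreover have "(\<lambda>j. (2 * 2 powr (1 / q) * (1 / real (Suc j))) powr q) \<longlonglongrightarrow> (2 * 2 powr (1 / q) * 0) powr q"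
    using q by (intro tendsto_powr' tendsto_mult tendsto_const to0) auto
  ultimately have "e \<le> (2 * 2 powr (1 / q) * 0) powr q" by (intro LIMSEQ_le_const) auto
  thus False using e by simp
qed

section \<open>Boundary layers and Cauchy kernels\<close>

text \<open>For y = \<bar>u\<bar> / 2 \<le> 2 one has y^3 \<le> 4 y, so the cubic Taylor bound gives
  sin y \<ge> y - y^3 / 6 \<ge> y / 3.\<close>

lemma abs_le_norm_cis_minus_1:
  assumes "\<bar>u\<bar> \<le> pi"
  shows "\<bar>u\<bar> \<le> 3 * cmod (cis u - 1)"
proof -
  define y where "y = \<bar>u\<bar> / 2"
  have y: "0 \<le> y" "y \<le> 2" using assms pi_less_4 by (auto simp: y_def)
  have "(\<Sum>m<3. sin_coeff m * y ^ m) = y" by (simp add: eval_nat_numeral sin_coeff_def)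
  hence "\<bar>sin y - y\<bar> \<le> y ^ 3 / 6"
    using Maclaurin_sin_bound[of y 3] y by (simp add: fact_numeral field_simps)
  moreover have "y ^ 3 \<le> 4 * y"
    using y mult_mono[of y 2 y 2] mult_right_mono[of "y * y" 4 y] by (simp add: eval_nat_numeral)
  ultimately have "y / 3 \<le> sin y" by linarith
  moreover have "\<bar>sin (u / 2)\<bar> \<ge> sin y" by (cases "u \<ge> 0") (auto simp: y_def)
  moreover have "cmod (cis u - 1) = 2 * \<bar>sin (u / 2)\<bar>"
    using dist_exp_i_1[of u] by (simp add: cis_conv_exp dist_norm)
  ultimately show ?thesis by (simp add: y_def)
qed

text \<open>Moving z radially to the circle costs at most another \<open>cmod (z - \<zeta>)\<close>,
  hence a factor 2; passing from the chord to the angle costs 3.\<close>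

lemma near_boundary_point:
  assumes "cmod \<zeta> = 1" "cmod z < 1"
  obtains u where "z = of_real (cmod z) * cis u * \<zeta>" "\<bar>u\<bar> \<le> 6 * cmod (z - \<zeta>)"
proof
  have \<zeta>: "\<zeta> \<noteq> 0" using assms by auto
  define u where "u = Arg (z / \<zeta>)"
  have "z / \<zeta> = of_real (cmod z) * cis u"
    using rcis_cmod_Arg[of "z / \<zeta>"] assms by (simp add: rcis_def u_def norm_divide)
  thus eq: "z = of_real (cmod z) * cis u * \<zeta>" using \<zeta> by (simp add: field_simps)
  have "cmod (cis u - 1) \<le> cmod (cis u - z / \<zeta>) + cmod (z / \<zeta> - 1)"
    using norm_triangle_ineq[of "cis u - z / \<zeta>" "z / \<zeta> - 1"] by simp
  also have "cmod (cis u - z / \<zeta>) = 1 - cmod z"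
  proof -
    have "cis u - z / \<zeta> = of_real (1 - cmod z) * cis u"
      unfolding \<open>z / \<zeta> = of_real (cmod z) * cis u\<close> by (simp add: algebra_simps)
    thus ?thesis using assms by (simp only: norm_mult norm_of_real norm_cis) simp
  qed
  also have "cmod (z / \<zeta> - 1) = cmod (z - \<zeta>)"
    using \<zeta> assms norm_divide[of "z - \<zeta>" \<zeta>] by (simp add: diff_divide_distrib)
  also have "1 - cmod z \<le> cmod (z - \<zeta>)" using norm_triangle_ineq2[of \<zeta> z] assms by (simp add: norm_minus_commute)
  finally have "cmod (cis u - 1) \<le> 2 * cmod (z - \<zeta>)" by simp
  moreover have "\<bar>u\<bar> \<le> 3 * cmod (cis u - 1)"
    using Arg_bounded[of "z / \<zeta>"] by (intro abs_le_norm_cis_minus_1) (auto simp: u_def)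
  ultimately show "\<bar>u\<bar> \<le> 6 * cmod (z - \<zeta>)" by linarith
qed

text \<open>A boundary layer of width \<open>t\<close> over an arc of length \<open>x\<close> is covered by \<open>O(x / t)\<close> balls of
  radius \<open>O(t)\<close>; this replaces polar coordinates.\<close>

lemma emeasure_boundary_layer_le:
  assumes \<zeta>: "cmod \<zeta> = 1" and t: "0 < t" "t \<le> x"
  shows "emeasure disk_area {z \<in> unit_disk. 1 - cmod z \<le> t \<and> cmod (z - \<zeta>) \<le> x} \<le> ennreal (135 * t * x)"
proof -
  \<comment> \<open>Angles of points in the layer are at most 6 x, so steps of size t with index
    between -J and J reach all of them.\<close>
  define J where "J = \<lceil>6 * x / t\<rceil>"
  have J: "6 * x / t \<le> of_int J" "of_int J < 6 * x / t + 1" by (auto simp: J_def) linarith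
  have "6 * x / t > 0" using t by (intro divide_pos_pos) auto
  hence J0: "J \<ge> 0" using J(1) by linarith
  \<comment> \<open>A point of the layer is within t of the circle radially and within t of the
    nearest lower grid angle, so its distance from the centre is at most 2 t < 3 t.\<close>
  define B where "B = (\<lambda>j::int. unit_disk \<inter> ball (cis (of_int j * t) * \<zeta>) (3 * t))"
  have BS: "B j \<in> sets disk_area" for j unfolding B_def by (intro in_sets_disk_area) auto
  have "{z \<in> unit_disk. 1 - cmod z \<le> t \<and> cmod (z - \<zeta>) \<le> x} \<subseteq> (\<Union>j\<in>{-J..J}. B j)"
  proof
    fix z assume "z \<in> {z \<in> unit_disk. 1 - cmod z \<le> t \<and> cmod (z - \<zeta>) \<le> x}"
    hence z: "cmod z < 1" "1 - cmod z \<le> t" "cmod (z - \<zeta>) \<le> x" by auto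
    obtain u where u: "z = of_real (cmod z) * cis u * \<zeta>" "\<bar>u\<bar> \<le> 6 * cmod (z - \<zeta>)"
      using near_boundary_point[OF \<zeta> z(1)] .
    define j where "j = \<lfloor>u / t\<rfloor>"
    have j: "of_int j \<le> u / t" "u / t < of_int j + 1" by (auto simp: j_def)
    have ux: "\<bar>u\<bar> / t \<le> 6 * x / t" using u(2) z(3) t by (intro divide_right_mono) auto
    have "u / t \<le> \<bar>u\<bar> / t" "- (\<bar>u\<bar> / t) \<le> u / t" using t by (auto simp: field_simps)
    hence bounds: "of_int j \<le> (of_int J :: real)" "- of_int J - 1 < (of_int j :: real)" using ux j J by linarith+
    hence jJ: "j \<in> {-J..J}" by auto
    have ujt: "\<bar>u - of_int j * t\<bar> \<le> t" using j t by (auto simp: field_simps)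
    have "cmod (z - cis (of_int j * t) * \<zeta>) = cmod ((of_real (cmod z) * cis u - cis (of_int j * t)) * \<zeta>)"
      using u(1) by (simp add: left_diff_distrib)
    also have "\<dots> = cmod ((of_real (cmod z) * cis u - cis u) + (cis u - cis (of_int j * t)))"
      using \<zeta> by (simp add: norm_mult)
    also have "\<dots> \<le> cmod (of_real (cmod z) * cis u - cis u) + cmod (cis u - cis (of_int j * t))"
      by (rule norm_triangle_ineq)
    also have "cmod (of_real (cmod z) * cis u - cis u) = 1 - cmod z"
    proof -
      have "of_real (cmod z) * cis u - cis u = of_real (cmod z - 1) * cis u" by (simp add: algebra_simps)
      thus ?thesis using z by (simp only: norm_mult norm_of_real norm_cis) simp
    qed
    also have "cmod (cis u - cis (of_int j * t)) \<le> t" using dist_cis_le[of u "of_int j * t"] ujt by linarith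
    finally have "z \<in> B j" using z t by (simp add: B_def dist_norm norm_minus_commute)
    thus "z \<in> (\<Union>j\<in>{-J..J}. B j)" using jJ by blast
  qed
  hence "emeasure disk_area {z \<in> unit_disk. 1 - cmod z \<le> t \<and> cmod (z - \<zeta>) \<le> x} \<le> emeasure disk_area (\<Union>j\<in>{-J..J}. B j)"
    using BS by (intro emeasure_mono) auto
  also have "\<dots> \<le> (\<Sum>j\<in>{-J..J}. emeasure disk_area (B j))"
    using BS by (intro emeasure_subadditive_finite) auto
  also have "\<dots> \<le> (\<Sum>j\<in>{-J..J}. ennreal ((3 * t)\<^sup>2))"
    using t by (intro sum_mono emeasure_disk_area_le_ball) (auto simp: B_def)
  also have "\<dots> = of_nat (card {-J..J}) * ennreal ((3 * t)\<^sup>2)" by simp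
  also have "\<dots> = ennreal (of_nat (card {-J..J}) * (3 * t)\<^sup>2)" by (simp add: ennreal_mult ennreal_of_nat_eq_real_of_nat)
  also have "\<dots> \<le> ennreal (135 * t * x)"
  proof (rule ennreal_leI)
    \<comment> \<open>The count is below 12 x / t + 3 \<le> 15 x / t because t \<le> x; each ball
      has measure at most 9 t^2, and 15 times 9 is 135.\<close>
    have "real (card {-J..J}) = 2 * of_int J + 1" using J0 by simp
    also have "\<dots> \<le> 15 * x / t"
    proof -
      have "1 \<le> x / t" using t by simp
      thus ?thesis using J(2) by simp
    qed
    finally have "real (card {-J..J}) * (3 * t)\<^sup>2 \<le> 15 * x / t * (3 * t)\<^sup>2" by (intro mult_right_mono) auto
    also have "\<dots> = 135 * t * x" using t by (simp add: power2_eq_square field_simps)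
    finally show "real (card {-J..J}) * (3 * t)\<^sup>2 \<le> 135 * t * x" .
  qed
  finally show ?thesis .
qed

lemma dyadic_below:
  fixes x y :: real
  assumes "0 < y" "y \<le> x"
  obtains k :: nat where "y \<le> x / 2 ^ k" "x / 2 ^ k < 2 * y"
proof -
  obtain n where n: "x / y < 2 ^ n" using real_arch_pow[of 2 "x / y"] by auto
  define m where "m = (LEAST n. x / y < 2 ^ n)"
  have m: "x / y < 2 ^ m" unfolding m_def by (rule LeastI[of _ n]) (rule n)
  have "m \<noteq> 0"
  proof
    assume "m = 0"
    thus False using m assms by (simp add: divide_less_eq)
  qed
  then obtain k where k: "m = Suc k" using not0_implies_Suc by blast
  have "\<not> x / y < 2 ^ k" using not_less_Least[of k "\<lambda>n. x / y < 2 ^ n"] k by (auto simp: m_def)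
  thus ?thesis using that[of k] m assms by (auto simp: k field_simps)
qed

lemma boundary_layer_in_sets_disk_area:
  "{z \<in> unit_disk. 1 - cmod z \<le> t \<and> cmod (z - \<zeta>) \<le> x} \<in> sets disk_area"
proof (rule in_sets_disk_area)
  have "{z \<in> unit_disk. 1 - cmod z \<le> t \<and> cmod (z - \<zeta>) \<le> x} = unit_disk \<inter> {z. 1 - cmod z \<le> t} \<inter> {z. cmod (z - \<zeta>) \<le> x}"
    by auto
  also have "\<dots> \<in> sets borel"
    by (intro sets.Int borel_open[OF open_ball] borel_closed closed_Collect_le continuous_intros)
  finally show "{z \<in> unit_disk. 1 - cmod z \<le> t \<and> cmod (z - \<zeta>) \<le> x} \<in> sets borel" .
qed auto

text \<open>A layer of thickness t = x / 2^k has measure O(t x) and carries weight about t powr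
  \<alpha>. Its contribution x powr (\<alpha> + 2) times 2 powr (- k (\<alpha> + 1)) is summable in
  k because \<alpha> > -1.\<close>

lemma nn_integral_weight_near_boundary_point:
  fixes \<alpha> :: real
  assumes \<alpha>: "\<alpha> > -1"
  shows "\<exists>C>0. \<forall>\<zeta> x. cmod \<zeta> = 1 \<and> 0 < x \<longrightarrow>
    (\<integral>\<^sup>+z. ennreal ((1 - cmod z) powr \<alpha>) * indicator {z. cmod (z - \<zeta>) \<le> x} z \<partial>disk_area) \<le> ennreal (C * x powr (\<alpha> + 2))"
proof -
  define \<rho> where "\<rho> = 2 powr (- (\<alpha> + 1))"
  have \<rho>: "0 < \<rho>" "\<rho> < 1" using \<alpha> by (auto simp: \<rho>_def powr_less_one)
  define c where "c = 2 powr \<bar>\<alpha>\<bar> * 135"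
  have c: "c > 0" by (simp add: c_def)
  show ?thesis
  proof (intro exI[of _ "c / (1 - \<rho>)"] conjI allI impI)
    show "c / (1 - \<rho>) > 0" using c \<rho> by simp
    fix \<zeta> :: complex and x :: real assume "cmod \<zeta> = 1 \<and> 0 < x"
    hence \<zeta>: "cmod \<zeta> = 1" and x: "0 < x" by auto
    define t where "t = (\<lambda>k::nat. x / 2 ^ k)"
    \<comment> \<open>These layers are nested rather than disjoint; the overcounting does no harm to
      an upper bound.\<close>
    define A where "A = (\<lambda>k. {z \<in> unit_disk. 1 - cmod z \<le> t k \<and> cmod (z - \<zeta>) \<le> x})"
    have A: "A k \<in> sets disk_area" for k unfolding A_def by (rule boundary_layer_in_sets_disk_area)
    have t: "0 < t k" "t k \<le> x" for k using x by (auto simp: t_def field_simps)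
    have "(\<integral>\<^sup>+z. ennreal ((1 - cmod z) powr \<alpha>) * indicator {z. cmod (z - \<zeta>) \<le> x} z \<partial>disk_area) \<le>
      (\<integral>\<^sup>+z. (\<Sum>k. ennreal (2 powr \<bar>\<alpha>\<bar> * t k powr \<alpha>) * indicator (A k) z) \<partial>disk_area)"
    proof (rule nn_integral_mono)
      fix z assume "z \<in> space disk_area"
      hence z: "cmod z < 1" by simp
      show "ennreal ((1 - cmod z) powr \<alpha>) * indicator {z. cmod (z - \<zeta>) \<le> x} z \<le>
        (\<Sum>k. ennreal (2 powr \<bar>\<alpha>\<bar> * t k powr \<alpha>) * indicator (A k) z)"
      proof (cases "cmod (z - \<zeta>) \<le> x")
        case True
        have "1 - cmod z \<le> x" using norm_triangle_ineq2[of \<zeta> z] \<zeta> True by (simp add: norm_minus_commute)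
        then obtain k where k: "1 - cmod z \<le> t k" "t k < 2 * (1 - cmod z)"
          using dyadic_below[of "1 - cmod z" x] z unfolding t_def by auto
        have "(1 - cmod z) powr \<alpha> \<le> 2 powr \<bar>\<alpha>\<bar> * t k powr \<alpha>"
          using k z t[of k] by (intro powr_le_comparable) auto
        define F where "F = (\<lambda>k. ennreal (2 powr \<bar>\<alpha>\<bar> * t k powr \<alpha>) * indicator (A k) z)"
        have "ennreal ((1 - cmod z) powr \<alpha>) * indicator {z. cmod (z - \<zeta>) \<le> x} z \<le> F k"
          using \<open>_ \<le> 2 powr \<bar>\<alpha>\<bar> * t k powr \<alpha>\<close> True k z by (simp add: A_def F_def ennreal_leI)
        also have "F k = sum F {k}" by simp
        also have "\<dots> \<le> suminf F" by (intro sum_le_suminf summableI) auto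
        finally show ?thesis by (simp only: F_def)
      qed simp
    qed
    also have "\<dots> = (\<Sum>k. (\<integral>\<^sup>+z. ennreal (2 powr \<bar>\<alpha>\<bar> * t k powr \<alpha>) * indicator (A k) z \<partial>disk_area))"
      using A by (intro nn_integral_suminf) auto
    also have "\<dots> \<le> (\<Sum>k. ennreal (c * x powr (\<alpha> + 2) * \<rho> ^ k))"
    proof (intro suminf_le summableI)
      fix k
      have "(\<integral>\<^sup>+z. ennreal (2 powr \<bar>\<alpha>\<bar> * t k powr \<alpha>) * indicator (A k) z \<partial>disk_area) =
          ennreal (2 powr \<bar>\<alpha>\<bar> * t k powr \<alpha>) * emeasure disk_area (A k)"
        by (rule nn_integral_cmult_indicator[OF A])
      also have "\<dots> \<le> ennreal (2 powr \<bar>\<alpha>\<bar> * t k powr \<alpha>) * ennreal (135 * t k * x)"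
        unfolding A_def by (intro mult_left_mono emeasure_boundary_layer_le \<zeta> t) auto
      also have "\<dots> = ennreal (2 powr \<bar>\<alpha>\<bar> * t k powr \<alpha> * (135 * t k * x))"
        by (intro ennreal_mult[symmetric]) (use x t[of k] in auto)
      also have "2 powr \<bar>\<alpha>\<bar> * t k powr \<alpha> * (135 * t k * x) = c * x powr (\<alpha> + 2) * \<rho> ^ k"
      proof -
        have "t k powr \<alpha> * t k = t k powr (\<alpha> + 1)" using t[of k] by (simp add: powr_add)
        also have "\<dots> = x powr (\<alpha> + 1) * \<rho> ^ k"
        proof -
          have "t k = x * 2 powr (- real k)" by (simp add: t_def powr_minus_divide powr_realpow)
          hence "t k powr (\<alpha> + 1) = x powr (\<alpha> + 1) * (2 powr (- real k)) powr (\<alpha> + 1)" using x by (simp add: powr_mult)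
          also have "(2 powr (- real k)) powr (\<alpha> + 1) = (\<rho> powr real k)"
            by (simp add: \<rho>_def powr_powr algebra_simps)
          also have "\<rho> powr real k = \<rho> ^ k" using \<rho> by (simp add: powr_realpow)
          finally show ?thesis .
        qed
        finally have e1: "t k powr \<alpha> * t k = x powr (\<alpha> + 1) * \<rho> ^ k" .
        have "x powr (\<alpha> + 1 + 1) = x powr (\<alpha> + 1) * x" unfolding powr_add using x by simp
        hence "x powr (\<alpha> + 2) = x powr (\<alpha> + 1) * x" by (simp add: add.assoc)
        thus ?thesis using e1 by (simp add: c_def mult_ac)
      qed
      finally show "(\<integral>\<^sup>+z. ennreal (2 powr \<bar>\<alpha>\<bar> * t k powr \<alpha>) * indicator (A k) z \<partial>disk_area) \<le>
          ennreal (c * x powr (\<alpha> + 2) * \<rho> ^ k)" .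
    qed
    also have "\<dots> = ennreal (c * x powr (\<alpha> + 2) * (1 / (1 - \<rho>)))"
      using \<rho> c by (intro suminf_ennreal_eq sums_mult geometric_sums) auto
    finally show "(\<integral>\<^sup>+z. ennreal ((1 - cmod z) powr \<alpha>) * indicator {z. cmod (z - \<zeta>) \<le> x} z \<partial>disk_area) \<le>
        ennreal (c / (1 - \<rho>) * x powr (\<alpha> + 2))" by (simp add: mult_ac)
  qed
qed

abbreviation kernel_integral :: "real \<Rightarrow> real \<Rightarrow> real \<Rightarrow> complex \<Rightarrow> ennreal" where
  "kernel_integral \<alpha> b h \<zeta> \<equiv>
    \<integral>\<^sup>+z. ennreal ((1 - cmod z) powr \<alpha> * max h (cmod (z - \<zeta>)) powr (- b)) \<partial>disk_area"

text \<open>At distance about 2^(-j) from \<zeta> the kernel is about 2^(j b), and the weighted area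
  there is about 2^(- j (\<alpha> + 2)). The cap at h stops the sum at the first scale below h or
  any later \<open>J\<close>.\<close>

lemma nn_integral_kernel_le_sum:
  fixes \<alpha> b :: real
  assumes \<alpha>: "\<alpha> > -1" and b: "b \<ge> 0"
  shows "\<exists>C>0. \<forall>\<zeta> h J. cmod \<zeta> = 1 \<and> 0 < h \<and> h \<le> 2 \<and> 1 / 2 ^ J \<le> h \<longrightarrow>
    kernel_integral \<alpha> b h \<zeta> \<le>
    ennreal (C * (\<Sum>j\<le>J. (2 powr (b - \<alpha> - 2)) ^ j))"
proof -
  obtain C where C: "C > 0" "\<forall>\<zeta> x. cmod \<zeta> = 1 \<and> 0 < x \<longrightarrow>
    (\<integral>\<^sup>+z. ennreal ((1 - cmod z) powr \<alpha>) * indicator {z. cmod (z - \<zeta>) \<le> x} z \<partial>disk_area) \<le> ennreal (C * x powr (\<alpha> + 2))"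
    using nn_integral_weight_near_boundary_point[OF \<alpha>] by (elim exE conjE)
  show ?thesis
  proof (intro exI[of _ "C * 2 powr (\<alpha> + 2)"] conjI allI impI)
    show "C * 2 powr (\<alpha> + 2) > 0" using C by simp
    fix \<zeta> :: complex and h :: real and J :: nat
    assume "cmod \<zeta> = 1 \<and> 0 < h \<and> h \<le> 2 \<and> 1 / 2 ^ J \<le> h"
    hence \<zeta>: "cmod \<zeta> = 1" and h: "0 < h" "h \<le> 2" "1 / 2 ^ J \<le> h" by auto
    define x where "x = (\<lambda>j::nat. 2 / 2 ^ j :: real)"
    have tail_set [measurable]: "Measurable.pred disk_area (\<lambda>z. z \<in> {z. cmod (z - \<zeta>) \<le> r})" for r
      unfolding mem_Collect_eq by measurable
    have "kernel_integral \<alpha> b h \<zeta> \<le>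
      (\<integral>\<^sup>+z. (\<Sum>j\<le>J. ennreal ((2 ^ j) powr b) * (ennreal ((1 - cmod z) powr \<alpha>) * indicator {z. cmod (z - \<zeta>) \<le> x j} z)) \<partial>disk_area)"
    proof (rule nn_integral_mono)
      fix z assume "z \<in> space disk_area"
      hence z: "cmod z < 1" by simp
      define y where "y = max h (cmod (z - \<zeta>))"
      have "cmod (z - \<zeta>) \<le> 2" using norm_triangle_ineq4[of z \<zeta>] z \<zeta> by simp
      hence y: "0 < y" "y \<le> 2" using h by (auto simp: y_def)
      obtain j where j: "y \<le> x j" "x j < 2 * y" using dyadic_below[OF y] unfolding x_def by blast
      have lt: "1 / 2 ^ j < y" using j(2) by (simp add: x_def)
      have main: "ennreal ((1 - cmod z) powr \<alpha> * y powr (- b)) \<le>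
          ennreal ((2 ^ i) powr b) * (ennreal ((1 - cmod z) powr \<alpha>) * indicator {z. cmod (z - \<zeta>) \<le> x i} z)"
        if i: "1 / 2 ^ i \<le> y" "y \<le> x i" for i
      proof -
        have "y powr (- b) \<le> (1 / 2 ^ i) powr (- b)" using i y b by (intro powr_mono2') auto
        also have "\<dots> = (2 ^ i) powr b" by (simp add: powr_divide powr_minus_divide)
        finally have "(1 - cmod z) powr \<alpha> * y powr (- b) \<le> (2 ^ i) powr b * (1 - cmod z) powr \<alpha>"
          by (subst mult.commute) (intro mult_right_mono, auto)
        moreover have "cmod (z - \<zeta>) \<le> x i" using i(2) by (simp add: y_def)
        ultimately show ?thesis by (simp add: ennreal_leI flip: ennreal_mult)
      qed
      \<comment> \<open>The dyadic index of y may exceed J; then J itself serves, since y \<ge> h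
        \<ge> 1 / 2^J.\<close>
      have "\<exists>i\<le>J. 1 / 2 ^ i \<le> y \<and> y \<le> x i"
      proof (cases "j \<le> J")
        case True
        thus ?thesis using lt j(1) by (intro exI[of _ j]) auto
      next
        case False
        hence "x j \<le> x J" unfolding x_def by (intro divide_left_mono power_increasing) auto
        moreover have "1 / 2 ^ J \<le> y" using h(3) by (simp add: y_def)
        ultimately show ?thesis using j(1) by (intro exI[of _ J]) auto
      qed
      then obtain i where i: "i \<le> J" "1 / 2 ^ i \<le> y" "y \<le> x i" by blast
      have "ennreal ((1 - cmod z) powr \<alpha> * y powr (- b)) \<le>
          ennreal ((2 ^ i) powr b) * (ennreal ((1 - cmod z) powr \<alpha>) * indicator {z. cmod (z - \<zeta>) \<le> x i} z)"
        by (rule main[OF i(2,3)])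
      also have "\<dots> \<le> (\<Sum>j\<le>J. ennreal ((2 ^ j) powr b) * (ennreal ((1 - cmod z) powr \<alpha>) * indicator {z. cmod (z - \<zeta>) \<le> x j} z))"
        using i(1) by (intro member_le_sum) auto
      finally show "ennreal ((1 - cmod z) powr \<alpha> * max h (cmod (z - \<zeta>)) powr (- b)) \<le>
          (\<Sum>j\<le>J. ennreal ((2 ^ j) powr b) * (ennreal ((1 - cmod z) powr \<alpha>) * indicator {z. cmod (z - \<zeta>) \<le> x j} z))"
        by (simp add: y_def)
    qed
    also have "\<dots> = (\<Sum>j\<le>J. ennreal ((2 ^ j) powr b) * (\<integral>\<^sup>+z. ennreal ((1 - cmod z) powr \<alpha>) * indicator {z. cmod (z - \<zeta>) \<le> x j} z \<partial>disk_area))"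
      by (subst nn_integral_sum, measurable) (intro sum.cong refl nn_integral_cmult, measurable)
    also have "\<dots> \<le> (\<Sum>j\<le>J. ennreal (C * 2 powr (\<alpha> + 2) * (2 powr (b - \<alpha> - 2)) ^ j))"
    proof (rule sum_mono)
      fix j
      have xj: "x j > 0" by (simp add: x_def)
      have "ennreal ((2 ^ j) powr b) * (\<integral>\<^sup>+z. ennreal ((1 - cmod z) powr \<alpha>) * indicator {z. cmod (z - \<zeta>) \<le> x j} z \<partial>disk_area)
          \<le> ennreal ((2 ^ j) powr b) * ennreal (C * x j powr (\<alpha> + 2))"
        using C(2) \<zeta> xj by (intro mult_left_mono) auto
      also have "\<dots> = ennreal ((2 ^ j) powr b * (C * x j powr (\<alpha> + 2)))" using C(1) by (simp add: ennreal_mult)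
      also have "(2 ^ j) powr b * (C * x j powr (\<alpha> + 2)) = C * 2 powr (\<alpha> + 2) * (2 powr (b - \<alpha> - 2)) ^ j"
      proof -
        have "(2 ^ j :: real) = 2 powr real j" by (simp add: powr_realpow)
        hence e: "(2 ^ j) powr b = 2 powr (real j * b)" "x j powr (\<alpha> + 2) = 2 powr (\<alpha> + 2) * 2 powr (- (real j * (\<alpha> + 2)))"
          by (auto simp: x_def powr_powr powr_divide powr_minus_divide)
        have "(2 powr (b - \<alpha> - 2)) ^ j = 2 powr (real j * b + - (real j * (\<alpha> + 2)))"
          by (simp add: powr_realpow[symmetric] powr_powr algebra_simps)
        thus ?thesis unfolding e by (simp only: powr_add mult_ac)
      qed
      finally show "ennreal ((2 ^ j) powr b) * (\<integral>\<^sup>+z. ennreal ((1 - cmod z) powr \<alpha>) * indicator {z. cmod (z - \<zeta>) \<le> x j} z \<partial>disk_area)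
          \<le> ennreal (C * 2 powr (\<alpha> + 2) * (2 powr (b - \<alpha> - 2)) ^ j)" .
    qed
    also have "\<dots> = ennreal (C * 2 powr (\<alpha> + 2) * (\<Sum>j\<le>J. (2 powr (b - \<alpha> - 2)) ^ j))"
      using C(1) by (subst sum_ennreal) (auto simp: sum_distrib_left)
    finally show "kernel_integral \<alpha> b h \<zeta> \<le>
        ennreal (C * 2 powr (\<alpha> + 2) * (\<Sum>j\<le>J. (2 powr (b - \<alpha> - 2)) ^ j))" .
  qed
qed

lemma ex_dyadic_scale:
  fixes h :: real
  assumes "0 < h" "h \<le> 1"
  obtains J :: nat where "1 / 2 ^ J \<le> h" "2 ^ J \<le> 2 / h"
proof -
  obtain k where "h \<le> 1 / 2 ^ k" "1 / 2 ^ k < 2 * h" using dyadic_below[OF assms] .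
  thus ?thesis using that[of "Suc k"] assms by (auto simp: field_simps)
qed

text \<open>For b > \<alpha> + 2 the geometric sum is dominated by its last term, taken at the scale
  2^(-J) comparable to h.\<close>

lemma nn_integral_kernel_power:
  fixes \<alpha> b :: real
  assumes \<alpha>: "\<alpha> > -1" and b: "b > \<alpha> + 2"
  shows "\<exists>C>0. \<forall>\<zeta> h. cmod \<zeta> = 1 \<and> 0 < h \<and> h \<le> 1 \<longrightarrow>
    kernel_integral \<alpha> b h \<zeta> \<le> ennreal (C * h powr (\<alpha> + 2 - b))"
proof -
  have b0: "b \<ge> 0" using \<alpha> b by simp
  obtain C where C: "C > 0" "\<forall>\<zeta> h J. cmod \<zeta> = 1 \<and> 0 < h \<and> h \<le> 2 \<and> 1 / 2 ^ J \<le> h \<longrightarrow>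
    kernel_integral \<alpha> b h \<zeta> \<le>
    ennreal (C * (\<Sum>j\<le>J. (2 powr (b - \<alpha> - 2)) ^ j))"
    using nn_integral_kernel_le_sum[OF \<alpha> b0] by (elim exE conjE)
  define \<gamma> where "\<gamma> = b - \<alpha> - 2"
  have \<gamma>: "\<gamma> > 0" using b by (simp add: \<gamma>_def)
  define \<rho> where "\<rho> = 2 powr \<gamma>"
  have \<rho>: "\<rho> > 1" using \<gamma> by (simp add: \<rho>_def)
  define C' where "C' = C * (\<rho> * \<rho> / (\<rho> - 1))"
  show ?thesis
  proof (intro exI[of _ C'] conjI allI impI)
    show "C' > 0" using C \<rho> by (simp add: C'_def)
    fix \<zeta> :: complex and h :: real
    assume "cmod \<zeta> = 1 \<and> 0 < h \<and> h \<le> 1"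
    hence \<zeta>: "cmod \<zeta> = 1" and h: "0 < h" "h \<le> 1" by auto
    obtain J where J: "1 / 2 ^ J \<le> h" "2 ^ J \<le> 2 / h" using ex_dyadic_scale[OF h] .
    have "kernel_integral \<alpha> b h \<zeta> \<le>
        ennreal (C * (\<Sum>j\<le>J. \<rho> ^ j))"
      using C(2) \<zeta> h J unfolding \<rho>_def \<gamma>_def by auto
    also have "\<dots> \<le> ennreal (C' * h powr (\<alpha> + 2 - b))"
    proof (rule ennreal_leI)
      have "\<rho> ^ J = (2 ^ J) powr \<gamma>"
        by (simp add: \<rho>_def powr_realpow[symmetric] powr_powr mult.commute)
      also have "\<dots> \<le> (2 / h) powr \<gamma>" using J \<gamma> by (intro powr_mono2) auto
      also have "(2 / h) powr \<gamma> = \<rho> * h powr (\<alpha> + 2 - b)"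
      proof -
        have "\<alpha> + 2 - b = - \<gamma>" by (simp add: \<gamma>_def)
        thus ?thesis by (simp add: powr_divide powr_minus_divide \<rho>_def)
      qed
      finally have le: "\<rho> ^ J \<le> \<rho> * h powr (\<alpha> + 2 - b)" .
      have "(\<Sum>j\<le>J. \<rho> ^ j) = (\<rho> ^ Suc J - 1) / (\<rho> - 1)"
        using \<rho> geometric_sum[of \<rho> "Suc J"] by (simp add: lessThan_Suc_atMost)
      also have "\<dots> \<le> \<rho> / (\<rho> - 1) * \<rho> ^ J" using \<rho> by (simp add: divide_right_mono)
      also have "\<dots> \<le> \<rho> / (\<rho> - 1) * (\<rho> * h powr (\<alpha> + 2 - b))" using \<rho> le by (intro mult_left_mono) auto
      finally have "(\<Sum>j\<le>J. \<rho> ^ j) \<le> \<rho> / (\<rho> - 1) * (\<rho> * h powr (\<alpha> + 2 - b))" .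
      hence "C * (\<Sum>j\<le>J. \<rho> ^ j) \<le> C * (\<rho> / (\<rho> - 1) * (\<rho> * h powr (\<alpha> + 2 - b)))"
        using C(1) by (intro mult_left_mono) auto
      thus "C * (\<Sum>j\<le>J. \<rho> ^ j) \<le> C' * h powr (\<alpha> + 2 - b)" by (simp add: C'_def mult_ac)
    qed
    finally show "kernel_integral \<alpha> b h \<zeta> \<le> ennreal (C' * h powr (\<alpha> + 2 - b))" .
  qed
qed

text \<open>For b = \<alpha> + 2 all scales contribute equally, and there are J + 1 of them. The
  bound h \<le> 1 / 4 gives 2 ln 2 \<le> ln (1 / h), which absorbs the additive constants of the
  count.\<close>

lemma nn_integral_kernel_log:
  fixes \<alpha> :: real
  assumes \<alpha>: "\<alpha> > -1"
  shows "\<exists>C>0. \<forall>\<zeta> h. cmod \<zeta> = 1 \<and> 0 < h \<and> h \<le> 1 / 4 \<longrightarrow>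
    kernel_integral \<alpha> (\<alpha> + 2) h \<zeta> \<le> ennreal (C * ln (1 / h))"
proof -
  have b0: "\<alpha> + 2 \<ge> 0" using \<alpha> by simp
  obtain C where C: "C > 0" "\<forall>\<zeta> h J. cmod \<zeta> = 1 \<and> 0 < h \<and> h \<le> 2 \<and> 1 / 2 ^ J \<le> h \<longrightarrow>
    kernel_integral \<alpha> (\<alpha> + 2) h \<zeta> \<le>
    ennreal (C * (\<Sum>j\<le>J. (2 powr (\<alpha> + 2 - \<alpha> - 2)) ^ j))"
    using nn_integral_kernel_le_sum[OF \<alpha> b0] by (elim exE conjE)
  show ?thesis
  proof (intro exI[of _ "C * (2 / ln 2)"] conjI allI impI)
    show "C * (2 / ln 2) > 0" using C by simp
    fix \<zeta> :: complex and h :: real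
    assume "cmod \<zeta> = 1 \<and> 0 < h \<and> h \<le> 1 / 4"
    hence \<zeta>: "cmod \<zeta> = 1" and h: "0 < h" "h \<le> 1 / 4" by auto
    obtain J where J: "1 / 2 ^ J \<le> h" "2 ^ J \<le> 2 / h" using ex_dyadic_scale[of h] h by auto
    have "kernel_integral \<alpha> (\<alpha> + 2) h \<zeta> \<le>
        ennreal (C * (\<Sum>j\<le>J. (2 powr (\<alpha> + 2 - \<alpha> - 2)) ^ j))"
      using C(2) \<zeta> h J by auto
    also have "\<dots> \<le> ennreal (C * (2 / ln 2) * ln (1 / h))"
    proof (rule ennreal_leI)
      have l2: "ln (2 :: real) > 0" by simp
      have "ln (2 ^ J) \<le> ln (2 / h)" using J h by (subst ln_le_cancel_iff) auto
      hence "real J * ln 2 \<le> ln 2 + ln (1 / h)" using h by (simp add: ln_realpow ln_div)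
      moreover have "ln 4 \<le> ln (1 / h)" using h by (subst ln_le_cancel_iff) (auto simp: field_simps)
      hence "2 * ln 2 \<le> ln (1 / h)" using ln_realpow[of 2 2] by simp
      ultimately have "(real J + 1) * ln 2 \<le> 2 * ln (1 / h)" by (simp add: algebra_simps)
      hence "real J + 1 \<le> 2 / ln 2 * ln (1 / h)" using l2 by (simp add: field_simps)
      hence "C * (real J + 1) \<le> C * (2 / ln 2 * ln (1 / h))" using C(1) by (intro mult_left_mono) auto
      thus "C * (\<Sum>j\<le>J. (2 powr (\<alpha> + 2 - \<alpha> - 2)) ^ j) \<le> C * (2 / ln 2) * ln (1 / h)"
        by (simp add: add.commute mult.assoc)
    qed
    finally show "kernel_integral \<alpha> (\<alpha> + 2) h \<zeta> \<le> ennreal (C * (2 / ln 2) * ln (1 / h))" .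
  qed
qed

section \<open>Concentrating test functions\<close>

text \<open>The denominator of a Cauchy kernel whose pole \<zeta> / (1 - h) lies at distance h / (1
  - h) outside the disk.\<close>

abbreviation cauchy_factor :: "complex \<Rightarrow> real \<Rightarrow> complex \<Rightarrow> complex" where
  "cauchy_factor \<zeta> h z \<equiv> 1 - of_real (1 - h) * cnj \<zeta> * z"

text \<open>With w = (1 - h) \<open>cnj \<zeta> * z\<close>, the bound 1 - cmod w \<le> cmod (1 - w)
  gives both h and 1 - cmod z as lower bounds. The factor has positive real part, so its powers and
  its principal logarithm are analytic.\<close>

lemma cauchy_kernel_lower_bounds:
  assumes "cmod \<zeta> = 1" "0 < h" "h < 1" "cmod z < 1"
  shows "max h (cmod (z - \<zeta>)) \<le> 2 * cmod (cauchy_factor \<zeta> h z)"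
    "1 - cmod z \<le> cmod (cauchy_factor \<zeta> h z)"
    "cmod (cauchy_factor \<zeta> h z) \<le> 2"
    "cauchy_factor \<zeta> h z \<notin> \<real>\<^sub>\<le>\<^sub>0"
proof -
  define w where "w = of_real (1 - h) * cnj \<zeta> * z"
  have w: "cmod w = (1 - h) * cmod z"
  proof -
    have "cmod w = \<bar>1 - h\<bar> * cmod z" unfolding w_def norm_mult norm_of_real complex_mod_cnj using assms by simp
    thus ?thesis using assms by simp
  qed
  have "cmod w \<le> (1 - h) * 1" unfolding w using assms by (intro mult_left_mono) auto
  hence "h \<le> 1 - cmod w" by simp
  moreover have "cmod w \<le> 1 * cmod z" unfolding w using assms by (intro mult_right_mono) auto
  hence "1 - cmod z \<le> 1 - cmod w" by simp
  moreover have "1 - cmod w \<le> cmod (1 - w)" using norm_triangle_ineq2[of 1 w] by simp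
  ultimately have lower: "h \<le> cmod (1 - w)" "1 - cmod z \<le> cmod (1 - w)" by (blast intro: order_trans)+
  show "1 - cmod z \<le> cmod (cauchy_factor \<zeta> h z)" using lower(2) by (simp add: w_def)
  show "cmod (cauchy_factor \<zeta> h z) \<le> 2"
    using norm_triangle_ineq4[of 1 w] \<open>cmod w \<le> 1 * cmod z\<close> assms by (simp add: w_def)
  have "\<zeta> * cnj \<zeta> = 1" using assms by (simp add: complex_norm_square[symmetric])
  moreover have "\<zeta> * (1 - w) = \<zeta> - of_real (1 - h) * (\<zeta> * cnj \<zeta>) * z" by (simp add: w_def algebra_simps)
  \<comment> \<open>This identity compares with the distance to \<zeta>: cmod (z - \<zeta>) \<le>
    cmod (1 - w) + h, and h is already bounded by cmod (1 - w).\<close>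
  ultimately have "\<zeta> * (1 - w) = (\<zeta> - z) + of_real h * z" by (simp add: algebra_simps)
  hence "cmod (\<zeta> - z) \<le> cmod (\<zeta> * (1 - w)) + cmod (of_real h * z)"
    using norm_triangle_ineq4[of "\<zeta> * (1 - w)" "of_real h * z"] by simp
  also have "cmod (\<zeta> * (1 - w)) = cmod (1 - w)" using assms by (simp add: norm_mult)
  also have "cmod (of_real h * z) \<le> h * 1"
    unfolding norm_mult using assms by (intro mult_mono) auto
  finally have "cmod (z - \<zeta>) \<le> 2 * cmod (1 - w)" using lower(1) by (simp add: norm_minus_commute)
  moreover have "h \<le> 2 * cmod (1 - w)" using lower(1) assms(2) by linarith
  ultimately show "max h (cmod (z - \<zeta>)) \<le> 2 * cmod (cauchy_factor \<zeta> h z)"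
    unfolding w_def[symmetric] by (rule max.boundedI[rotated])
  have "Re w \<le> cmod w" by (rule complex_Re_le_cmod)
  hence "Re (1 - w) > 0" using \<open>cmod w \<le> (1 - h) * 1\<close> assms by simp
  thus "cauchy_factor \<zeta> h z \<notin> \<real>\<^sub>\<le>\<^sub>0" unfolding w_def[symmetric] by (auto simp: complex_nonpos_Reals_iff)
qed

lemma disk_weight_le:
  assumes "cmod z < 1"
  shows "(1 - (cmod z)\<^sup>2) powr \<alpha> \<le> 2 powr \<bar>\<alpha>\<bar> * (1 - cmod z) powr \<alpha>"
proof (rule powr_le_comparable)
  have e: "1 - (cmod z)\<^sup>2 = (1 - cmod z) * (1 + cmod z)" by (rule one_minus_cmod_sq)
  show "1 - (cmod z)\<^sup>2 \<le> 2 * (1 - cmod z)" unfolding e using assms mult_left_mono[of "1 + cmod z" 2 "1 - cmod z"] by simp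
  have "1 - cmod z \<le> 1 - (cmod z)\<^sup>2" unfolding e using assms mult_left_mono[of 1 "1 + cmod z" "1 - cmod z"] by simp
  thus "1 - cmod z \<le> 2 * (1 - (cmod z)\<^sup>2)" "1 - (cmod z)\<^sup>2 > 0" using assms by auto
qed (use assms in auto)

text \<open>The factor 2 powr b comes from replacing the Cauchy factor by
  \<open>max h (cmod (z - \<zeta>))\<close>, and 2 powr \<bar>\<alpha>\<bar> from replacing 1 -
  (cmod z)^2 by 1 - cmod z.\<close>

lemma dirichlet_energy_cauchy_kernel_le:
  fixes \<alpha> p b A :: real
  assumes p: "p > 0" and b: "b \<ge> 0" and A: "A \<ge> 0" and \<zeta>: "cmod \<zeta> = 1" and h: "0 < h" "h < 1"
    and d: "\<And>z. z \<in> unit_disk \<Longrightarrow> cmod (deriv f z) powr p \<le> A * cmod (cauchy_factor \<zeta> h z) powr (- b)"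
  shows "dirichlet_energy \<alpha> p f \<le> ennreal (A * 2 powr b * 2 powr \<bar>\<alpha>\<bar>) *
    kernel_integral \<alpha> b h \<zeta>"
proof -
  have "dirichlet_energy \<alpha> p f \<le> (\<integral>\<^sup>+z. ennreal (A * 2 powr b * 2 powr \<bar>\<alpha>\<bar>) *
      ennreal ((1 - cmod z) powr \<alpha> * max h (cmod (z - \<zeta>)) powr (- b)) \<partial>disk_area)"
    unfolding dirichlet_energy_def
  proof (rule nn_integral_mono)
    fix z assume "z \<in> space disk_area"
    hence z: "z \<in> unit_disk" "cmod z < 1" by auto
    define m where "m = max h (cmod (z - \<zeta>))"
    have m: "m > 0" using h by (simp add: m_def)
    have "cmod (cauchy_factor \<zeta> h z) powr (- b) \<le> (m / 2) powr (- b)"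
      using cauchy_kernel_lower_bounds(1)[OF \<zeta> h z(2)] m b unfolding m_def[symmetric] by (intro powr_mono2') auto
    also have "\<dots> = 2 powr b * m powr (- b)" using m by (simp add: powr_divide powr_minus_divide)
    finally have "cmod (deriv f z) powr p \<le> A * (2 powr b * m powr (- b))"
      using d[OF z(1)] A mult_left_mono order_trans by blast
    hence "dirichlet_density \<alpha> p f z \<le> (A * (2 powr b * m powr (- b))) * (2 powr \<bar>\<alpha>\<bar> * (1 - cmod z) powr \<alpha>)"
      unfolding dirichlet_density_def using disk_weight_le[OF z(2), of \<alpha>] A by (intro mult_mono) auto
    hence "ennreal (dirichlet_density \<alpha> p f z) \<le> ennreal ((A * 2 powr b * 2 powr \<bar>\<alpha>\<bar>) * ((1 - cmod z) powr \<alpha> * m powr (- b)))"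
      by (intro ennreal_leI) (simp add: mult_ac)
    thus "ennreal (dirichlet_density \<alpha> p f z) \<le> ennreal (A * 2 powr b * 2 powr \<bar>\<alpha>\<bar>) *
        ennreal ((1 - cmod z) powr \<alpha> * max h (cmod (z - \<zeta>)) powr (- b))"
      using A by (simp add: ennreal_mult' m_def)
  qed
  also have "\<dots> = ennreal (A * 2 powr b * 2 powr \<bar>\<alpha>\<bar>) *
    kernel_integral \<alpha> b h \<zeta>"
    using borel_measurable_cmod_disk_area by (intro nn_integral_cmult) measurable
  finally show ?thesis .
qed

text \<open>The threshold 1 / 81 amounts to (9 h)^2 \<le> h, which in the logarithmic family turns a
  Cauchy factor of size 9 h into half of the full logarithm. The 9 is the size of that factor on a
  Carleson square of side h.\<close>

abbreviation small_scale :: "complex \<Rightarrow> real \<Rightarrow> bool" where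
  "small_scale \<zeta> h \<equiv> cmod \<zeta> = 1 \<and> 0 < h \<and> h \<le> 1 / 81"

text \<open>\<open>F \<zeta> h\<close> lives near the boundary point \<open>\<zeta>\<close> at scale \<open>h\<close>; there \<open>\<Lambda> h\<close> is the size forced by the growth bound.\<close>

definition concentrating_family :: "real \<Rightarrow> real \<Rightarrow> (real \<Rightarrow> real) \<Rightarrow> (complex \<Rightarrow> real \<Rightarrow> complex \<Rightarrow> complex) \<Rightarrow> bool" where
  "concentrating_family \<alpha> p \<Lambda> F \<longleftrightarrow>
    (\<exists>M. \<forall>\<zeta> h. small_scale \<zeta> h \<longrightarrow> F \<zeta> h \<in> dirichlet_space \<alpha> p \<and> dirichlet_norm \<alpha> p (F \<zeta> h) \<le> M) \<and>
    (\<exists>c>0. \<forall>\<zeta> h z. small_scale \<zeta> h \<and> cmod z < 1 \<and> cmod (cauchy_factor \<zeta> h z) \<le> 9 * h \<longrightarrow>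
      c * \<Lambda> h \<le> cmod (F \<zeta> h z)) \<and>
    (\<forall>z. cmod z < 1 \<longrightarrow> (\<exists>B. \<exists>\<epsilon>. (\<epsilon> \<longlongrightarrow> 0) (at_right 0) \<and>
      (\<forall>\<zeta> h. small_scale \<zeta> h \<longrightarrow> cmod (F \<zeta> h z) \<le> \<epsilon> h * B)))"

text \<open>A power N of the Cauchy kernel, scaled by h powr (N - \<tau>) to have energy bounded
  independently of h; on the square it has size h powr (-\<tau>).\<close>

lemma concentrating_family_power:
  fixes \<alpha> p :: real
  assumes \<alpha>: "\<alpha> > -1" and p: "p > 0" "p < \<alpha> + 2"
  shows "\<exists>F. concentrating_family \<alpha> p (\<lambda>h. h powr (- (\<alpha> + 2 - p) / p)) F"
proof -
  define \<tau> where "\<tau> = (\<alpha> + 2 - p) / p"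
  have \<tau>: "\<tau> > 0" "p * \<tau> = \<alpha> + 2 - p" using p by (auto simp: \<tau>_def)
  \<comment> \<open>N > \<tau> is used twice: it makes b = p (N + 1) exceed \<alpha> + 2, so that
    the kernel integral is a power of h, and it makes h powr (N - \<tau>) tend to 0.\<close>
  obtain N where N: "\<tau> < real N" using reals_Archimedean2 by blast
  define F where "F = (\<lambda>\<zeta> h z. if z \<in> unit_disk then of_real (h powr (real N - \<tau>)) / cauchy_factor \<zeta> h z ^ N else 0)"
  define b where "b = p * (real N + 1)"
  have "p * \<tau> < p * real N" using N p by simp
  hence b: "b > \<alpha> + 2" using \<tau> by (simp add: b_def algebra_simps)
  have b0: "b \<ge> 0" using b \<alpha> by simp
  obtain C where C: "C > 0" "\<forall>\<zeta> h. cmod \<zeta> = 1 \<and> 0 < h \<and> h \<le> 1 \<longrightarrow>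
    kernel_integral \<alpha> b h \<zeta> \<le> ennreal (C * h powr (\<alpha> + 2 - b))"
    using nn_integral_kernel_power[OF \<alpha> b] by (elim exE conjE)
  define E where "E = real N powr p * 2 powr b * 2 powr \<bar>\<alpha>\<bar> * C"
  have F_eq: "F \<zeta> h z = of_real (h powr (real N - \<tau>)) / cauchy_factor \<zeta> h z ^ N" if "z \<in> unit_disk" for \<zeta> h z
    using that by (simp add: F_def)
  have bounded: "F \<zeta> h \<in> dirichlet_space \<alpha> p \<and> dirichlet_norm \<alpha> p (F \<zeta> h) \<le> (1 powr p + E) powr (1 / p)"
    if \<zeta>: "cmod \<zeta> = 1" and h: "0 < h" "h < 1" for \<zeta> h
  proof -
    define a where "a = of_real (1 - h) * cnj \<zeta>"
    have a: "cmod a \<le> 1"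
    proof -
      have "cmod a = \<bar>1 - h\<bar>" unfolding a_def norm_mult norm_of_real complex_mod_cnj using \<zeta> by simp
      thus ?thesis using h by simp
    qed
    have nz: "1 - a * z \<noteq> 0" if "z \<in> unit_disk" for z
      using cauchy_kernel_lower_bounds(4)[OF \<zeta> h, of z] that by (auto simp: a_def)
    have der: "(F \<zeta> h has_field_derivative of_real (h powr (real N - \<tau>)) * (real N * a / (1 - a * z) ^ (N + 1))) (at z)"
      if z: "z \<in> unit_disk" for z
    proof -
      define X where "X = 1 - a * z"
      have X: "X \<noteq> 0" using nz[OF z] by (simp add: X_def)
      obtain n where n: "N = Suc n" using N \<tau>(1) by (cases N) auto
      have "((\<lambda>z. 1 - a * z) has_field_derivative - a) (at z)" by (auto intro!: derivative_eq_intros)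
      hence "((\<lambda>z. (1 - a * z) ^ N) has_field_derivative of_nat N * (- a * X ^ n)) (at z)"
        using DERIV_power[of "\<lambda>z. 1 - a * z" "- a" z UNIV N] by (simp add: n X_def)
      hence "((\<lambda>z. inverse ((1 - a * z) ^ N)) has_field_derivative
          - (inverse (X ^ N) * (of_nat N * (- a * X ^ n)) * inverse (X ^ N))) (at z)"
        using X unfolding X_def by (intro DERIV_inverse') auto
      moreover have "- (inverse (X ^ N) * (of_nat N * (- a * X ^ n)) * inverse (X ^ N)) = real N * a / X ^ (N + 1)"
        using X by (simp add: n divide_simps)
      ultimately have "((\<lambda>z. of_real (h powr (real N - \<tau>)) * inverse ((1 - a * z) ^ N)) has_field_derivative
          of_real (h powr (real N - \<tau>)) * (real N * a / (1 - a * z) ^ (N + 1))) (at z)"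
        unfolding X_def by (intro DERIV_cmult) simp
      thus ?thesis
        by (rule has_field_derivative_transform_within_open[OF _ open_ball z]) (simp add: F_eq a_def divide_inverse)
    qed
    have Fd: "F \<zeta> h \<in> disk_analytic"
    proof -
      have "F \<zeta> h holomorphic_on unit_disk" unfolding holomorphic_on_open[OF open_ball] using der by blast
      thus ?thesis by (auto simp: disk_analytic_def F_def)
    qed
    have "dirichlet_energy \<alpha> p (F \<zeta> h) \<le> ennreal (((h powr (real N - \<tau>)) powr p * real N powr p) * 2 powr b * 2 powr \<bar>\<alpha>\<bar>) *
      kernel_integral \<alpha> b h \<zeta>"
    proof (rule dirichlet_energy_cauchy_kernel_le[OF p(1) b0 _ \<zeta> h])
      fix z assume z: "z \<in> unit_disk"
      define y where "y = cmod (1 - a * z)"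
      have y: "y > 0" using nz[OF z] by (simp add: y_def)
      have "cmod (deriv (F \<zeta> h) z) = h powr (real N - \<tau>) * (real N * cmod a / y ^ (N + 1))"
        unfolding DERIV_imp_deriv[OF der[OF z]] norm_mult norm_divide norm_power y_def by simp
      also have "\<dots> \<le> h powr (real N - \<tau>) * (real N * 1 / y ^ (N + 1))"
        using a y by (intro mult_left_mono divide_right_mono) auto
      finally have "cmod (deriv (F \<zeta> h) z) powr p \<le> (h powr (real N - \<tau>) * (real N / y ^ (N + 1))) powr p"
        using p by (intro powr_mono2) auto
      also have "\<dots> = (h powr (real N - \<tau>)) powr p * real N powr p * (y powr real (N + 1)) powr (- p)"
      proof -
        have "y ^ (N + 1) = y powr real (N + 1)" using y by (simp only: powr_realpow)
        thus ?thesis by (simp only: powr_mult powr_divide powr_minus_divide) simp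
      qed
      also have "(y powr real (N + 1)) powr (- p) = y powr (- b)" by (simp add: powr_powr b_def algebra_simps)
      finally show "cmod (deriv (F \<zeta> h) z) powr p \<le>
          (h powr (real N - \<tau>)) powr p * real N powr p * cmod (cauchy_factor \<zeta> h z) powr (- b)"
        by (simp add: y_def a_def)
    qed simp
    also have "\<dots> \<le> ennreal (((h powr (real N - \<tau>)) powr p * real N powr p) * 2 powr b * 2 powr \<bar>\<alpha>\<bar>) * ennreal (C * h powr (\<alpha> + 2 - b))"
      using C(2) \<zeta> h by (intro mult_left_mono) auto
    also have "\<dots> = ennreal E"
    proof -
      have "(real N - \<tau>) * p + (\<alpha> + 2 - b) = 0" using \<tau>(2) by (simp add: b_def algebra_simps)
      hence "(h powr (real N - \<tau>)) powr p * h powr (\<alpha> + 2 - b) = 1"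
        using h unfolding powr_powr powr_add[symmetric] by simp
      hence "((h powr (real N - \<tau>)) powr p * real N powr p) * 2 powr b * 2 powr \<bar>\<alpha>\<bar> * (C * h powr (\<alpha> + 2 - b)) = E"
        by (simp add: E_def)
      thus ?thesis using C(1) by (subst ennreal_mult[symmetric]) auto
    qed
    finally have en: "dirichlet_energy \<alpha> p (F \<zeta> h) \<le> ennreal E" .
    have "h powr (real N - \<tau>) \<le> h powr 0" using h N by (intro powr_mono') auto
    hence "cmod (F \<zeta> h 0) \<le> 1" using h by (simp add: F_eq)
    hence "dirichlet_norm \<alpha> p (F \<zeta> h) \<le> (1 powr p + E) powr (1 / p)"
      using en C p by (intro dirichlet_norm_leI Fd) (auto simp: E_def)
    thus ?thesis using Fd order.strict_trans1[OF en ennreal_less_top] by (simp add: dirichlet_space_iff)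
  qed
  have A: "\<exists>M. \<forall>\<zeta> h. small_scale \<zeta> h \<longrightarrow> F \<zeta> h \<in> dirichlet_space \<alpha> p \<and> dirichlet_norm \<alpha> p (F \<zeta> h) \<le> M"
    by (rule exI[of _ "(1 powr p + E) powr (1 / p)"]) (use bounded in auto)
  have B: "\<exists>c>0. \<forall>\<zeta> h z. small_scale \<zeta> h \<and> cmod z < 1 \<and> cmod (cauchy_factor \<zeta> h z) \<le> 9 * h \<longrightarrow>
      c * h powr (- \<tau>) \<le> cmod (F \<zeta> h z)"
    proof (intro exI[of _ "1 / 9 ^ N"] conjI allI impI)
      fix \<zeta> z :: complex and h :: real
      assume H: "small_scale \<zeta> h \<and> cmod z < 1 \<and> cmod (cauchy_factor \<zeta> h z) \<le> 9 * h"
      define y where "y = cmod (cauchy_factor \<zeta> h z)"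
      have y: "0 < y" "y \<le> 9 * h" using cauchy_kernel_lower_bounds(2)[of \<zeta> h z] H by (auto simp: y_def)
      have "1 / 9 ^ N * h powr (- \<tau>) = h powr (real N - \<tau>) / (9 * h) ^ N"
        using H by (simp add: powr_diff powr_minus_divide powr_realpow power_mult_distrib)
      also have "\<dots> \<le> h powr (real N - \<tau>) / y ^ N" using y H by (intro divide_left_mono power_mono mult_pos_pos) auto
      also have "\<dots> = cmod (F \<zeta> h z)" using H by (simp add: F_eq norm_divide norm_power y_def)
      finally show "1 / 9 ^ N * h powr (- \<tau>) \<le> cmod (F \<zeta> h z)" .
    qed simp
  have D: "\<exists>B \<epsilon>. (\<epsilon> \<longlongrightarrow> 0) (at_right 0) \<and> (\<forall>\<zeta> h. small_scale \<zeta> h \<longrightarrow> cmod (F \<zeta> h z) \<le> \<epsilon> h * B)"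
    if z: "cmod z < 1" for z
    proof (intro exI[of _ "1 / (1 - cmod z) ^ N"] exI[of _ "\<lambda>h. h powr (real N - \<tau>)"] conjI allI impI)
      have "((\<lambda>h. h powr (real N - \<tau>)) \<longlongrightarrow> 0 powr (real N - \<tau>)) (at_right 0)"
        using N by (intro tendsto_powr' tendsto_ident_at tendsto_const) (auto simp: eventually_at_filter)
      thus "((\<lambda>h::real. h powr (real N - \<tau>)) \<longlongrightarrow> 0) (at_right 0)" by simp
      fix \<zeta> :: complex and h :: real assume H: "small_scale \<zeta> h"
      have "1 - cmod z \<le> cmod (cauchy_factor \<zeta> h z)" using cauchy_kernel_lower_bounds(2)[of \<zeta> h z] H z by auto
      hence "h powr (real N - \<tau>) / cmod (cauchy_factor \<zeta> h z) ^ N \<le> h powr (real N - \<tau>) / (1 - cmod z) ^ N"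
        using z by (intro divide_left_mono power_mono mult_pos_pos zero_less_power) auto
      thus "cmod (F \<zeta> h z) \<le> h powr (real N - \<tau>) * (1 / (1 - cmod z) ^ N)"
        using z by (simp add: F_eq norm_divide norm_power)
    qed
  have "concentrating_family \<alpha> p (\<lambda>h. h powr (- \<tau>)) F"
    unfolding concentrating_family_def by (intro conjI allI impI A B D)
  moreover have "- \<tau> = - (\<alpha> + 2 - p) / p" by (simp only: \<tau>_def minus_divide_left)
  ultimately show ?thesis by metis
qed

text \<open>The energy of the logarithm of the Cauchy factor is at most of order L = ln (1 / h), so
  it is normalised by L powr (- 1 / p). On the square it is at least L / 2 before normalisation,
  hence of order L powr (1 - 1 / p) afterwards; at a fixed point it stays bounded, and the
  normalisation tends to 0.\<close>

lemma concentrating_family_log: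
  fixes p :: real
  assumes p: "p > 1"
  shows "\<exists>F. concentrating_family (p - 2) p (\<lambda>h. ln (1 / h) powr (1 - 1 / p)) F"
proof -
  define L where "L = (\<lambda>h::real. ln (1 / h))"
  define F where "F = (\<lambda>\<zeta> h z. if z \<in> unit_disk then of_real (L h powr (- 1 / p)) * Ln (cauchy_factor \<zeta> h z) else 0)"
  have F_eq: "F \<zeta> h z = of_real (L h powr (- 1 / p)) * Ln (cauchy_factor \<zeta> h z)" if "z \<in> unit_disk" for \<zeta> h z
    using that by (simp add: F_def)
  have Lpos: "L h > 0" if "0 < h" "h \<le> 1 / 81" for h using that by (simp add: L_def)
  have p2: "p - 2 > -1" using p by simp
  obtain C where C: "C > 0" "\<forall>\<zeta> h. cmod \<zeta> = 1 \<and> 0 < h \<and> h \<le> 1 / 4 \<longrightarrow>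
    kernel_integral (p - 2) (p - 2 + 2) h \<zeta> \<le> ennreal (C * ln (1 / h))"
    using nn_integral_kernel_log[OF p2] by (elim exE conjE)
  define E where "E = 2 powr (p - 2 + 2) * 2 powr \<bar>p - 2\<bar> * C"
  have bounded: "F \<zeta> h \<in> dirichlet_space (p - 2) p \<and> dirichlet_norm (p - 2) p (F \<zeta> h) \<le> (0 powr p + E) powr (1 / p)"
    if \<zeta>: "cmod \<zeta> = 1" and h: "0 < h" "h \<le> 1 / 81" for \<zeta> h
  proof -
    have h1: "h < 1" using h by simp
    define a where "a = of_real (1 - h) * cnj \<zeta>"
    have a: "cmod a \<le> 1"
    proof -
      have "cmod a = \<bar>1 - h\<bar>" unfolding a_def norm_mult norm_of_real complex_mod_cnj using \<zeta> by simp
      thus ?thesis using h by simp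
    qed
    have nn: "1 - a * z \<notin> \<real>\<^sub>\<le>\<^sub>0" if "z \<in> unit_disk" for z
      using cauchy_kernel_lower_bounds(4)[OF \<zeta> h(1) h1, of z] that by (auto simp: a_def)
    hence nz: "1 - a * z \<noteq> 0" if "z \<in> unit_disk" for z using that by force
    have der: "(F \<zeta> h has_field_derivative of_real (L h powr (- 1 / p)) * (- a / (1 - a * z))) (at z)"
      if z: "z \<in> unit_disk" for z
    proof -
      have "((\<lambda>z. of_real (L h powr (- 1 / p)) * Ln (1 - a * z)) has_field_derivative
          of_real (L h powr (- 1 / p)) * (- a / (1 - a * z))) (at z)"
        using nn[OF z] by (auto intro!: derivative_eq_intros simp: divide_inverse)
      thus ?thesis
        by (rule has_field_derivative_transform_within_open[OF _ open_ball z]) (simp add: F_eq a_def)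
    qed
    have Fd: "F \<zeta> h \<in> disk_analytic"
    proof -
      have "F \<zeta> h holomorphic_on unit_disk" unfolding holomorphic_on_open[OF open_ball] using der by blast
      thus ?thesis by (auto simp: disk_analytic_def F_def)
    qed
    have "dirichlet_energy (p - 2) p (F \<zeta> h) \<le> ennreal ((1 / L h) * 2 powr (p - 2 + 2) * 2 powr \<bar>p - 2\<bar>) *
      kernel_integral (p - 2) (p - 2 + 2) h \<zeta>"
    proof (rule dirichlet_energy_cauchy_kernel_le[OF _ _ _ \<zeta> h(1) h1])
      fix z assume z: "z \<in> unit_disk"
      define y where "y = cmod (1 - a * z)"
      have y: "y > 0" using nz[OF z] by (simp add: y_def)
      have "cmod (deriv (F \<zeta> h) z) = L h powr (- 1 / p) * (cmod a / y)"
        unfolding DERIV_imp_deriv[OF der[OF z]] norm_mult norm_divide y_def by simp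
      also have "\<dots> \<le> L h powr (- 1 / p) * (1 / y)"
        using a y by (intro mult_left_mono divide_right_mono) auto
      finally have "cmod (deriv (F \<zeta> h) z) powr p \<le> (L h powr (- 1 / p) * (1 / y)) powr p"
        using p by (intro powr_mono2) auto
      also have "\<dots> = 1 / L h * y powr (- (p - 2 + 2))"
        using p y Lpos[OF h] by (simp add: powr_mult powr_divide powr_powr powr_minus_divide)
      finally show "cmod (deriv (F \<zeta> h) z) powr p \<le> 1 / L h * cmod (cauchy_factor \<zeta> h z) powr (- (p - 2 + 2))"
        by (simp add: y_def a_def)
    qed (use p Lpos[OF h] in auto)
    also have "\<dots> \<le> ennreal ((1 / L h) * 2 powr (p - 2 + 2) * 2 powr \<bar>p - 2\<bar>) * ennreal (C * ln (1 / h))"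
      using C(2) \<zeta> h by (intro mult_left_mono) auto
    also have "\<dots> = ennreal E"
    proof -
      have "(1 / L h) * 2 powr (p - 2 + 2) * 2 powr \<bar>p - 2\<bar> * (C * L h) = E"
        using Lpos[OF h] by (simp add: E_def)
      thus ?thesis using C(1) Lpos[OF h] unfolding L_def by (subst ennreal_mult[symmetric]) auto
    qed
    finally have en: "dirichlet_energy (p - 2) p (F \<zeta> h) \<le> ennreal E" .
    have "dirichlet_norm (p - 2) p (F \<zeta> h) \<le> (0 powr p + E) powr (1 / p)"
      using en C p by (intro dirichlet_norm_leI Fd) (auto simp: E_def F_eq)
    thus ?thesis using Fd order.strict_trans1[OF en ennreal_less_top] by (simp add: dirichlet_space_iff)
  qed
  have A: "\<exists>M. \<forall>\<zeta> h. small_scale \<zeta> h \<longrightarrow> F \<zeta> h \<in> dirichlet_space (p - 2) p \<and> dirichlet_norm (p - 2) p (F \<zeta> h) \<le> M"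
    by (rule exI[of _ "(0 powr p + E) powr (1 / p)"]) (use bounded in auto)
  have B: "\<exists>c>0. \<forall>\<zeta> h z. small_scale \<zeta> h \<and> cmod z < 1 \<and> cmod (cauchy_factor \<zeta> h z) \<le> 9 * h \<longrightarrow>
      c * L h powr (1 - 1 / p) \<le> cmod (F \<zeta> h z)"
    proof (intro exI[of _ "1 / 2"] conjI allI impI)
      fix \<zeta> z :: complex and h :: real
      assume H: "small_scale \<zeta> h \<and> cmod z < 1 \<and> cmod (cauchy_factor \<zeta> h z) \<le> 9 * h"
      define w where "w = 1 - of_real (1 - h) * cnj \<zeta> * z"
      have w: "0 < cmod w" "cmod w \<le> 9 * h" using cauchy_kernel_lower_bounds(2)[of \<zeta> h z] H by (auto simp: w_def)
      \<comment> \<open>Thus (cmod w)^2 \<le> h, and the real part ln (cmod w) of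
        \<open>Ln w\<close> is at most - L h / 2.\<close>
      have "(9 * h)\<^sup>2 \<le> h" using H by (simp add: power2_eq_square field_simps)
      moreover have "(cmod w)\<^sup>2 \<le> (9 * h)\<^sup>2" using w by (intro power_mono) auto
      ultimately have "ln ((cmod w)\<^sup>2) \<le> ln h" using w H by (subst ln_le_cancel_iff) auto
      hence "ln (cmod w) \<le> - (1 / 2 * L h)" using w H by (simp add: ln_realpow L_def ln_div)
      moreover have "\<bar>Re (Ln w)\<bar> \<le> cmod (Ln w)" by (rule abs_Re_le_cmod)
      ultimately have "1 / 2 * L h \<le> cmod (Ln w)" using w by auto
      hence "L h powr (- 1 / p) * (1 / 2 * L h) \<le> L h powr (- 1 / p) * cmod (Ln w)" by (intro mult_left_mono) auto
      moreover have "L h powr (1 - 1 / p) = L h powr (- 1 / p) * L h"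
        using Lpos[of h] H powr_add[of "L h" "- 1 / p" 1] by (simp add: add.commute)
      ultimately show "1 / 2 * L h powr (1 - 1 / p) \<le> cmod (F \<zeta> h z)"
        using H by (simp add: F_eq norm_mult w_def)
    qed simp
  have D: "\<exists>B \<epsilon>. (\<epsilon> \<longlongrightarrow> 0) (at_right 0) \<and> (\<forall>\<zeta> h. small_scale \<zeta> h \<longrightarrow> cmod (F \<zeta> h z) \<le> \<epsilon> h * B)"
    if z: "cmod z < 1" for z
    proof (intro exI[of _ "(1 - ln (1 - cmod z)) + pi"] exI[of _ "\<lambda>h. L h powr (- 1 / p)"] conjI allI impI)
      have "filterlim L at_top (at_right 0)"
        unfolding L_def
        by (rule filterlim_compose[OF ln_at_top]) (simp add: filterlim_inverse_at_top_right flip: inverse_eq_divide)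
      thus "((\<lambda>h. L h powr (- 1 / p)) \<longlongrightarrow> 0) (at_right 0)"
        using p by (intro tendsto_neg_powr) auto
      fix \<zeta> :: complex and h :: real assume H: "small_scale \<zeta> h"
      define w where "w = 1 - of_real (1 - h) * cnj \<zeta> * z"
      have w: "1 - cmod z \<le> cmod w" "cmod w \<le> 2" using cauchy_kernel_lower_bounds(2,3)[of \<zeta> h z] H z by (auto simp: w_def)
      have w0: "w \<noteq> 0" using w z by auto
      have "ln (1 - cmod z) \<le> ln (cmod w)" using w z by (subst ln_le_cancel_iff) auto
      moreover have "ln (cmod w) \<le> ln 2" using w w0 by (subst ln_le_cancel_iff) auto
      moreover have "ln (1 - cmod z) \<le> 0" using z by simp
      ultimately have "\<bar>ln (cmod w)\<bar> \<le> 1 - ln (1 - cmod z)" using ln_2_less_1 by linarith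
      moreover have "\<bar>Im (Ln w)\<bar> \<le> pi" using mpi_less_Im_Ln[OF w0] Im_Ln_le_pi[OF w0] by auto
      moreover have "cmod (Ln w) \<le> \<bar>Re (Ln w)\<bar> + \<bar>Im (Ln w)\<bar>" by (rule cmod_le)
      ultimately have "cmod (Ln w) \<le> (1 - ln (1 - cmod z)) + pi" using w0 by simp
      hence "L h powr (- 1 / p) * cmod (Ln w) \<le> L h powr (- 1 / p) * ((1 - ln (1 - cmod z)) + pi)" by (intro mult_left_mono) auto
      thus "cmod (F \<zeta> h z) \<le> L h powr (- 1 / p) * ((1 - ln (1 - cmod z)) + pi)"
        using z by (simp add: F_eq norm_mult w_def)
    qed
  have "concentrating_family (p - 2) p (\<lambda>h. L h powr (1 - 1 / p)) F"
    unfolding concentrating_family_def by (intro conjI allI impI A B D)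
  thus ?thesis unfolding L_def by blast
qed

text \<open>Failure of the condition gives shrinking arcs whose squares carry mass above \<epsilon>
  \<phi>. A test function at the scale of such an arc has size at least c \<Lambda> on its square,
  and \<open>\<Lambda> h powr q * \<phi> h = 1\<close> leaves the lower bound c powr q times
  \<epsilon>, which compactness forbids.\<close>

lemma squares_little_o_if_compact:
  fixes \<alpha> \<beta> p q :: real
  assumes comp: "compact_dirichlet_operator \<alpha> p \<beta> q (volterra g)" and q: "q > 0" and g: "g \<in> disk_analytic"
    and F: "concentrating_family \<alpha> p \<Lambda> F"
    and \<phi>: "\<And>h. 0 < h \<Longrightarrow> h \<le> 1 / 81 \<Longrightarrow> \<Lambda> h > 0 \<and> \<Lambda> h powr q * \<phi> h = 1"
  shows "squares_little_o (dirichlet_measure g q \<beta>) \<phi>"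
proof (rule ccontr)
  define \<mu> where "\<mu> = dirichlet_measure g q \<beta>"
  assume "\<not> squares_little_o (dirichlet_measure g q \<beta>) \<phi>"
  then obtain \<epsilon> where \<epsilon>: "\<epsilon> > 0" and bad: "\<And>\<delta>. \<delta> > 0 \<Longrightarrow> \<exists>I. circle_arc I \<and> 0 < arc_length I \<and> arc_length I < \<delta> \<and>
      \<not> emeasure \<mu> (carleson_square I) \<le> ennreal (\<epsilon> * \<phi> (arc_length I))"
    unfolding squares_little_o_def \<mu>_def by auto
  \<comment> \<open>The shift by 81 puts all lengths into the range of \<open>small_scale\<close>
    while they tend to 0.\<close>
  have "\<exists>I. circle_arc I \<and> 0 < arc_length I \<and> arc_length I < 1 / real (n + 81) \<and>
      \<not> emeasure \<mu> (carleson_square I) \<le> ennreal (\<epsilon> * \<phi> (arc_length I))" for n :: nat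
    by (rule bad) simp
  then obtain I where I: "\<And>n. circle_arc (I n)" "\<And>n. 0 < arc_length (I n)" "\<And>n. arc_length (I n) < 1 / real (n + 81)"
      "\<And>n. \<not> emeasure \<mu> (carleson_square (I n)) \<le> ennreal (\<epsilon> * \<phi> (arc_length (I n)))" by metis
  define h where "h = (\<lambda>n. arc_length (I n))"
  have h: "0 < h n" "h n \<le> 1 / 81" for n
  proof -
    show "0 < h n" using I(2) by (simp add: h_def)
    have "1 / real (n + 81) \<le> 1 / 81" by (intro divide_left_mono) auto
    thus "h n \<le> 1 / 81" using I(3)[of n] unfolding h_def by linarith
  qed
  have "I n \<noteq> {}" for n using h(1)[of n] by (auto simp: h_def arc_length_def)
  hence "\<exists>z. z \<in> I n" for n by blast
  then obtain \<zeta> where \<zeta>: "\<And>n. \<zeta> n \<in> I n" by metis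
  have \<zeta>1: "cmod (\<zeta> n) = 1" for n using \<zeta>[of n] I(1)[of n] by (auto simp: circle_arc_def)
  obtain M where M: "\<forall>\<zeta> h. small_scale \<zeta> h \<longrightarrow> F \<zeta> h \<in> dirichlet_space \<alpha> p \<and> dirichlet_norm \<alpha> p (F \<zeta> h) \<le> M"
    using F unfolding concentrating_family_def by (elim conjE exE)
  obtain c where c: "c > 0" "\<forall>\<zeta> h z. small_scale \<zeta> h \<and> cmod z < 1 \<and> cmod (cauchy_factor \<zeta> h z) \<le> 9 * h \<longrightarrow>
      c * \<Lambda> h \<le> cmod (F \<zeta> h z)"
    using F unfolding concentrating_family_def by (elim conjE exE)
  define f where "f = (\<lambda>n. F (\<zeta> n) (h n))"
  \<comment> \<open>9 = 2 + 7: the radial defect 1 - (1 - h) r is at most 2 h, and the arc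
    contributes at most 2 pi h \<le> 7 h.\<close>
  have near: "cmod (cauchy_factor (\<zeta> n) (h n) z) \<le> 9 * h n" if square: "z \<in> carleson_square (I n)" for n z
  proof -
    obtain r w where z: "z = of_real r * w" "w \<in> I n" "1 - h n \<le> r" "r < 1"
      using square by (auto simp: carleson_square_def h_def)
    have r: "0 \<le> r" using z(3) h(2)[of n] by simp
    have "cmod (\<zeta> n - w) \<le> 2 * pi * h n"
      unfolding h_def by (rule circle_arc_dist_le[OF I(1) \<zeta> z(2)]) (use h(2)[of n] in \<open>simp add: h_def\<close>)
    also have "\<dots> \<le> 7 * h n" using h(1)[of n] pi_approx by (intro mult_right_mono) auto
    finally have dist: "cmod (\<zeta> n - w) \<le> 7 * h n" .
    define s where "s = (1 - h n) * r"
    have s: "0 \<le> s" "s \<le> 1" "1 - s \<le> 2 * h n"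
    proof -
      show "0 \<le> s" using r h(2)[of n] by (simp add: s_def)
      show "s \<le> 1" unfolding s_def using r z(4) h[of n] by (intro mult_le_one) auto
      have "(1 - h n) * (1 - h n) \<le> s" unfolding s_def using z(3) h(2)[of n] by (intro mult_left_mono) auto
      moreover have "(1 - h n) * (1 - h n) \<ge> 1 - 2 * h n" by (simp add: algebra_simps)
      ultimately show "1 - s \<le> 2 * h n" by simp
    qed
    have unit: "cnj (\<zeta> n) * \<zeta> n = 1" using \<zeta>1[of n] by (simp add: complex_norm_square[symmetric] mult.commute)
    have "1 - of_real (1 - h n) * cnj (\<zeta> n) * z = of_real (1 - s) + of_real s * (cnj (\<zeta> n) * (\<zeta> n - w))"
      using unit by (simp add: z(1) s_def algebra_simps)
    hence "cmod (cauchy_factor (\<zeta> n) (h n) z) \<le> cmod (of_real (1 - s)) + cmod (of_real s * (cnj (\<zeta> n) * (\<zeta> n - w)))"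
      using norm_triangle_ineq by metis
    also have "\<dots> = (1 - s) + s * cmod (\<zeta> n - w)"
      unfolding norm_mult norm_of_real complex_mod_cnj using s \<zeta>1[of n] by simp
    also have "s * cmod (\<zeta> n - w) \<le> 1 * (7 * h n)" using s dist by (intro mult_mono) auto
    finally show ?thesis using s(3) by simp
  qed
  have disk: "cmod z < 1" if "z \<in> carleson_square (I n)" for n z
    using that carleson_square_eq[OF I(1)[of n]] h(2)[of n] by (auto simp: h_def)
  show False
  proof (rule compact_volterra_contradiction[OF comp q g])
    show "f n \<in> dirichlet_space \<alpha> p" "dirichlet_norm \<alpha> p (f n) \<le> M" for n
      using M h[of n] \<zeta>1[of n] by (auto simp: f_def)
    show "c powr q * \<epsilon> > 0" using c \<epsilon> by simp
    show "(\<lambda>n. f n z) \<longlonglongrightarrow> 0" if z: "z \<in> unit_disk" for z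
    proof -
      obtain B \<epsilon>' where B: "(\<epsilon>' \<longlongrightarrow> 0) (at_right 0)"
        "\<forall>\<zeta> h. small_scale \<zeta> h \<longrightarrow> cmod (F \<zeta> h z) \<le> \<epsilon>' h * B"
        using F z unfolding concentrating_family_def by auto
      have "h \<longlonglongrightarrow> 0"
      proof (rule tendsto_sandwich[OF _ _ tendsto_const])
        show "\<forall>\<^sub>F n in sequentially. h n \<le> 1 / real (n + 81)" using I(3) unfolding h_def by (intro always_eventually allI less_imp_le)
        show "(\<lambda>n. 1 / real (n + 81)) \<longlonglongrightarrow> 0" by (rule LIMSEQ_ignore_initial_segment[OF lim_1_over_n])
      qed (use h in \<open>auto intro!: always_eventually less_imp_le\<close>)
      moreover have "h n \<in> {0<..} \<and> h n \<noteq> 0" for n using h(1)[of n] by simp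
      ultimately have "filterlim h (at_right 0) sequentially"
        by (simp add: filterlim_at)
      hence "(\<lambda>n. \<epsilon>' (h n)) \<longlonglongrightarrow> 0" using B(1) filterlim_compose by blast
      hence "(\<lambda>n. \<epsilon>' (h n) * B) \<longlonglongrightarrow> 0 * B" by (intro tendsto_intros)
      moreover have "\<forall>\<^sub>F n in sequentially. norm (f n z) \<le> \<epsilon>' (h n) * B"
        using B(2) h \<zeta>1 by (intro always_eventually) (auto simp: f_def)
      ultimately show ?thesis by (intro Lim_null_comparison[of "\<lambda>n. f n z" "\<lambda>n. \<epsilon>' (h n) * B"]) auto
    qed
    fix n
    \<comment> \<open>Measurability is forced: a nonmeasurable set has \<open>emeasure\<close> 0 and
      could not violate the bound.\<close>
    have meas: "carleson_square (I n) \<in> sets \<mu>" using I(4)[of n] emeasure_notin_sets[of "carleson_square (I n)" \<mu>] by force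
    have \<phi>n: "\<Lambda> (h n) > 0" "\<Lambda> (h n) powr q * \<phi> (h n) = 1" using \<phi>[OF h[of n]] by auto
    have "ennreal (c powr q * \<epsilon>) = ennreal ((c * \<Lambda> (h n)) powr q) * ennreal (\<epsilon> * \<phi> (h n))"
    proof -
      have "c powr q * \<epsilon> = (c * \<Lambda> (h n)) powr q * (\<epsilon> * \<phi> (h n))"
        using \<phi>n(2) c \<phi>n(1) by (simp add: powr_mult)
      hence "ennreal (c powr q * \<epsilon>) = ennreal ((c * \<Lambda> (h n)) powr q * (\<epsilon> * \<phi> (h n)))" by (rule arg_cong)
      also have "\<dots> = ennreal ((c * \<Lambda> (h n)) powr q) * ennreal (\<epsilon> * \<phi> (h n))" by (rule ennreal_mult') simp
      finally show ?thesis .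
    qed
    also have "\<dots> \<le> ennreal ((c * \<Lambda> (h n)) powr q) * emeasure \<mu> (carleson_square (I n))"
      using I(4)[of n] by (intro mult_left_mono) (auto simp: h_def not_le intro: less_imp_le)
    also have "\<dots> = (\<integral>\<^sup>+z. ennreal ((c * \<Lambda> (h n)) powr q) * indicator (carleson_square (I n)) z \<partial>\<mu>)"
      by (rule nn_integral_cmult_indicator[OF meas, symmetric])
    also have "\<dots> \<le> (\<integral>\<^sup>+z. ennreal (cmod (f n z) powr q) \<partial>\<mu>)"
    proof (rule nn_integral_mono)
      fix z
      show "ennreal ((c * \<Lambda> (h n)) powr q) * indicator (carleson_square (I n)) z \<le> ennreal (cmod (f n z) powr q)"
      proof (cases "z \<in> carleson_square (I n)")
        case True
        have "c * \<Lambda> (h n) \<le> cmod (f n z)" using c(2) \<zeta>1 h near[OF True] disk[OF True] by (simp add: f_def)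
        hence "(c * \<Lambda> (h n)) powr q \<le> cmod (f n z) powr q" using c(1) \<phi>n q by (intro powr_mono2) auto
        thus ?thesis using True by (simp add: ennreal_leI)
      qed simp
    qed
    finally show "ennreal (c powr q * \<epsilon>) \<le> (\<integral>\<^sup>+z. ennreal (cmod (f n z) powr q) \<partial>dirichlet_measure g q \<beta>)"
      by (simp add: \<mu>_def)
  qed
qed

section \<open>From Carleson squares to compactness\<close>

text \<open>Put d = 1 - cmod u. A point z within 3 d of u is within 4 d of the boundary point in
  direction u, so its angle deviates by at most 6 times 4 d = 24 d. The arc has length 24 d / pi
  \<ge> 4 d, enough for the radial extent; d < 1 / 24 keeps the length below 1.\<close>

lemma radial_cones_subset_carleson_square:
  assumes u: "cmod u < 1" "1 - cmod u < 1 / 24"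
  obtains I where "circle_arc I" "closed I" "arc_length I = 24 * (1 - cmod u) / pi"
    "{z \<in> unit_disk. u \<in> radial_cone z} \<subseteq> carleson_square I"
proof
  define d where "d = 1 - cmod u"
  have d: "0 < d" "d < 1 / 24" using u by (auto simp: d_def)
  define \<theta> where "\<theta> = Arg u"
  define I where "I = cis ` {\<theta> - 24 * d..\<theta> + 24 * d}"
  show "circle_arc I" "closed I" unfolding I_def by (rule circle_arc_Icc, rule closed_cis_Icc)
  have "arc_length I = 24 * d / pi"
    unfolding I_def using d pi_gt3 by (intro arc_length_Icc) linarith+
  thus al: "arc_length I = 24 * (1 - cmod u) / pi" by (simp add: d_def)
  have al4: "4 * d \<le> arc_length I" "arc_length I < 1"
  proof -
    have "pi * (4 * d) \<le> 24 * d" using d pi_less_4 mult_right_mono[of pi 6 "4 * d"] by simp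
    thus "4 * d \<le> arc_length I" unfolding al d_def[symmetric] by (simp add: field_simps)
    show "arc_length I < 1" unfolding al d_def[symmetric] using d pi_gt3 by (simp add: divide_less_eq)
  qed
  show "{z \<in> unit_disk. u \<in> radial_cone z} \<subseteq> carleson_square I"
  proof
    fix z assume "z \<in> {z \<in> unit_disk. u \<in> radial_cone z}"
    hence z: "cmod z < 1" "cmod (z - u) < 3 * d" by (auto simp: radial_cone_def d_def)
    have "cis \<theta> - u = of_real d * cis \<theta>"
      using rcis_cmod_Arg[of u] by (simp add: rcis_def d_def \<theta>_def algebra_simps)
    hence "cmod (cis \<theta> - u) = d" using d by (simp add: norm_mult)
    hence dist: "cmod (z - cis \<theta>) < 4 * d"
      using z(2) norm_triangle_ineq[of "z - u" "u - cis \<theta>"] by (simp add: norm_minus_commute)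
    obtain v where v: "z = of_real (cmod z) * cis v * cis \<theta>" "\<bar>v\<bar> \<le> 6 * cmod (z - cis \<theta>)"
      using near_boundary_point[of "cis \<theta>" z] z(1) by auto
    have zl: "1 - cmod z < 4 * d"
      using norm_triangle_ineq2[of "cis \<theta>" z] dist by (simp add: norm_minus_commute)
    hence zpos: "cmod z > 0" using d by linarith
    have "sgn z = cis (v + \<theta>)"
    proof -
      have "z = of_real (cmod z) * cis (v + \<theta>)" using v(1) by (simp add: mult.assoc cis_mult)
      thus ?thesis using zpos by (metis nonzero_mult_div_cancel_left norm_eq_zero less_irrefl of_real_eq_0_iff sgn_eq)
    qed
    moreover have "v + \<theta> \<in> {\<theta> - 24 * d..\<theta> + 24 * d}" using v(2) dist by auto
    ultimately have "sgn z \<in> I" unfolding I_def by blast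
    thus "z \<in> carleson_square I"
      unfolding carleson_square_eq[OF \<open>circle_arc I\<close> al4(2)] using z(1) zl al4(1) by simp
  qed
qed

lemma emeasure_dirichlet_measure_cball:
  assumes g: "g \<in> disk_analytic" and q: "q > 0" and r: "0 \<le> r" "r < 1"
  shows "emeasure (dirichlet_measure g q \<beta>) (cball 0 r) < \<infinity>"
proof -
  define w where "w = (\<lambda>z. (1 - (cmod z)\<^sup>2) powr \<beta> * cmod (deriv g z) powr q)"
  have sub: "cball 0 r \<subseteq> unit_disk" using r by auto
  have cS: "cball 0 r \<in> sets disk_area" by (intro in_sets_disk_area sub) auto
  note [measurable] = borel_measurable_disk_analytic[OF g] borel_measurable_cmod_disk_area
  have wm: "(\<lambda>z. ennreal (w z)) \<in> borel_measurable disk_area" unfolding w_def by measurable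
  have "continuous_on (cball 0 r) (deriv g)"
    using g sub by (intro continuous_on_subset[OF holomorphic_on_imp_continuous_on[OF holomorphic_deriv] sub])
      (auto simp: disk_analytic_def)
  hence "bounded (deriv g ` cball 0 r)" by (intro compact_imp_bounded compact_continuous_image) auto
  then obtain b where b: "b > 0" "\<forall>x\<in>deriv g ` cball 0 r. cmod x \<le> b" unfolding bounded_pos by blast
  have pos: "1 - (cmod z)\<^sup>2 > 0" if "z \<in> cball 0 r" for z
  proof -
    have "cmod z < 1" using that r by simp
    thus ?thesis by (simp add: power_less_one_iff abs_square_less_1)
  qed
  have "continuous_on (cball 0 r) (\<lambda>z::complex. (1 - (cmod z)\<^sup>2) powr \<beta>)"
    using pos by (intro continuous_intros) force
  hence "bounded ((\<lambda>z::complex. (1 - (cmod z)\<^sup>2) powr \<beta>) ` cball 0 r)"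
    by (intro compact_imp_bounded compact_continuous_image) auto
  then obtain a where a: "a > 0" "\<forall>x\<in>(\<lambda>z::complex. (1 - (cmod z)\<^sup>2) powr \<beta>) ` cball 0 r. \<bar>x\<bar> \<le> a"
    unfolding bounded_pos by auto
  have "emeasure (dirichlet_measure g q \<beta>) (cball 0 r) =
      (\<integral>\<^sup>+z. ennreal (w z) * indicator (cball 0 r) z \<partial>disk_area)"
    unfolding dirichlet_measure_def w_def by (rule emeasure_density[OF wm[unfolded w_def] cS])
  also have "\<dots> \<le> (\<integral>\<^sup>+z. ennreal (a * b powr q) * indicator (cball 0 r) z \<partial>disk_area)"
  proof (rule nn_integral_mono)
    fix z
    show "ennreal (w z) * indicator (cball 0 r) z \<le> ennreal (a * b powr q) * indicator (cball 0 r) z"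
    proof (cases "z \<in> cball 0 r")
      case True
      have "(1 - (cmod z)\<^sup>2) powr \<beta> \<le> a" using a(2) True by fastforce
      moreover have "cmod (deriv g z) powr q \<le> b powr q" using b(2) True q by (intro powr_mono2) auto
      ultimately have "w z \<le> a * b powr q" unfolding w_def using a(1) by (intro mult_mono) auto
      thus ?thesis using True by (simp add: ennreal_leI)
    qed simp
  qed
  also have "\<dots> = ennreal (a * b powr q) * emeasure disk_area (cball 0 r)"
    by (rule nn_integral_cmult_indicator[OF cS])
  also have "\<dots> < \<infinity>" by (simp add: disk_area.emeasure_eq_measure ennreal_mult_less_top)
  finally show ?thesis .
qed

text \<open>Equal arcs of one small length cover the circle, so finitely many squares of finite mass
  cover an annulus at the boundary; the remaining compact disk has finite mass anyway.\<close>

lemma finite_measure_if_squares_little_o: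
  assumes g: "g \<in> disk_analytic" and q: "q > 0" and sq: "squares_little_o (dirichlet_measure g q \<beta>) \<phi>"
  shows "finite_measure (dirichlet_measure g q \<beta>)"
proof
  define \<mu> where "\<mu> = dirichlet_measure g q \<beta>"
  obtain \<delta> where \<delta>: "\<delta> > 0" "\<And>I. circle_arc I \<Longrightarrow> 0 < arc_length I \<Longrightarrow> arc_length I < \<delta> \<Longrightarrow>
      emeasure \<mu> (carleson_square I) \<le> ennreal (1 * \<phi> (arc_length I))"
    using sq unfolding squares_little_o_def \<mu>_def by (metis zero_less_one)
  \<comment> \<open>N > 1 makes the arc length 1 / N less than 1, as the description of squares by
    modulus and direction requires.\<close>
  obtain N where N: "1 / \<delta> < real N" "N > 1"
  proof -
    obtain n where "1 / \<delta> < real n" using reals_Archimedean2 by blast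
    thus ?thesis using that[of "n + 2"] by auto
  qed
  have N\<delta>: "1 / real N < \<delta>" using N \<delta>(1) by (simp add: field_simps)
  define \<theta> where "\<theta> = (\<lambda>j::nat. 2 * pi * real j / real N)"
  define I where "I = (\<lambda>j. cis ` {\<theta> j - pi / real N..\<theta> j + pi / real N})"
  have al: "arc_length (I j) = 1 / real N" for j
    unfolding I_def using N by (subst arc_length_Icc) (auto simp: field_simps)
  have ca: "circle_arc (I j)" "closed (I j)" for j
    unfolding I_def by (rule circle_arc_Icc, rule closed_cis_Icc)
  have al1: "arc_length (I j) < 1" for j unfolding al using N by simp
  have Isub: "carleson_square (I j) \<in> sets \<mu>" for j
  proof -
    have "carleson_square (I j) \<subseteq> unit_disk" unfolding carleson_square_eq[OF ca(1) al1] by auto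
    thus ?thesis using carleson_square_borel[OF ca(1) al1 ca(2)] by (simp add: \<mu>_def in_sets_disk_area)
  qed
  have fin: "emeasure \<mu> (carleson_square (I j)) < \<infinity>" for j
    using \<delta>(2)[OF ca(1), of j] N\<delta> N by (auto simp: al intro: order.strict_trans1)
  define \<rho> where "\<rho> = 1 - 1 / real N"
  have \<rho>: "0 \<le> \<rho>" "\<rho> < 1" using N by (auto simp: \<rho>_def)
  have cover: "unit_disk \<subseteq> cball 0 \<rho> \<union> (\<Union>j\<in>{..N}. carleson_square (I j))"
  proof
    fix z :: complex assume z: "z \<in> unit_disk"
    show "z \<in> cball 0 \<rho> \<union> (\<Union>j\<in>{..N}. carleson_square (I j))"
    proof (cases "cmod z \<le> \<rho>")
      case False
      hence z0: "z \<noteq> 0" using \<rho> by auto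
      define t where "t = Arg2pi z"
      have t: "0 \<le> t" "t < 2 * pi" using Arg2pi[of z] by (auto simp: t_def)
      have "z = of_real (cmod z) * cis t" using Arg2pi[of z] by (simp add: is_Arg_def t_def cis_conv_exp)
      hence sz: "sgn z = cis t" using z0 by (metis nonzero_mult_div_cancel_left norm_eq_zero of_real_eq_0_iff sgn_eq)
      define y where "y = t * real N / (2 * pi)"
      have y: "0 \<le> y" "y < real N" using t N by (auto simp: y_def field_simps)
      \<comment> \<open>Rounding to the nearest index may return N, whose arc coincides with that of
        0; hence the index range includes N.\<close>
      define j where "j = nat \<lfloor>y + 1 / 2\<rfloor>"
      have jy: "real j \<le> y + 1 / 2" "y - 1 / 2 < real j" using y by (auto simp: j_def) linarith+
      have "real j < real N + 1" using jy y by linarith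
      hence jN: "j \<le> N" by linarith
      have "t = 2 * pi * y / real N" using N by (simp add: y_def)
      hence "t - \<theta> j = 2 * pi / real N * (y - real j)"
        by (simp add: \<theta>_def right_diff_distrib diff_divide_distrib)
      moreover have "\<bar>y - real j\<bar> \<le> 1 / 2" using jy by linarith
      hence "\<bar>2 * pi / real N * (y - real j)\<bar> \<le> 2 * pi / real N * (1 / 2)"
        unfolding abs_mult by (intro mult_mono) auto
      ultimately have "\<bar>t - \<theta> j\<bar> \<le> pi / real N" by simp
      hence "t \<in> {\<theta> j - pi / real N..\<theta> j + pi / real N}" by (auto simp: abs_le_iff)
      hence "sgn z \<in> I j" unfolding I_def sz by blast
      moreover have "1 - arc_length (I j) \<le> cmod z" using False by (simp add: al \<rho>_def)
      ultimately have "z \<in> carleson_square (I j)"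
        unfolding carleson_square_eq[OF ca(1) al1] using z by simp
      thus ?thesis using jN by blast
    qed simp
  qed
  have cb: "cball 0 \<rho> \<in> sets \<mu>" using \<rho> by (auto simp: \<mu>_def intro!: in_sets_disk_area)
  have "emeasure \<mu> unit_disk \<le> emeasure \<mu> (cball 0 \<rho> \<union> (\<Union>j\<in>{..N}. carleson_square (I j)))"
    using cover cb Isub by (intro emeasure_mono) auto
  also have "\<dots> \<le> emeasure \<mu> (cball 0 \<rho>) + emeasure \<mu> (\<Union>j\<in>{..N}. carleson_square (I j))"
    using cb Isub by (intro emeasure_subadditive) auto
  also have "\<dots> \<le> emeasure \<mu> (cball 0 \<rho>) + (\<Sum>j\<le>N. emeasure \<mu> (carleson_square (I j)))"
    using Isub by (intro add_left_mono emeasure_subadditive_finite) auto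
  also have "\<dots> < \<infinity>"
    using emeasure_dirichlet_measure_cball[OF g q \<rho>, of \<beta>] fin by (simp add: \<mu>_def)
  finally show "emeasure (dirichlet_measure g q \<beta>) (space (dirichlet_measure g q \<beta>)) \<noteq> \<infinity>"
    by (simp add: \<mu>_def)
qed

text \<open>Continuity from above for a finite measure, along annuli with empty
  intersection.\<close>

lemma dirichlet_measure_tail_small:
  assumes fin: "finite_measure (dirichlet_measure g q \<beta>)" and \<epsilon>: "\<epsilon> > 0"
  shows "\<exists>R. 0 \<le> R \<and> R < 1 \<and> emeasure (dirichlet_measure g q \<beta>) {z \<in> unit_disk. R \<le> cmod z} \<le> ennreal \<epsilon>"
proof -
  define \<mu> where "\<mu> = dirichlet_measure g q \<beta>"
  interpret \<mu>: finite_measure \<mu> unfolding \<mu>_def by (rule fin)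
  define A where "A = (\<lambda>n. {z \<in> unit_disk. 1 - 1 / real (Suc n) \<le> cmod z})"
  have A: "A n \<in> sets \<mu>" for n unfolding A_def \<mu>_def sets_dirichlet_measure by (rule disk_tail_in_sets_disk_area)
  have "decseq A"
  proof (rule decseq_SucI)
    fix n
    have "1 - 1 / real (Suc n) \<le> 1 - 1 / real (Suc (Suc n))" by (simp add: field_simps)
    thus "A (Suc n) \<subseteq> A n" unfolding A_def by auto
  qed
  hence "(\<lambda>n. emeasure \<mu> (A n)) \<longlonglongrightarrow> emeasure \<mu> (\<Inter>n. A n)"
    using A by (intro Lim_emeasure_decseq) auto
  moreover have "(\<Inter>n. A n) = {}"
  proof -
    have "\<exists>n. z \<notin> A n" for z
    proof (cases "cmod z < 1")
      case True
      then obtain n where "1 / real (Suc n) < 1 - cmod z" using nat_approx_posE[of "1 - cmod z"] by auto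
      thus ?thesis by (intro exI[of _ n]) (simp add: A_def)
    qed (simp add: A_def)
    thus ?thesis by blast
  qed
  ultimately have "(\<lambda>n. emeasure \<mu> (A n)) \<longlonglongrightarrow> 0" by simp
  hence "\<forall>\<^sub>F n in sequentially. emeasure \<mu> (A n) < ennreal \<epsilon>" using \<epsilon> by (intro order_tendstoD) auto
  then obtain n where "emeasure \<mu> (A n) < ennreal \<epsilon>" by (meson eventually_happens' sequentially_bot)
  thus ?thesis
    by (intro exI[of _ "1 - 1 / real (Suc n)"] conjI) (auto simp: A_def \<mu>_def)
qed

text \<open>The embedding is applied to the part of \<mu> on an outer annulus of mass at most
  \<epsilon>1 \<psi> d0. For u within d0 of the circle the mass bound comes from a Carleson square;
  for other u the mass of the annulus suffices because \<psi> is monotone.\<close>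

lemma compact_volterra_if_squares_little_o:
  fixes \<alpha> \<beta> p q K d1 :: real
  assumes p: "0 < p" "p < q" and \<alpha>: "\<alpha> > -1" and g: "g \<in> disk_analytic"
    and sq: "squares_little_o (dirichlet_measure g q \<beta>) \<phi>"
    and cp: "carleson_pointwise \<alpha> p q \<psi>"
    and pos: "\<And>t. 0 < t \<Longrightarrow> t \<le> 1 \<Longrightarrow> \<psi> t > 0" and meas: "\<psi> \<in> borel_measurable borel"
    and mono: "\<And>s t. 0 < s \<Longrightarrow> s \<le> t \<Longrightarrow> t \<le> 1 \<Longrightarrow> \<psi> s \<le> \<psi> t"
    and K: "K > 0" "d1 > 0" and le: "\<And>d. 0 < d \<Longrightarrow> d < d1 \<Longrightarrow> \<phi> (24 * d / pi) \<le> K * \<psi> d"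
  shows "compact_dirichlet_operator \<alpha> p \<beta> q (volterra g)"
proof (rule compact_volterra_if_tails_small[OF p(1) _ _ g])
  define \<mu> where "\<mu> = dirichlet_measure g q \<beta>"
  show q: "q > 0" "\<alpha> > -2" using p \<alpha> by auto
  show fin: "finite_measure (dirichlet_measure g q \<beta>)"
    by (rule finite_measure_if_squares_little_o[OF g q(1) sq])
  interpret \<mu>: finite_measure \<mu> unfolding \<mu>_def by (rule fin)
  have posall: "\<forall>t. 0 < t \<and> t \<le> 1 \<longrightarrow> \<psi> t > 0" using pos by simp
  obtain C where C: "C > 0" "\<forall>\<nu> \<epsilon> f. sets \<nu> = sets disk_area \<and> finite_measure \<nu> \<and> \<epsilon> \<ge> 0 \<and> f \<in> disk_analytic \<and> dirichlet_energy \<alpha> p f \<le> 1 \<and>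
      (\<forall>u\<in>unit_disk. emeasure \<nu> {z \<in> unit_disk. u \<in> radial_cone z} \<le> ennreal (\<epsilon> * \<psi> (1 - cmod u))) \<longrightarrow>
    (\<integral>\<^sup>+z. ennreal (cmod (f z - f 0) powr q) \<partial>\<nu>) \<le> ennreal (C * \<epsilon>)"
    using carleson_embedding[OF cp posall meas] by (elim exE conjE)
  fix \<epsilon> :: real assume \<epsilon>: "\<epsilon> > 0"
  define \<epsilon>1 where "\<epsilon>1 = \<epsilon> / C"
  have \<epsilon>1: "\<epsilon>1 > 0" using \<epsilon> C by (simp add: \<epsilon>1_def)
  have "\<epsilon>1 / K > 0" using \<epsilon>1 K by simp
  then obtain \<delta> where \<delta>: "\<delta> > 0" "\<forall>I. circle_arc I \<and> 0 < arc_length I \<and> arc_length I < \<delta> \<longrightarrow>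
      emeasure \<mu> (carleson_square I) \<le> ennreal (\<epsilon>1 / K * \<phi> (arc_length I))"
    using sq unfolding squares_little_o_def \<mu>_def by blast
  \<comment> \<open>\<open>d1\<close> allows comparing \<phi> with \<psi>, 1 / 24 is the range in
    which cones fit into a square, and \<delta> / 8 makes the arc of length 24 d / pi < 8 d short
    enough.\<close>
  define d0 where "d0 = min (min d1 (1 / 24)) (\<delta> / 8)"
  have d0: "0 < d0" "d0 \<le> d1" "d0 \<le> 1 / 24" "d0 \<le> \<delta> / 8" using K \<delta> by (auto simp: d0_def)
  have "\<epsilon>1 * \<psi> d0 > 0" using \<epsilon>1 d0 pos by simp
  then obtain R where R: "0 \<le> R" "R < 1" "emeasure \<mu> {z \<in> unit_disk. R \<le> cmod z} \<le> ennreal (\<epsilon>1 * \<psi> d0)"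
    using dirichlet_measure_tail_small[OF fin] unfolding \<mu>_def by blast
  define T where "T = {z \<in> unit_disk. R \<le> cmod z}"
  have T: "T \<in> sets \<mu>" unfolding T_def \<mu>_def sets_dirichlet_measure by (rule disk_tail_in_sets_disk_area)
  define \<nu> where "\<nu> = density \<mu> (indicator T)"
  have s\<nu>: "sets \<nu> = sets disk_area" by (simp add: \<nu>_def \<mu>_def)
  have \<nu>_em: "emeasure \<nu> B = emeasure \<mu> (T \<inter> B)" if "B \<in> sets \<mu>" for B
    unfolding \<nu>_def using T that by (subst emeasure_density) (auto simp: nn_integral_indicator indicator_inter_arith[symmetric])
  have \<nu>_fin: "finite_measure \<nu>"
  proof
    have "emeasure \<nu> (space \<nu>) = emeasure \<mu> (T \<inter> space \<mu>)" unfolding \<nu>_em[OF sets.top, symmetric] by (simp add: \<nu>_def)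
    thus "emeasure \<nu> (space \<nu>) \<noteq> \<infinity>" by simp
  qed
  have small: "emeasure \<nu> {z \<in> unit_disk. u \<in> radial_cone z} \<le> ennreal (\<epsilon>1 * \<psi> (1 - cmod u))" if u: "u \<in> unit_disk" for u
  proof -
    define B where "B = {z \<in> unit_disk. u \<in> radial_cone z}"
    have B: "B \<in> sets \<mu>"
    proof -
      have "B = unit_disk \<inter> {z. cmod (z - u) < 3 * (1 - cmod u)}" using u by (auto simp: B_def radial_cone_def)
      also have "\<dots> \<in> sets borel" by (intro sets.Int borel_open open_ball open_Collect_less continuous_intros)
      finally show ?thesis by (auto simp: \<mu>_def B_def intro!: in_sets_disk_area)
    qed
    have u1: "0 < 1 - cmod u" "1 - cmod u \<le> 1" using u by auto
    have "emeasure \<nu> B = emeasure \<mu> (T \<inter> B)" by (rule \<nu>_em[OF B])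
    also have "\<dots> \<le> ennreal (\<epsilon>1 * \<psi> (1 - cmod u))"
    proof (cases "1 - cmod u < d0")
      case True
      have "cmod u < 1" "1 - cmod u < 1 / 24" using u1 True d0 by auto
      from radial_cones_subset_carleson_square[OF this] obtain I where I: "circle_arc I" "closed I"
        "arc_length I = 24 * (1 - cmod u) / pi" "B \<subseteq> carleson_square I" unfolding B_def by metis
      have al: "0 < arc_length I" "arc_length I < 1" "arc_length I < \<delta>"
      proof -
        show "0 < arc_length I" unfolding I(3) using u1 by simp
        have "24 * (1 - cmod u) / pi < 24 * (1 - cmod u) / 3" using u1 pi_gt3 by (intro divide_strict_left_mono) auto
        also have "\<dots> = 8 * (1 - cmod u)" by simp
        also have "\<dots> < 8 * d0" using True by simp
        finally have "arc_length I < 8 * d0" unfolding I(3) .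
        thus "arc_length I < 1" "arc_length I < \<delta>" using d0 by auto
      qed
      have "carleson_square I \<subseteq> unit_disk" unfolding carleson_square_eq[OF I(1) al(2)] by auto
      hence Sm: "carleson_square I \<in> sets \<mu>"
        using carleson_square_borel[OF I(1) al(2) I(2)] by (simp add: \<mu>_def in_sets_disk_area)
      have "emeasure \<mu> (T \<inter> B) \<le> emeasure \<mu> (carleson_square I)" using I(4) Sm by (intro emeasure_mono) auto
      also have "\<dots> \<le> ennreal (\<epsilon>1 / K * \<phi> (24 * (1 - cmod u) / pi))" using \<delta>(2) I(1,3) al by metis
      also have "\<dots> \<le> ennreal (\<epsilon>1 / K * (K * \<psi> (1 - cmod u)))"
        using le[of "1 - cmod u"] True d0 u1 \<epsilon>1 K by (intro ennreal_leI mult_left_mono) auto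
      also have "\<epsilon>1 / K * (K * \<psi> (1 - cmod u)) = \<epsilon>1 * \<psi> (1 - cmod u)" using K by simp
      finally show ?thesis .
    next
      case False
      have "emeasure \<mu> (T \<inter> B) \<le> emeasure \<mu> T" using T by (intro emeasure_mono) auto
      also have "\<dots> \<le> ennreal (\<epsilon>1 * \<psi> d0)" using R(3) by (simp add: T_def)
      also have "\<dots> \<le> ennreal (\<epsilon>1 * \<psi> (1 - cmod u))"
        using mono[of d0 "1 - cmod u"] False d0 u1 \<epsilon>1 by (intro ennreal_leI mult_left_mono) auto
      finally show ?thesis .
    qed
    finally show ?thesis by (simp add: B_def)
  qed
  have "tail_integral (dirichlet_measure g q \<beta>) q R f \<le> ennreal \<epsilon>"
    if f: "f \<in> disk_analytic" "dirichlet_energy \<alpha> p f \<le> 1" for f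
  proof -
    note [measurable] = borel_measurable_disk_analytic(1)[OF f(1)]
    have m: "(\<lambda>z. ennreal (cmod (f z - f 0) powr q)) \<in> borel_measurable \<mu>" unfolding \<mu>_def by measurable
    have "(\<integral>\<^sup>+z. ennreal (cmod (f z - f 0) powr q) \<partial>\<nu>) \<le> ennreal (C * \<epsilon>1)"
      using C(2) s\<nu> \<nu>_fin \<epsilon>1 f small by (meson less_imp_le)
    also have "C * \<epsilon>1 = \<epsilon>" using C by (simp add: \<epsilon>1_def)
    also have "(\<integral>\<^sup>+z. ennreal (cmod (f z - f 0) powr q) \<partial>\<nu>) = (\<integral>\<^sup>+z. indicator T z * ennreal (cmod (f z - f 0) powr q) \<partial>\<mu>)"
      unfolding \<nu>_def using T m by (intro nn_integral_density) auto
    also have "\<dots> = tail_integral \<mu> q R f"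
      by (intro nn_integral_cong) (auto simp: T_def \<mu>_def indicator_def)
    finally show ?thesis by (simp add: \<mu>_def)
  qed
  thus "\<exists>R. 0 \<le> R \<and> R < 1 \<and> (\<forall>f\<in>disk_analytic. dirichlet_energy \<alpha> p f \<le> 1 \<longrightarrow>
      tail_integral (dirichlet_measure g q \<beta>) q R f \<le> ennreal \<epsilon>)"
    using R(1,2) by (intro exI[of _ R]) blast
qed

text \<open>With oscillations bounded by C, every tail integral is at most C powr q times the mass
  of the annulus.\<close>

lemma compact_volterra_if_finite_measure:
  fixes \<alpha> \<beta> p q :: real
  assumes p: "0 < p" "0 < q" and \<alpha>: "\<alpha> > -1" "\<alpha> + 2 < p" and g: "g \<in> disk_analytic"
    and fin: "finite_measure (dirichlet_measure g q \<beta>)"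
  shows "compact_dirichlet_operator \<alpha> p \<beta> q (volterra g)"
proof (rule compact_volterra_if_tails_small[OF p _ g fin])
  show \<alpha>2: "-2 < \<alpha>" using \<alpha> by simp
  obtain C where C: "C > 0" "\<forall>f z. f \<in> disk_analytic \<and> dirichlet_energy \<alpha> p f \<le> 1 \<and> z \<in> unit_disk \<longrightarrow> cmod (f z - f 0) \<le> C"
    using disk_analytic_oscillation_bounded[OF p(1) \<alpha>2 \<alpha>(2)] by (elim exE conjE)
  fix \<epsilon> :: real assume "\<epsilon> > 0"
  hence "\<epsilon> / C powr q > 0" using C by simp
  then obtain R where R: "0 \<le> R" "R < 1" "emeasure (dirichlet_measure g q \<beta>) {z \<in> unit_disk. R \<le> cmod z} \<le> ennreal (\<epsilon> / C powr q)"
    using dirichlet_measure_tail_small[OF fin] by blast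
  have T: "{z \<in> unit_disk. R \<le> cmod z} \<in> sets (dirichlet_measure g q \<beta>)"
    unfolding sets_dirichlet_measure by (rule disk_tail_in_sets_disk_area)
  have "tail_integral (dirichlet_measure g q \<beta>) q R f \<le> ennreal \<epsilon>"
    if f: "f \<in> disk_analytic" "dirichlet_energy \<alpha> p f \<le> 1" for f
  proof -
    have "tail_integral (dirichlet_measure g q \<beta>) q R f \<le>
      (\<integral>\<^sup>+z. ennreal (C powr q) * indicator {z \<in> unit_disk. R \<le> cmod z} z \<partial>dirichlet_measure g q \<beta>)"
    proof (rule nn_integral_mono)
      fix z assume "z \<in> space (dirichlet_measure g q \<beta>)"
      hence z: "z \<in> unit_disk" by simp
      hence "cmod (f z - f 0) \<le> C" using C(2) f by blast
      hence "cmod (f z - f 0) powr q \<le> C powr q" using p by (intro powr_mono2) auto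
      thus "ennreal (cmod (f z - f 0) powr q) * indicator {z. R \<le> cmod z} z \<le>
          ennreal (C powr q) * indicator {z \<in> unit_disk. R \<le> cmod z} z"
        using z by (auto simp: indicator_def ennreal_leI)
    qed
    also have "\<dots> = ennreal (C powr q) * emeasure (dirichlet_measure g q \<beta>) {z \<in> unit_disk. R \<le> cmod z}"
      by (rule nn_integral_cmult_indicator[OF T])
    also have "\<dots> \<le> ennreal (C powr q) * ennreal (\<epsilon> / C powr q)" by (intro mult_left_mono R) auto
    also have "\<dots> = ennreal \<epsilon>" using C(1) by (subst ennreal_mult'[symmetric]) auto
    finally show ?thesis .
  qed
  thus "\<exists>R. 0 \<le> R \<and> R < 1 \<and> (\<forall>f\<in>disk_analytic. dirichlet_energy \<alpha> p f \<le> 1 \<longrightarrow>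
      tail_integral (dirichlet_measure g q \<beta>) q R f \<le> ennreal \<epsilon>)"
    using R(1,2) by (intro exI[of _ R]) blast
qed

text \<open>The density of the measure is the energy density of g, so its total mass is the energy
  of g.\<close>

lemma finite_measure_iff_dirichlet_space:
  assumes g: "g \<in> disk_analytic"
  shows "finite_measure (dirichlet_measure g q \<beta>) \<longleftrightarrow> g \<in> dirichlet_space \<beta> q"
proof -
  have "emeasure (dirichlet_measure g q \<beta>) (space (dirichlet_measure g q \<beta>)) = (\<integral>\<^sup>+z. 1 \<partial>dirichlet_measure g q \<beta>)"
    by simp
  also have "\<dots> = dirichlet_energy \<beta> q g"
    unfolding dirichlet_energy_def
    by (subst nn_integral_dirichlet_measure[OF g]) (auto simp: dirichlet_density_def mult.commute)
  finally have "emeasure (dirichlet_measure g q \<beta>) (space (dirichlet_measure g q \<beta>)) = dirichlet_energy \<beta> q g" .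
  note total = this
  show ?thesis
  proof
    assume "finite_measure (dirichlet_measure g q \<beta>)"
    from finite_measure.emeasure_finite[OF this, of "space (dirichlet_measure g q \<beta>)"]
    show "g \<in> dirichlet_space \<beta> q" using g total by (simp add: dirichlet_space_iff top.not_eq_extremum)
  next
    assume "g \<in> dirichlet_space \<beta> q"
    thus "finite_measure (dirichlet_measure g q \<beta>)"
      by (intro finite_measureI) (simp only: total, auto simp: dirichlet_space_iff)
  qed
qed

text \<open>The test function is the constant 1, cut off to 0 outside the disk: the energy of its
  image is the total mass of the measure.\<close>

lemma finite_measure_if_compact:
  assumes comp: "compact_dirichlet_operator \<alpha> p \<beta> q (volterra g)" and g: "g \<in> disk_analytic"
  shows "finite_measure (dirichlet_measure g q \<beta>)"
proof
  define f :: "complex \<Rightarrow> complex" where "f = (\<lambda>z. if z \<in> unit_disk then 1 else 0)"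
  have fd: "(f has_field_derivative 0) (at z)" if "z \<in> unit_disk" for z
    by (rule has_field_derivative_transform_within_open[OF DERIV_const[of 1] open_ball that]) (simp add: f_def)
  have "f holomorphic_on unit_disk" unfolding holomorphic_on_open[OF open_ball] using fd by blast
  hence f: "f \<in> disk_analytic" by (auto simp: disk_analytic_def f_def)
  have "dirichlet_energy \<alpha> p f = (\<integral>\<^sup>+z. 0 \<partial>disk_area)"
    unfolding dirichlet_energy_def
    by (intro nn_integral_cong) (simp add: dirichlet_density_def DERIV_imp_deriv[OF fd])
  hence "f \<in> dirichlet_space \<alpha> p" using f by (simp add: dirichlet_space_iff)
  hence "volterra g f \<in> dirichlet_space \<beta> q" using comp by (auto simp: compact_dirichlet_operator_def)
  hence "(\<integral>\<^sup>+z. ennreal (cmod (f z) powr q) \<partial>dirichlet_measure g q \<beta>) < \<infinity>"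
    unfolding dirichlet_energy_volterra[OF g f, symmetric] by (simp add: dirichlet_space_iff)
  moreover have "(\<integral>\<^sup>+z. ennreal (cmod (f z) powr q) \<partial>dirichlet_measure g q \<beta>) = (\<integral>\<^sup>+z. 1 \<partial>dirichlet_measure g q \<beta>)"
    by (intro nn_integral_cong) (simp add: f_def)
  ultimately show "emeasure (dirichlet_measure g q \<beta>) (space (dirichlet_measure g q \<beta>)) \<noteq> \<infinity>" by simp
qed

theorem theorem6:
  fixes \<alpha> \<beta> p q :: real and g :: "complex \<Rightarrow> complex"
  assumes "\<alpha> > -1" and "\<beta> > -1"
    and "g \<in> disk_analytic"
    and "0 < p" and "p < q"
  shows "(p < \<alpha> + 2 \<longrightarrow>
            (compact_dirichlet_operator \<alpha> p \<beta> q (volterra g) \<longleftrightarrow>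
             vanishing_carleson (q * (\<alpha> + 2 - p) / p) (dirichlet_measure g q \<beta>))) \<and>
         (p = \<alpha> + 2 \<longrightarrow>
            (compact_dirichlet_operator \<alpha> p \<beta> q (volterra g) \<longleftrightarrow>
             squares_little_o (dirichlet_measure g q \<beta>)
               (\<lambda>t. ln (1 / t) powr ((1 / p - 1) * q)))) \<and>
         (p > \<alpha> + 2 \<longrightarrow>
            (compact_dirichlet_operator \<alpha> p \<beta> q (volterra g) \<longleftrightarrow>
             finite_measure (dirichlet_measure g q \<beta>)) \<and>
            (finite_measure (dirichlet_measure g q \<beta>) \<longleftrightarrow> g \<in> dirichlet_space \<beta> q))"
proof (intro conjI impI)
  have q: "q > 0" using assms by simp
  note g = assms(3)
  show "compact_dirichlet_operator \<alpha> p \<beta> q (volterra g) \<longleftrightarrow>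
      vanishing_carleson (q * (\<alpha> + 2 - p) / p) (dirichlet_measure g q \<beta>)" if \<alpha>: "p < \<alpha> + 2"
  proof
    define s where "s = q * (\<alpha> + 2 - p) / p"
    have s: "s > 0" using \<alpha> assms q by (simp add: s_def)
    {
      assume comp: "compact_dirichlet_operator \<alpha> p \<beta> q (volterra g)"
      obtain F where F: "concentrating_family \<alpha> p (\<lambda>h. h powr (- (\<alpha> + 2 - p) / p)) F"
        using concentrating_family_power[OF assms(1,4) \<alpha>] by blast
      show "vanishing_carleson (q * (\<alpha> + 2 - p) / p) (dirichlet_measure g q \<beta>)"
        unfolding vanishing_carleson_def s_def[symmetric]
      proof (rule squares_little_o_if_compact[OF comp q g F])
        fix h :: real assume h: "0 < h" "h \<le> 1 / 81"
        have "- (\<alpha> + 2 - p) / p * q + s = 0" using assms by (simp add: s_def field_simps)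
        hence "(h powr (- (\<alpha> + 2 - p) / p)) powr q * h powr s = 1"
          using h unfolding powr_powr powr_add[symmetric] by simp
        thus "h powr (- (\<alpha> + 2 - p) / p) > 0 \<and> (h powr (- (\<alpha> + 2 - p) / p)) powr q * h powr s = 1"
          using h by simp
      qed
    }
    assume "vanishing_carleson (q * (\<alpha> + 2 - p) / p) (dirichlet_measure g q \<beta>)"
    hence sq: "squares_little_o (dirichlet_measure g q \<beta>) (\<lambda>t. t powr s)"
      by (simp add: vanishing_carleson_def s_def)
    have cp: "carleson_pointwise \<alpha> p q (\<lambda>t. t powr s)"
      unfolding s_def by (rule carleson_pointwise_powr[OF assms(4,5) \<alpha>])
    show "compact_dirichlet_operator \<alpha> p \<beta> q (volterra g)"
    \<comment> \<open>Powers scale exactly, so the constant 24 / pi from the arc length simply comes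
      out as its power s.\<close>
    proof (rule compact_volterra_if_squares_little_o[where K = "(24 / pi) powr s" and ?d1.0 = 1,
          OF assms(4,5,1) g sq cp])
      show "(24 * d / pi) powr s \<le> (24 / pi) powr s * d powr s" for d
        using powr_mult[of "24 / pi" d s] by simp
      show "a powr s \<le> b powr s" if "0 < a" "a \<le> b" "b \<le> 1" for a b
        using that s by (intro powr_mono2) auto
    qed auto
  qed
  show "compact_dirichlet_operator \<alpha> p \<beta> q (volterra g) \<longleftrightarrow>
      squares_little_o (dirichlet_measure g q \<beta>) (\<lambda>t. ln (1 / t) powr ((1 / p - 1) * q))" if \<alpha>: "p = \<alpha> + 2"
  proof
    \<comment> \<open>The critical relation and \<alpha> > -1 force p > 1, so the exponent of the
      logarithm is negative and comparisons of its base are reversed.\<close>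
    have p1: "p > 1" and \<alpha>': "\<alpha> = p - 2" using \<alpha> assms(1) by auto
    define \<kappa> where "\<kappa> = (1 / p - 1) * q"
    have \<kappa>: "\<kappa> < 0" using p1 q by (simp add: \<kappa>_def mult_less_0_iff)
    {
      assume comp: "compact_dirichlet_operator \<alpha> p \<beta> q (volterra g)"
      obtain F where F: "concentrating_family \<alpha> p (\<lambda>h. ln (1 / h) powr (1 - 1 / p)) F"
        using concentrating_family_log[OF p1] unfolding \<alpha>' by blast
      show "squares_little_o (dirichlet_measure g q \<beta>) (\<lambda>t. ln (1 / t) powr ((1 / p - 1) * q))"
      proof (rule squares_little_o_if_compact[OF comp q g F])
        fix h :: real assume h: "0 < h" "h \<le> 1 / 81"
        have "(1 - 1 / p) * q + (1 / p - 1) * q = 0" by (simp add: algebra_simps)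
        moreover have "ln (1 / h) > 0" using h by simp
        ultimately show "ln (1 / h) powr (1 - 1 / p) > 0 \<and>
            (ln (1 / h) powr (1 - 1 / p)) powr q * ln (1 / h) powr ((1 / p - 1) * q) = 1"
          unfolding powr_powr powr_add[symmetric] by simp
      qed
    }
    assume "squares_little_o (dirichlet_measure g q \<beta>) (\<lambda>t. ln (1 / t) powr ((1 / p - 1) * q))"
    hence sq: "squares_little_o (dirichlet_measure g q \<beta>) (\<lambda>t. ln (1 / t) powr \<kappa>)" by (simp add: \<kappa>_def)
    have cp: "carleson_pointwise \<alpha> p q (\<lambda>t. (2 - ln t) powr \<kappa>)"
      unfolding \<alpha>' \<kappa>_def by (rule carleson_pointwise_log[OF p1 assms(5)])
    have L2: "2 - ln t \<ge> 2" if "0 < t" "t \<le> 1" for t :: real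
    proof -
      have "ln t \<le> 0" using that by simp
      thus ?thesis by simp
    qed
    show "compact_dirichlet_operator \<alpha> p \<beta> q (volterra g)"
    proof (rule compact_volterra_if_squares_little_o[where K = "4 powr (- \<kappa>)" and ?d1.0 = "exp (- 5)",
          OF assms(4,5,1) g sq cp])
      show "(2 - ln t) powr \<kappa> > 0" if "0 < t" "t \<le> 1" for t using L2[OF that] by simp
      show "(2 - ln s) powr \<kappa> \<le> (2 - ln t) powr \<kappa>" if st: "0 < s" "s \<le> t" "t \<le> 1" for s t
      proof (rule powr_mono2')
        have "0 < t" using st by simp
        from L2[OF this st(3)] show "0 < 2 - ln t" by simp
        show "2 - ln t \<le> 2 - ln s" using st by simp
      qed (use \<kappa> in simp)
      \<comment> \<open>Since 24 / pi < 8 and 3 ln 2 \<le> 3, the logarithm on the left is at least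
        - 3 - ln d. This dominates (2 - ln d) / 4 as soon as ln d \<le> - 14 / 3, which
        \<open>exp (- 5)\<close> guarantees.\<close>
      show "ln (1 / (24 * d / pi)) powr \<kappa> \<le> 4 powr (- \<kappa>) * (2 - ln d) powr \<kappa>" if d: "0 < d" "d < exp (- 5)" for d
      proof -
        have ld: "ln d < -5" using d by (metis ln_exp ln_less_cancel_iff exp_gt_zero)
        have "ln (1 / (8 * d)) \<le> ln (1 / (24 * d / pi))"
          using d pi_gt3 by (subst ln_le_cancel_iff) (auto simp: field_simps)
        moreover have "ln (1 / (8 * d)) = - (3 * ln 2) - ln d"
          using d ln_realpow[of 2 3] by (simp add: ln_div ln_mult)
        moreover have "3 * ln 2 \<le> (3 :: real)" using ln_2_less_1 by simp
        ultimately have "(2 - ln d) / 4 \<le> ln (1 / (24 * d / pi))" using ld by simp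
        hence "ln (1 / (24 * d / pi)) powr \<kappa> \<le> ((2 - ln d) / 4) powr \<kappa>"
          using ld \<kappa> by (intro powr_mono2') auto
        also have "\<dots> = 4 powr (- \<kappa>) * (2 - ln d) powr \<kappa>" by (simp add: powr_divide powr_minus_divide)
        finally show ?thesis .
      qed
    qed auto
  qed
  show "compact_dirichlet_operator \<alpha> p \<beta> q (volterra g) \<longleftrightarrow> finite_measure (dirichlet_measure g q \<beta>)" if "p > \<alpha> + 2"
    using finite_measure_if_compact[OF _ g] compact_volterra_if_finite_measure[OF assms(4) q assms(1) that g] by blast
  show "finite_measure (dirichlet_measure g q \<beta>) \<longleftrightarrow> g \<in> dirichlet_space \<beta> q"
    by (rule finite_measure_iff_dirichlet_space[OF g])
qed

end
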